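(* Let $A$ be an operator on a complex Banach space $X$ such that $A\in\mathrm{Sect}(\pi/2-)$ and $0\in\varrho(A)$. For each $\alpha\ge 0$ and $0<\omega_{\min}\le\omega_{\max}<\infty$, there exists a constant $M>0$ such that $$\left\|\left(\prod_{k=1}^n V_{\omega_k}(A)\right)A^{-\alpha}\right\|\le\frac{M}{n^{\alpha}}$$ for all $n\in\mathbb{N}$ and all $(\omega_k)_{k\in\mathbb{N}}\in\mathcal{S}(\omega_{\min},\omega_{\max})$.
   Context: $\varrho(A)$ is the resolvent set and $\sigma(A)$ the spectrum of $A$. Put $\Sigma_\theta=\{z\in\mathbb{C}\setminus\{0\}:|\arg z|<\theta\}$ for $0<\theta<\pi$ and $\Sigma_0=(0,\infty)$. A densely defined closed operator $A$ on $X$ is sectorial of angle $\theta\in[0,\pi)$ if $\sigma(A)\subset\overline{\Sigma_\theta}$ and $\sup\{\|\lambda(\lambda-A)^{-1}\|:\lambda\in\mathbb{C}\setminus\overline{\Sigma_{\theta'}}\}<\infty$ for each $\theta'\in(\theta,\pi)$; $\mathrm{Sect}(\theta)$ is the set of such operators and $\mathrm{Sect}(\pi/2-)=\bigcup_{0\le\theta<\pi/2}\mathrm{Sect}(\theta)$. Fractional powers are those of the sectorial operator $A$, with $A^{-\alpha}=(A^{\alpha})^{-1}$. For $\omega\in\varrho(-A)\cap(0,\infty)$, $V_\omega(A)=(A-\omega)(A+\omega)^{-1}$ is the Cayley transform. $\mathcal{S}(\omega_{\min},\omega_{\max})$ is the set of real sequences $(\omega_k)_{k\in\mathbb{N}}$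 with $\omega_{\min}\le\omega_k\le\omega_{\max}$ for all $k\in\mathbb{N}$. $\mathbb{N}=\{1,2,\dots\}$. *)

theory Defs
  imports "HOL-Analysis.Analysis"
begin

section \<open>Complex Banach spaces\<close>

class complex_normed_vector = real_normed_vector +
  fixes scaleC :: "complex \<Rightarrow> 'a \<Rightarrow> 'a" (infixr "*\<^sub>C" 75)
  assumes scaleC_add_right: "a *\<^sub>C (x + y) = a *\<^sub>C x + a *\<^sub>C y"
    and scaleC_add_left: "(a + b) *\<^sub>C x = a *\<^sub>C x + b *\<^sub>C x"
    and scaleC_scaleC: "a *\<^sub>C (b *\<^sub>C x) = (a * b) *\<^sub>C x"
    and scaleC_of_real: "complex_of_real r *\<^sub>C x = r *\<^sub>R x"
    and norm_scaleC: "norm (a *\<^sub>C x) = cmod a * norm x"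

class complex_banach = banach + complex_normed_vector

instantiation complex :: complex_banach
begin

definition scaleC_complex :: "complex \<Rightarrow> complex \<Rightarrow> complex"
  where "scaleC_complex a x = a * x"

instance
  by standard (auto simp: scaleC_complex_def algebra_simps norm_mult scaleR_conv_of_real)

end


section \<open>Unbounded operators\<close>

text \<open>
  A (possibly unbounded, partially defined) operator is identified with its graph.
  Its domain is \<open>Domain T\<close>, the identity is \<open>Id\<close>, the inverse is \<open>T\<inverse>\<close> (the converse
  relation), and iterates are \<open>T ^^ n\<close>. Sums and products carry their natural domains.
\<close>

type_synonym 'x operator = "('x \<times> 'x) set"

definition linear_operator :: "('x::complex_normed_vector) operator \<Rightarrow> bool" where
  "linear_operator T \<longleftrightarrow>
     single_valued T \<and> (0, 0) \<in> T \<and>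
     (\<forall>x y u v. (x, y) \<in> T \<longrightarrow> (u, v) \<in> T \<longrightarrow> (x + u, y + v) \<in> T) \<and>
     (\<forall>c x y. (x, y) \<in> T \<longrightarrow> (c *\<^sub>C x, c *\<^sub>C y) \<in> T)"

definition op_scale :: "complex \<Rightarrow> ('x::complex_normed_vector) operator \<Rightarrow> 'x operator" where
  "op_scale c T = {(x, c *\<^sub>C y) |x y. (x, y) \<in> T}"

definition op_add :: "('x::complex_normed_vector) operator \<Rightarrow> 'x operator \<Rightarrow> 'x operator" where
  "op_add S T = {(x, y + z) |x y z. (x, y) \<in> S \<and> (x, z) \<in> T}"

text \<open>The product \<open>ST\<close> applies \<open>T\<close> first, whereas \<open>O\<close> composes relations from left to right.\<close>

definition op_mult :: "'x operator \<Rightarrow> 'x operator \<Rightarrow> 'x operator" where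
  "op_mult S T = T O S"

primrec op_prod :: "(nat \<Rightarrow> 'x operator) \<Rightarrow> nat \<Rightarrow> 'x operator" where
  "op_prod T 0 = Id"
| "op_prod T (Suc n) = op_mult (op_prod T n) (T (Suc n))"

definition bounded_operator :: "('x::complex_normed_vector) operator \<Rightarrow> bool" where
  "bounded_operator T \<longleftrightarrow>
     (\<exists>f. bounded_linear f \<and> (\<forall>c x. f (c *\<^sub>C x) = c *\<^sub>C f x) \<and> T = {(x, f x) |x. True})"

definition op_fun :: "'x operator \<Rightarrow> 'x \<Rightarrow> 'x" where
  "op_fun T x = (THE y. (x, y) \<in> T)"

definition op_norm :: "('x::complex_normed_vector) operator \<Rightarrow> real" where
  "op_norm T = onorm (op_fun T)"


section \<open>Resolvents and sectorial operators\<close>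

definition resolvent :: "complex \<Rightarrow> ('x::complex_normed_vector) operator \<Rightarrow> 'x operator" where
  "resolvent z A = (op_add (op_scale z Id) (op_scale (-1) A))\<inverse>"

definition resolvent_set :: "('x::complex_normed_vector) operator \<Rightarrow> complex set" where
  "resolvent_set A = {z. bounded_operator (resolvent z A)}"

definition spectrum :: "('x::complex_normed_vector) operator \<Rightarrow> complex set" where
  "spectrum A = - resolvent_set A"

definition sector :: "real \<Rightarrow> complex set" where
  "sector \<theta> = (if \<theta> = 0 then complex_of_real ` {0<..} else {z. z \<noteq> 0 \<and> \<bar>Arg z\<bar> < \<theta>})"

definition Sect :: "real \<Rightarrow> ('x::complex_normed_vector) operator set" where
  "Sect \<theta> = {A. linear_operator A \<and> closed A \<and> closure (Domain A) = UNIV \<and>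
     0 \<le> \<theta> \<and> \<theta> < pi \<and>
     spectrum A \<subseteq> closure (sector \<theta>) \<and>
     (\<forall>\<theta>'. \<theta> < \<theta>' \<longrightarrow> \<theta>' < pi \<longrightarrow>
        bdd_above ((\<lambda>z. op_norm (op_scale z (resolvent z A))) ` (- closure (sector \<theta>'))))}"

definition Sect_half_pi_minus :: "('x::complex_normed_vector) operator set" where
  "Sect_half_pi_minus = (\<Union>\<theta>\<in>{0..<pi/2}. Sect \<theta>)"


section \<open>Fractional powers\<close>

definition sectoriality_angle :: "('x::complex_normed_vector) operator \<Rightarrow> real" where
  "sectoriality_angle A = Inf {\<theta>. A \<in> Sect \<theta>}"

text \<open>
  The primary functional calculus of a sectorial operator, for holomorphic \<open>f\<close> decaying
  polynomially at \<open>0\<close> and at \<open>\<infinity>\<close>: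
    \<open>f(A) x = 1 / (2 \<pi> \<i>) \<integral> f(z) (z - A)\<inverse> x dz\<close>
  over the positively oriented boundary of \<open>sector \<delta>\<close>, with \<open>\<delta>\<close> strictly between the
  sectoriality angle and \<open>\<pi>\<close>. The value does not depend on \<open>\<delta>\<close>; the midpoint is taken.
  The boundary rays are parametrised by \<open>z = exp (s \<plusminus> \<i> \<delta>)\<close> with \<open>s\<close> real (so \<open>dz = z ds\<close>),
  the lower ray running outwards and the upper ray inwards.
\<close>

definition contour_angle :: "('x::complex_normed_vector) operator \<Rightarrow> real" where
  "contour_angle A = (sectoriality_angle A + pi) / 2"

definition fc_integrand ::
  "('x::complex_normed_vector) operator \<Rightarrow> (complex \<Rightarrow> complex) \<Rightarrow> complex \<Rightarrow> 'x \<Rightarrow> 'x" where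
  "fc_integrand A f z x = (f z * z) *\<^sub>C op_fun (resolvent z A) x"

definition primary_fc ::
  "('x::complex_banach) operator \<Rightarrow> (complex \<Rightarrow> complex) \<Rightarrow> 'x operator" where
  "primary_fc A f = {(x, y).
     ((\<lambda>s. (1 / (2 * of_real pi * \<i>)) *\<^sub>C
        (fc_integrand A f (exp (Complex s (- contour_angle A))) x
         - fc_integrand A f (exp (Complex s (contour_angle A))) x))
      has_integral y) UNIV}"

text \<open>
  For \<open>\<alpha> > 0\<close> and an integer \<open>m > \<alpha>\<close>, the function \<open>z\<^sup>\<alpha> (1 + z)\<^sup>-\<^sup>m\<close> is in the domain of the primary
  calculus, and \<open>A\<^sup>\<alpha> = (1 + A)\<^sup>m (z\<^sup>\<alpha> (1 + z)\<^sup>-\<^sup>m)(A)\<close> by regularisation. This does not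
  depend on \<open>m\<close>; the least such integer is taken. Only \<open>\<alpha> \<ge> 0\<close> is meaningful here.
\<close>

definition frac_power :: "('x::complex_banach) operator \<Rightarrow> real \<Rightarrow> 'x operator" where
  "frac_power A \<alpha> =
     (if \<alpha> = 0 then Id
      else (let m = nat \<lfloor>\<alpha>\<rfloor> + 1 in
        op_mult ((op_add Id A) ^^ m)
          (primary_fc A (\<lambda>z. z powr of_real \<alpha> / (1 + z) ^ m))))"


section \<open>Cayley transforms\<close>

definition cayley :: "real \<Rightarrow> ('x::complex_normed_vector) operator \<Rightarrow> 'x operator" where
  "cayley \<omega> A = op_mult (op_add A (op_scale (- of_real \<omega>) Id))
                        ((op_add A (op_scale (of_real \<omega>) Id))\<inverse>)"

text \<open>Sequences are indexed from 1; the value at index 0 is unconstrained and never used.\<close>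

definition shift_seqs :: "real \<Rightarrow> real \<Rightarrow> (nat \<Rightarrow> real) set" where
  "shift_seqs \<omega>min \<omega>max = {\<omega>. \<forall>k\<ge>1. \<omega>min \<le> \<omega> k \<and> \<omega> k \<le> \<omega>max}"

end

theory Submission
  imports Defs "HOL-Complex_Analysis.Complex_Analysis" "HOL-Real_Asymp.Real_Asymp"
begin

text \<open>
  The proof represents all operators involved by one contour integral. Write \<open>R z = (z - A)\<inverse>\<close>. As the
  angle of \<open>A\<close> is less than \<open>\<pi>/2\<close> and \<open>A\<close> is invertible, \<open>R\<close> exists and is of order \<open>1 / (1 + |z|)\<close> off a
  sector in the right half-plane, and also near \<open>0\<close> (\<open>sectorial_resolvent_exists\<close>). A branch
  \<open>\<gamma> t = \<rho> sin (b + \<i> t)\<close> of a hyperbola separates the spectrum from \<open>0\<close> within this region, and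
  \<open>\<Phi> g = 1 / (2 \<pi> \<i>) \<integral> g(z) R z dz\<close> along it defines a calculus for functions \<open>g\<close> that are holomorphic
  on the right half-plane and decay polynomially. On the hyperbola \<open>|z|\<close>, \<open>Re z\<close> and \<open>|dz/dt|\<close> are
  comparable to \<open>cosh t\<close>, so \<open>\<parallel>R z dz/dt\<parallel>\<close> is bounded and only \<open>g\<close> has to be estimated.

  Estimates: with shifts in a compact subset of \<open>(0, \<infinity>)\<close>, every Cayley factor \<open>(z - \<omega>) / (z + \<omega>)\<close> is at
  most \<open>exp (-c / cosh t)\<close> on the contour, so the product of \<open>n\<close> of them times \<open>z\<^sup>-\<^sup>\<alpha>\<close> is bounded by a
  multiple of \<open>exp (-c n / cosh t) (cosh t)\<^sup>-\<^sup>\<alpha>\<close>, hence of \<open>n\<^sup>-\<^sup>\<alpha> exp (-\<alpha> ||t| - ln n|)\<close>. The integral of this over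
  \<open>t\<close> is at most a multiple of \<open>n\<^sup>-\<^sup>\<alpha>\<close> (\<open>decay_estimate\<close>). For \<open>\<alpha> = 0\<close> the symbol does not decay at infinity, and
  the same bound is applied after subtracting \<open>z / (z + n)\<close>, the symbol of \<open>A (A + n)\<inverse>\<close>
  (\<open>power_bound_estimate\<close>).

  Algebra of the calculus: three facts suffice. The resolvent identity and Cauchy's theorem give
  \<open>R \<mu> (\<Phi> g) = \<Phi> (g / (\<mu> - z))\<close> for \<open>Re \<mu> \<le> 0\<close> (\<open>R_Phi\<close>), which covers products with Cayley transforms.
  The normalisation is \<open>\<Phi> (1/z) = A\<inverse>\<close> (\<open>Phi_inverse\<close>). Finally \<open>f(A) (\<Phi> g) = \<Phi> (f g)\<close> for the primary
  calculus \<open>f(A)\<close> (\<open>fc_Phi\<close>), by Fubini's theorem and Cauchy's formula. For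
  \<open>f(z) = z\<^sup>\<alpha> (1 + z)\<^sup>-\<^sup>m\<close> and \<open>g(z) = z\<^sup>-\<^sup>\<alpha>\<close> this yields \<open>f(A) (\<Phi> g) = (1 + A)\<^sup>-\<^sup>m\<close>, whence \<open>\<Phi> g\<close> is the inverse of the
  fractional power (\<open>frac_power_inverse_graph\<close>).

  Cauchy's theorem for vector-valued functions is obtained in the coordinate \<open>w\<close> with \<open>z = \<rho> sin w\<close>, where
  the hyperbola is a vertical line, by differentiating the integral over a vertical line with
  respect to its abscissa (\<open>strip_shift\<close>).
\<close>

section \<open>Scalar multiplication\<close>

lemma bounded_bilinear_scaleC:
  "bounded_bilinear (scaleC :: complex \<Rightarrow> 'a \<Rightarrow> 'a::complex_normed_vector)"
proof
  fix a a' :: complex and b b' :: 'a and r :: real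
  show "(a + a') *\<^sub>C b = a *\<^sub>C b + a' *\<^sub>C b" by (rule scaleC_add_left)
  show "a *\<^sub>C (b + b') = a *\<^sub>C b + a *\<^sub>C b'" by (rule scaleC_add_right)
  show "(r *\<^sub>R a) *\<^sub>C b = r *\<^sub>R (a *\<^sub>C b)"
    by (metis scaleC_of_real scaleC_scaleC scaleR_conv_of_real)
  show "a *\<^sub>C (r *\<^sub>R b) = r *\<^sub>R (a *\<^sub>C b)"
    by (metis scaleC_of_real scaleC_scaleC mult.commute)
  show "\<exists>K. \<forall>a (b::'a). norm (a *\<^sub>C b) \<le> norm a * norm b * K"
    by (rule exI[of _ 1]) (simp add: norm_scaleC)
qed

interpretation scaleC: bounded_bilinear "scaleC :: complex \<Rightarrow> 'a \<Rightarrow> 'a::complex_normed_vector"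
  by (rule bounded_bilinear_scaleC)

lemmas [continuous_intros] = scaleC.continuous_on scaleC.continuous

lemma scaleC_one [simp]: "1 *\<^sub>C x = x"
  using scaleC_of_real[of 1 x] by simp

lemma scaleC_minus_one [simp]: "(- 1) *\<^sub>C x = - x"
  by (simp add: scaleC.minus_left)

section \<open>Integrals of vector-valued functions over the real line\<close>

lemma has_integral_exp_abs:
  fixes a \<tau> :: real
  assumes "a > 0"
  shows "((\<lambda>t. exp (- a * \<bar>t - \<tau>\<bar>)) has_integral 2 / a) UNIV"
proof -
  have right: "((\<lambda>t. exp (- a * \<bar>t - s\<bar>)) has_integral 1 / a) {s..}" for s
  proof -
    have "((\<lambda>t. exp (a * s) * exp (- a * t)) has_integral exp (a * s) * (exp (- a * s) / a)) {s..}"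
      by (intro has_integral_mult_right has_integral_exp_minus_to_infinity assms)
    moreover have "exp (a * s) * exp (- (a * s)) = 1"
      by (simp add: exp_add[symmetric])
    ultimately have "((\<lambda>t. exp (a * s) * exp (- a * t)) has_integral 1 / a) {s..}"
      by simp
    then show ?thesis
      by (rule has_integral_eq[rotated]) (auto simp: exp_add[symmetric] algebra_simps)
  qed
  have "(\<lambda>t. exp (- a * \<bar>t - (-\<tau>)\<bar>)) absolutely_integrable_on {-\<tau>..}"
    using right[of "-\<tau>"] by (intro nonnegative_absolutely_integrable_1) (auto simp: integrable_on_def)
  then have "(\<lambda>t. exp (- a * \<bar>-t - (-\<tau>)\<bar>)) absolutely_integrable_on {..\<tau>} \<and>
       integral {..\<tau>} (\<lambda>t. exp (- a * \<bar>-t - (-\<tau>)\<bar>)) = 1 / a"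
    using right[of "-\<tau>"]
    by (subst has_absolute_integral_reflect_real[where B = "{-\<tau>..}"]) auto
  then have left: "((\<lambda>t. exp (- a * \<bar>t - \<tau>\<bar>)) has_integral 1 / a) {..\<tau>}"
    by (auto simp: abs_minus_commute set_lebesgue_integral_eq_integral(1) has_integral_iff)
  have "((\<lambda>t. exp (- a * \<bar>t - \<tau>\<bar>)) has_integral 1 / a + 1 / a) ({..\<tau>} \<union> {\<tau>..})"
    by (rule has_integral_Un[OF left right])
      (auto intro!: negligible_subset[OF negligible_sing[of \<tau>]])
  moreover have "{..\<tau>} \<union> {\<tau>..} = UNIV" by auto
  ultimately show ?thesis by simp
qed

lemma integrable_exp_abs: "a > 0 \<Longrightarrow> (\<lambda>t. exp (- a * \<bar>t - \<tau>\<bar>)) integrable_on (UNIV :: real set)"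
  using has_integral_exp_abs by blast

lemma integrable_exp_decay:
  fixes F :: "real \<Rightarrow> 'b::banach"
  assumes cont: "continuous_on UNIV F" and a: "a > 0"
    and decay: "\<And>t. T \<le> \<bar>t\<bar> \<Longrightarrow> norm (F t) \<le> K * exp (- a * \<bar>t\<bar>)"
  shows "F integrable_on UNIV"
proof -
  have "bounded (F ` {-\<bar>T\<bar>..\<bar>T\<bar>})"
    by (intro compact_imp_bounded compact_continuous_image continuous_on_subset[OF cont]) auto
  then obtain M where M: "\<And>t. \<bar>t\<bar> \<le> \<bar>T\<bar> \<Longrightarrow> norm (F t) \<le> M" and "M > 0"
    unfolding bounded_pos by (force simp: abs_le_iff)
  define L where "L = max K (M * exp (a * \<bar>T\<bar>))"
  have "norm (F t) \<le> L * exp (- a * \<bar>t - 0\<bar>)" for t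
  proof (cases "\<bar>t\<bar> \<le> \<bar>T\<bar>")
    case True
    then have "a * \<bar>t\<bar> \<le> a * \<bar>T\<bar>" using a by simp
    then have "1 \<le> exp (a * \<bar>T\<bar>) * exp (- a * \<bar>t\<bar>)"
      by (simp add: exp_add[symmetric])
    then have "M \<le> M * exp (a * \<bar>T\<bar>) * exp (- a * \<bar>t\<bar>)"
      using \<open>M > 0\<close> by simp
    also have "\<dots> \<le> L * exp (- a * \<bar>t\<bar>)"
      by (intro mult_right_mono) (auto simp: L_def)
    finally show ?thesis using M[OF True] by simp
  next
    case False
    then have "norm (F t) \<le> K * exp (- a * \<bar>t\<bar>)" by (intro decay) auto
    also have "\<dots> \<le> L * exp (- a * \<bar>t\<bar>)"
      by (intro mult_right_mono) (auto simp: L_def)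
    finally show ?thesis by simp
  qed
  moreover have "(\<lambda>t. L * exp (- a * \<bar>t - 0\<bar>)) integrable_on UNIV"
    by (intro integrable_on_mult_right integrable_exp_abs a)
  moreover have "F integrable_on cbox u v" for u v
    by (intro integrable_continuous continuous_on_subset[OF cont]) auto
  ultimately show ?thesis
    by (intro integrable_on_all_intervals_UNIV[of F]) auto
qed

lemma integral_UNIV_limit:
  fixes F :: "real \<Rightarrow> 'b::banach"
  assumes "F integrable_on UNIV"
  shows "((\<lambda>N. integral {-N..N} F) \<longlongrightarrow> integral UNIV F) at_top"
proof (rule tendstoI)
  fix e :: real assume "e > 0"
  have "(F has_integral integral UNIV F) UNIV"
    using assms by (rule integrable_integral)
  then obtain B where B: "B > 0"
    "\<And>a b. ball 0 B \<subseteq> cbox a b \<Longrightarrow> norm (integral (cbox a b) F - integral UNIV F) < e"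
    unfolding has_integral_alt'[of F] using \<open>e > 0\<close> by (auto simp only: UNIV_I if_True)
  have "dist (integral {-N..N} F) (integral UNIV F) < e" if "N \<ge> B" for N
    
  proof -
    have "ball 0 B \<subseteq> cbox (-N) N" using that by (auto simp: dist_real_def)
    from B(2)[OF this] show ?thesis by (simp add: dist_norm)
  qed
  then show "\<forall>\<^sub>F N in at_top. dist (integral {-N..N} F) (integral UNIV F) < e"
    unfolding eventually_at_top_linorder by blast
qed

lemma integral_odd_eq_0:
  fixes F :: "real \<Rightarrow> 'b::banach"
  assumes "F integrable_on UNIV" and odd: "\<And>t. F (- t) = - F t"
  shows "integral UNIV F = 0"
proof -
  have "integral {-N..N} F = 0" for N
  proof -
    have "integral {-N..N} F = integral {-N..- (-N)} (\<lambda>t. F (- t))"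
      using Henstock_Kurzweil_Integration.integral_reflect_real[of N "-N" F] by simp
    also have "\<dots> = - integral {-N..N} F" by (simp add: odd)
    finally show ?thesis
      by (metis add.right_inverse double_zero_sym scaleR_2 scaleR_eq_0_iff add_eq_0_iff zero_neq_numeral)
  qed
  then have "((\<lambda>N::real. 0) \<longlongrightarrow> integral UNIV F) at_top"
    using integral_UNIV_limit[OF assms(1)] by simp
  then show ?thesis
    using tendsto_unique[OF trivial_limit_at_top_linorder] tendsto_const by metis
qed

text \<open>
  Fubini's theorem for a continuous integrand that is dominated by a product of decaying
  exponentials. The two inner integrals are assumed to be known, which makes it unnecessary
  to discuss how they depend on the parameter.
\<close>

lemma integral_swap_exp_decay:
  fixes H :: "real \<Rightarrow> real \<Rightarrow> 'b::banach"
  assumes cont: "continuous_on UNIV (\<lambda>(s, t). H s t)"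
    and bound: "\<And>s t. norm (H s t) \<le> C * exp (- a * \<bar>s\<bar>) * exp (- b * \<bar>t\<bar>)"
    and "a > 0" "b > 0"
    and P: "\<And>s. (H s has_integral P s) UNIV" and Pi: "P integrable_on UNIV"
    and Q: "\<And>t. ((\<lambda>s. H s t) has_integral Q t) UNIV" and Qi: "Q integrable_on UNIV"
  shows "integral UNIV P = integral UNIV Q"
proof -
  let ?J = "\<lambda>H N s. integral {-N..N} (H s :: real \<Rightarrow> 'b)"
  have half: "((\<lambda>N. integral {-N..N} (?J H N)) \<longlongrightarrow> integral UNIV P) at_top"
    if cont: "continuous_on UNIV (\<lambda>(s, t). H s t)"
      and bound: "\<And>s t. norm (H s t) \<le> C * exp (- a * \<bar>s\<bar>) * exp (- b * \<bar>t\<bar>)"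
      and "a > 0" "b > 0"
      and P: "\<And>s. (H s has_integral P s) UNIV" and Pi: "P integrable_on UNIV"
    for H :: "real \<Rightarrow> real \<Rightarrow> 'b" and a b P
  proof -
    define v where "v = (\<lambda>t::real. exp (- b * \<bar>t\<bar>))"
    have v: "v integrable_on UNIV"
      using integrable_exp_abs[OF \<open>b > 0\<close>, of 0] by (simp add: v_def)
    define u where "u = (\<lambda>s::real. exp (- a * \<bar>s\<bar>))"
    have u: "u integrable_on UNIV"
      using integrable_exp_abs[OF \<open>a > 0\<close>, of 0] by (simp add: u_def)
    define e where "e = (\<lambda>N. \<bar>C\<bar> * (integral UNIV v - integral {-N..N} v))"
    have on: "f integrable_on {-N..N}" if "f integrable_on UNIV" for f :: "real \<Rightarrow> 'c::banach" and N
      using that integrable_on_subinterval by (metis box_real(2) top_greatest)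
    have Hc: "continuous_on S (H s)" for s S
      using continuous_on_compose2[OF cont, of S "\<lambda>t. (s, t)"] by (simp add: continuous_intros)
    have inner: "norm (P s - integral {-N..N} (H s)) \<le> e N * u s" for s N
    proof -
      have iH: "H s integrable_on UNIV" using P by blast
      have eq: "P s - integral {-N..N} (H s) = integral (UNIV - {-N..N}) (H s)"
        using integral_unique[OF P[of s]] by (subst integral_setdiff) (auto intro!: on iH)
      have "norm (integral (UNIV - {-N..N}) (H s)) \<le> integral (UNIV - {-N..N}) (\<lambda>t. \<bar>C\<bar> * u s * v t)"
      proof (rule integral_norm_bound_integral)
        show "H s integrable_on UNIV - {- N..N}"
          by (intro integrable_setdiff[OF integrable_integral[OF iH] integrable_integral[OF on[OF iH]]]) auto
        show "(\<lambda>t. \<bar>C\<bar> * u s * v t) integrable_on UNIV - {- N..N}"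
          by (intro integrable_on_mult_right integrable_setdiff[OF integrable_integral[OF v] integrable_integral[OF on[OF v]]]) auto
        fix t
        have "norm (H s t) \<le> C * u s * v t" using bound by (simp add: u_def v_def)
        also have "\<dots> \<le> \<bar>C\<bar> * u s * v t"
          by (intro mult_right_mono) (auto simp: u_def v_def)
        finally show "norm (H s t) \<le> \<bar>C\<bar> * u s * v t" .
      qed
      also have "\<dots> = \<bar>C\<bar> * u s * integral (UNIV - {-N..N}) v" by simp
      also have "integral (UNIV - {-N..N}) v = integral UNIV v - integral {-N..N} v"
        by (rule integral_setdiff) (auto intro: v on)
      finally show ?thesis by (simp add: eq e_def algebra_simps)
    qed
    have "(e \<longlongrightarrow> \<bar>C\<bar> * (integral UNIV v - integral UNIV v)) at_top"
      unfolding e_def by (intro tendsto_intros integral_UNIV_limit v)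
    then have "((\<lambda>N. e N * integral UNIV u) \<longlongrightarrow> 0 * integral UNIV u) at_top"
      by (intro tendsto_intros) simp
    then have e0: "((\<lambda>N. e N * integral UNIV u) \<longlongrightarrow> 0) at_top" by simp
    have outer: "norm (integral {-N..N} P - integral {-N..N} (?J H N))
        \<le> e N * integral UNIV u" for N
    proof -
      have ii: "(?J H N) integrable_on {-N..N}"
        using continuous_on_subset[OF cont, of "cbox (-N, -N) (N, N)"]
        by (intro integrable_continuous_real)
          (use integral_continuous_on_param[of "{-N..N}" "-N" N "\<lambda>s t. H s t"] cont
            in \<open>auto simp: case_prod_unfold intro: continuous_on_subset\<close>)
      have "integral {-N..N} P - integral {-N..N} (?J H N) =
          integral {-N..N} (\<lambda>s. P s - integral {-N..N} (H s))"
        by (rule integral_diff[OF on[OF Pi] ii, symmetric])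
      also have "norm \<dots> \<le> integral {-N..N} (\<lambda>s. e N * u s)"
        by (rule integral_norm_bound_integral)
          (auto intro!: integrable_diff[OF on[OF Pi] ii] integrable_on_mult_right on[OF u] inner)
      also have "\<dots> = e N * integral {-N..N} u" by simp
      also have "\<dots> \<le> e N * integral UNIV u"
      proof (rule mult_left_mono)
        show "integral {- N..N} u \<le> integral UNIV u"
          by (intro integral_subset_le on u) (auto simp: u_def)
        show "0 \<le> e N" unfolding e_def
          using integral_subset_le[of "{-N..N}" UNIV v] on[OF v] v by (auto simp: v_def)
      qed
      finally show ?thesis .
    qed
    have "((\<lambda>N. integral {-N..N} P - integral {-N..N} (?J H N)) \<longlongrightarrow> 0) at_top"
      by (rule Lim_null_comparison[OF _ e0]) (auto simp: outer)
    from tendsto_diff[OF integral_UNIV_limit[OF Pi] this] show ?thesis by simp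
  qed
  have 1: "((\<lambda>N. integral {-N..N} (?J H N)) \<longlongrightarrow> integral UNIV P) at_top"
    using assms by (intro half[of H a b P]) auto
  have 2: "((\<lambda>N. integral {-N..N} (\<lambda>t. integral {-N..N} (\<lambda>s. H s t))) \<longlongrightarrow> integral UNIV Q) at_top"
  proof (rule half[of "\<lambda>t s. H s t" b a Q])
    show "continuous_on UNIV (\<lambda>(t, s). H s t)"
      using continuous_on_compose2[OF cont, of UNIV "\<lambda>(t, s). (s, t)"]
      by (simp add: case_prod_unfold continuous_intros)
    show "norm (H s t) \<le> C * exp (- b * \<bar>t\<bar>) * exp (- a * \<bar>s\<bar>)" for s t
      using bound[of s t] by (simp add: mult_ac)
  qed (use assms in auto)
  have "integral {-N..N} (?J H N) = integral {-N..N} (\<lambda>t. integral {-N..N} (\<lambda>s. H s t))" for N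
    using integral_swap_continuous[of "-N" "-N" N N H] continuous_on_subset[OF cont] by auto
  then show ?thesis
    using tendsto_unique[OF _ 1] 2 by auto
qed

section \<open>Cauchy's theorem on a strip\<close>

text \<open>
  The closed vertical strip between the abscissae \<open>b\<close> and \<open>c\<close>.
\<close>

definition vstrip :: "real \<Rightarrow> real \<Rightarrow> complex set" where
  "vstrip b c = {w. b \<le> Re w \<and> Re w \<le> c}"

text \<open>
  Cauchy's theorem for a vector-valued function on a strip: for a function that decays at both
  ends of the strip, the integral along a vertical line does not depend on the abscissa \<open>x\<close> of
  the line. No scalar theory is used: differentiating under the integral sign gives
  \<open>\<integral> G'(x + i t) dt\<close>, which by the fundamental theorem of calculus is \<open>-\<i>\<close> times the
  difference of the boundary values of \<open>G\<close>.
\<close>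

lemma strip_shift:
  fixes G G' :: "complex \<Rightarrow> 'x::complex_banach"
  assumes bc: "b \<le> c"
    and der: "\<And>w. w \<in> vstrip b c \<Longrightarrow> (G has_derivative (\<lambda>h. h *\<^sub>C G' w)) (at w within vstrip b c)"
    and contG': "continuous_on (vstrip b c) G'"
    and a: "a > 0"
    and decay: "\<And>w. w \<in> vstrip b c \<Longrightarrow> T \<le> \<bar>Im w\<bar> \<Longrightarrow> norm (G w) \<le> K * exp (- a * \<bar>Im w\<bar>)"
  shows "integral UNIV (\<lambda>t. G (Complex b t)) = integral UNIV (\<lambda>t. G (Complex c t))"
proof -
  let ?S = "vstrip b c"
  have contG: "continuous_on ?S G"
    using der by (meson continuous_on_eq_continuous_within has_derivative_continuous)
  have mem: "Complex x t \<in> ?S" if "x \<in> {b..c}" for x t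
    using that by (simp add: vstrip_def)
  have Complex_eq': "Complex x t = of_real x + \<i> * of_real t" for x t by (simp add: Complex_eq)
  have int: "(\<lambda>t. G (Complex x t)) integrable_on UNIV" if "x \<in> {b..c}" for x
  proof (rule integrable_exp_decay[OF _ a])
    show "continuous_on UNIV (\<lambda>t. G (Complex x t))"
      by (rule continuous_on_compose2[OF contG]) (use mem that in \<open>auto simp: Complex_eq' intro!: continuous_intros\<close>)
    show "norm (G (Complex x t)) \<le> K * exp (- a * \<bar>t\<bar>)" if "T \<le> \<bar>t\<bar>" for t
      using decay[of "Complex x t"] mem[OF \<open>x \<in> _\<close>, of t] that by simp
  qed
  define J where "J = (\<lambda>N x. integral {-N..N} (\<lambda>t. G (Complex x t)))"
  have bound: "norm (J N c - J N b) \<le> 2 * K * exp (- a * N) * norm (c - b)" if N: "N \<ge> \<bar>T\<bar>" for N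
  proof -
    have contGx: "continuous_on {-N..N} (\<lambda>t. G (Complex x t))" if "x \<in> {b..c}" for x
      by (rule continuous_on_compose2[OF contG]) (use mem that in \<open>auto simp: Complex_eq' intro!: continuous_intros\<close>)
    have J': "(J N has_vector_derivative integral {-N..N} (\<lambda>t. G' (Complex x t))) (at x within {b..c})"
      if x: "x \<in> {b..c}" for x
      unfolding J_def box_real[symmetric]
    proof (rule leibniz_rule_vector_derivative)
      fix y t assume "y \<in> cbox b c"
      then have y: "y \<in> {b..c}" by simp
      have "((\<lambda>y. Complex y t) has_derivative (\<lambda>h. of_real h)) (at y within {b..c})"
        unfolding Complex_eq' by (auto intro!: derivative_eq_intros)
      then have "((\<lambda>y. G (Complex y t)) has_derivative (\<lambda>h. of_real h *\<^sub>C G' (Complex y t))) (at y within {b..c})"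
        by (rule has_derivative_in_compose2[where t = ?S and g = G and g' = "\<lambda>w h. h *\<^sub>C G' w", rotated 3]) (use der mem y in auto)
      then show "((\<lambda>y. G (Complex y t)) has_vector_derivative G' (Complex y t)) (at y within cbox b c)"
        by (simp add: has_vector_derivative_def scaleC_of_real)
    next
      fix y assume "y \<in> cbox b c"
      then show "(\<lambda>t. G (Complex y t)) integrable_on cbox (-N) N"
        using contGx[of y] by (auto intro!: integrable_continuous_real)
    next
      show "continuous_on (cbox b c \<times> cbox (- N) N) (\<lambda>(x, t). G' (Complex x t))"
        unfolding case_prod_unfold
        by (rule continuous_on_compose2[OF contG']) (use mem in \<open>auto simp: Complex_eq' intro!: continuous_intros\<close>)
    qed (use x in auto)
    have J'_bound: "norm (integral {-N..N} (\<lambda>t. G' (Complex x t))) \<le> 2 * K * exp (- a * N)"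
      if x: "x \<in> {b..c}" for x
    proof -
      have "((\<lambda>t. \<i> *\<^sub>C G' (Complex x t)) has_integral (G (Complex x N) - G (Complex x (-N)))) {-N..N}"
      proof (rule fundamental_theorem_of_calculus)
        fix t assume t: "t \<in> {-N..N}"
        have "((\<lambda>t. Complex x t) has_derivative (\<lambda>h. \<i> * of_real h)) (at t within {-N..N})"
          unfolding Complex_eq' by (auto intro!: derivative_eq_intros)
        then have "((\<lambda>t. G (Complex x t)) has_derivative (\<lambda>h. (\<i> * of_real h) *\<^sub>C G' (Complex x t))) (at t within {-N..N})"
          by (rule has_derivative_in_compose2[where t = ?S and g = G and g' = "\<lambda>w h. h *\<^sub>C G' w", rotated 3]) (use der mem x t in auto)
        then show "((\<lambda>t. G (Complex x t)) has_vector_derivative \<i> *\<^sub>C G' (Complex x t)) (at t within {-N..N})"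
          unfolding has_vector_derivative_def
          by (rule has_derivative_eq_rhs) (metis mult.commute scaleC_of_real scaleC_scaleC)
      qed (use N in auto)
      then have "((\<lambda>t. (- \<i>) *\<^sub>C \<i> *\<^sub>C G' (Complex x t)) has_integral
            (- \<i>) *\<^sub>C (G (Complex x N) - G (Complex x (-N)))) {-N..N}"
        by (rule has_integral_linear[OF _ scaleC.bounded_linear_right, unfolded o_def])
      then have "integral {-N..N} (\<lambda>t. G' (Complex x t)) = (- \<i>) *\<^sub>C (G (Complex x N) - G (Complex x (-N)))"
        by (intro integral_unique) (simp add: scaleC_scaleC)
      then have "norm (integral {-N..N} (\<lambda>t. G' (Complex x t))) \<le> norm (G (Complex x N)) + norm (G (Complex x (-N)))"
        by (simp add: norm_scaleC norm_triangle_ineq4)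
      also have "\<dots> \<le> K * exp (- a * N) + K * exp (- a * N)"
        using N decay[of "Complex x N"] decay[of "Complex x (-N)"] mem[OF x]
        by (intro add_mono) auto
      finally show ?thesis by simp
    qed
    show ?thesis
    proof (rule differentiable_bound)
      show "(J N has_derivative (\<lambda>h. h *\<^sub>R integral {-N..N} (\<lambda>t. G' (Complex x t)))) (at x within {b..c})"
        if "x \<in> {b..c}" for x
        using J'[OF that] by (simp add: has_vector_derivative_def)
      show "onorm (\<lambda>h. h *\<^sub>R integral {-N..N} (\<lambda>t. G' (Complex x t))) \<le> 2 * K * exp (- a * N)"
        if "x \<in> {b..c}" for x
        using J'_bound[OF that] by (intro onorm_le) (simp add: mult.commute mult_left_mono)
    qed (use bc in auto)
  qed
  have "((\<lambda>N. J N c - J N b) \<longlongrightarrow> integral UNIV (\<lambda>t. G (Complex c t)) - integral UNIV (\<lambda>t. G (Complex b t))) at_top"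
    unfolding J_def using bc by (intro tendsto_diff integral_UNIV_limit int) auto
  moreover have "((\<lambda>N. J N c - J N b) \<longlongrightarrow> 0) at_top"
  proof (rule Lim_null_comparison)
    show "\<forall>\<^sub>F N in at_top. norm (J N c - J N b) \<le> 2 * K * exp (- a * N) * norm (c - b)"
      using bound unfolding eventually_at_top_linorder by blast
    show "((\<lambda>N. 2 * K * exp (- a * N) * norm (c - b)) \<longlongrightarrow> 0) at_top"
      using a by real_asymp
  qed
  ultimately show ?thesis
    using tendsto_unique[OF trivial_limit_at_top_linorder] by fastforce
qed

section \<open>Complex differentiation of vector-valued functions\<close>

text \<open>
  That \<open>F\<close> has complex derivative \<open>F'\<close> is expressed by the real derivative being
  multiplication by \<open>F'\<close>.
\<close>

lemma scaleC_complex_eq [simp]: "a *\<^sub>C (b::complex) = a * b"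
  by (simp add: scaleC_complex_def)

lemma has_derivative_scaleC_mult:
  fixes F :: "complex \<Rightarrow> 'x::complex_normed_vector"
  assumes "(f has_field_derivative f') (at w within S)"
    and "(F has_derivative (\<lambda>h. h *\<^sub>C F')) (at w within S)"
  shows "((\<lambda>w. f w *\<^sub>C F w) has_derivative (\<lambda>h. h *\<^sub>C (f w *\<^sub>C F' + f' *\<^sub>C F w))) (at w within S)"
  by (rule has_derivative_eq_rhs[OF scaleC.FDERIV[OF assms(1)[unfolded has_field_derivative_def] assms(2)]])
    (simp add: fun_eq_iff scaleC_add_right scaleC_scaleC mult_ac)

lemma has_derivative_scaleC_chain:
  fixes F :: "complex \<Rightarrow> 'x::complex_normed_vector"
  assumes "(g has_field_derivative g') (at w within S)" "w \<in> S" "g ` S \<subseteq> T"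
    and "\<And>z. z \<in> T \<Longrightarrow> (F has_derivative (\<lambda>h. h *\<^sub>C F' z)) (at z within T)"
  shows "((\<lambda>w. F (g w)) has_derivative (\<lambda>h. h *\<^sub>C (g' *\<^sub>C F' (g w)))) (at w within S)"
proof -
  have "((\<lambda>w. F (g w)) has_derivative (\<lambda>h. (g' * h) *\<^sub>C F' (g w))) (at w within S)"
    by (rule has_derivative_in_compose2[where t = T and g = F and g' = "\<lambda>z h. h *\<^sub>C F' z", rotated 3])
      (use assms in \<open>auto simp: has_field_derivative_def\<close>)
  then show ?thesis by (simp add: scaleC_scaleC mult_ac)
qed

section \<open>The complex sine on a vertical strip\<close>

lemma norm_sin_sq: "(cmod (sin w))\<^sup>2 = (cosh (Im w))\<^sup>2 - (cos (Re w))\<^sup>2"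
proof -
  have "(cmod (sin w))\<^sup>2 = (sin (Re w))\<^sup>2 * (cosh (Im w))\<^sup>2 + (cos (Re w))\<^sup>2 * (sinh (Im w))\<^sup>2"
    by (simp add: cmod_power2 Re_sin Im_sin cosh_field_def sinh_field_def power_mult_distrib power_divide)
  also have "\<dots> = ((sin (Re w))\<^sup>2 + (cos (Re w))\<^sup>2) * (cosh (Im w))\<^sup>2 - (cos (Re w))\<^sup>2"
    unfolding sinh_square_eq by (simp only: algebra_simps)
  finally show ?thesis by simp
qed

lemma norm_cos_sq: "(cmod (cos w))\<^sup>2 = (cosh (Im w))\<^sup>2 - (sin (Re w))\<^sup>2"
proof -
  have "(cmod (cos w))\<^sup>2 = (cos (Re w))\<^sup>2 * (cosh (Im w))\<^sup>2 + (sin (Re w))\<^sup>2 * (sinh (Im w))\<^sup>2"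
    by (simp add: cmod_power2 Re_cos Im_cos cosh_field_def sinh_field_def power_mult_distrib power_divide
      power2_commute)
  also have "\<dots> = ((sin (Re w))\<^sup>2 + (cos (Re w))\<^sup>2) * (cosh (Im w))\<^sup>2 - (sin (Re w))\<^sup>2"
    unfolding sinh_square_eq by (simp only: algebra_simps)
  finally show ?thesis by simp
qed

lemma norm_sin_le_cosh: "cmod (sin w) \<le> cosh (Im w)"
  by (rule power2_le_imp_le) (simp_all add: norm_sin_sq)

lemma norm_cos_le_cosh: "cmod (cos w) \<le> cosh (Im w)"
  by (rule power2_le_imp_le) (simp_all add: norm_cos_sq)

lemma Re_sin_cosh: "Re (sin w) = sin (Re w) * cosh (Im w)"
  by (simp add: Re_sin cosh_field_def)

lemma Im_sin_sinh: "Im (sin w) = cos (Re w) * sinh (Im w)"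
  by (simp add: Im_sin sinh_field_def)

lemma cosh_le_exp_abs: "cosh t \<le> exp \<bar>t::real\<bar>"
proof -
  have "exp t \<le> exp \<bar>t\<bar>" "exp (- t) \<le> exp \<bar>t\<bar>" by auto
  then have "exp t + exp (- t) \<le> 2 * exp \<bar>t\<bar>" by linarith
  then show ?thesis by (simp add: cosh_field_def)
qed

lemma exp_abs_le_cosh: "exp \<bar>t::real\<bar> \<le> 2 * cosh t"
  by (cases "t \<ge> 0") (simp_all add: cosh_field_def)

lemma cosh_powr_minus_le:
  assumes "a \<ge> 0" shows "cosh t powr (- a) \<le> 2 powr a * exp (- a * \<bar>t::real\<bar>)"
proof -
  have "cosh t powr (- a) \<le> (exp \<bar>t\<bar> / 2) powr (- a)"
    using exp_abs_le_cosh[of t] assms by (intro powr_mono2') auto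
  also have "\<dots> = 2 powr a * exp (- a * \<bar>t\<bar>)"
    by (simp add: powr_divide powr_minus exp_powr_real exp_minus field_simps)
  finally show ?thesis .
qed

section \<open>Resolvent calculus\<close>

text \<open>
  The complement of the sector \<open>Re z \<ge> \<kappa> * |z|\<close>, whose half-angle is \<open>arccos \<kappa>\<close>, together with the
  disc of radius \<open>r\<close> about \<open>0\<close>.
\<close>

definition left_region :: "real \<Rightarrow> real \<Rightarrow> complex set" where
  "left_region \<kappa> r = {z. Re z < \<kappa> * cmod z \<or> cmod z < r}"

text \<open>
  What is needed of the resolvent \<open>R z = (z - A)\<inverse>\<close> of an invertible sectorial operator of angle less
  than \<open>\<pi>/2\<close>: on a region of the above kind it satisfies the resolvent identity and decays like
  \<open>1 / (1 + |z|)\<close>. The operator itself does not occur; note that \<open>R 0 = -A\<inverse>\<close>.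
\<close>

locale sectorial_resolvent =
  fixes R :: "complex \<Rightarrow> 'x::complex_banach \<Rightarrow> 'x" and \<kappa> r C :: real
  assumes kappa_pos: "0 < \<kappa>" and kappa_le: "\<kappa> \<le> 1" and r_pos: "0 < r" and C_nonneg: "0 \<le> C"
    and R_add: "\<And>z x y. z \<in> left_region \<kappa> r \<Longrightarrow> R z (x + y) = R z x + R z y"
    and R_scaleC: "\<And>z c x. z \<in> left_region \<kappa> r \<Longrightarrow> R z (c *\<^sub>C x) = c *\<^sub>C R z x"
    and R_bound: "\<And>z x. z \<in> left_region \<kappa> r \<Longrightarrow> norm (R z x) \<le> C / (1 + cmod z) * norm x"
    and R_identity: "\<And>z w x. z \<in> left_region \<kappa> r \<Longrightarrow> w \<in> left_region \<kappa> r \<Longrightarrow>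
      R w x - R z x = (z - w) *\<^sub>C R w (R z x)"
    and R0_inj: "\<And>x. R 0 x = 0 \<Longrightarrow> x = 0"
begin

abbreviation \<Omega> :: "complex set" where "\<Omega> \<equiv> left_region \<kappa> r"

text \<open>
  The constants of the contour, a hyperbola with foci \<open>\<plusminus> \<rho>\<close> and vertex \<open>p\<close>, whose asymptotes make
  the angle \<open>\<pi>/2 - b\<close> with the positive real axis.
\<close>

definition b :: real where "b = arcsin (\<kappa> / 2)"
definition \<rho> :: real where "\<rho> = r / 2"
definition p :: real where "p = \<rho> * (\<kappa> / 2)"

lemma rho_pos: "0 < \<rho>" using r_pos by (simp add: \<rho>_def)
lemma p_pos: "0 < p" using rho_pos kappa_pos by (simp add: p_def)
lemma sin_b: "sin b = \<kappa> / 2" using kappa_pos kappa_le by (simp add: b_def)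
lemma b_pos: "0 < b" using kappa_pos kappa_le arcsin_less_mono[of 0 "\<kappa>/2"] by (simp add: b_def)
lemma b_less: "b < pi / 2" using kappa_pos kappa_le arcsin_lt_bounded[of "\<kappa>/2"] by (simp add: b_def)
lemma cos_b: "0 < cos b" using b_pos b_less by (intro cos_gt_zero) auto
lemma p_less_rho: "p < \<rho>" using rho_pos kappa_le by (simp add: p_def)

lemma zero_in_Omega: "0 \<in> \<Omega>" using r_pos by (simp add: left_region_def)

lemma Omega_left: "Re z \<le> 0 \<Longrightarrow> z \<in> \<Omega>"
  using kappa_pos r_pos by (cases "z = 0") (auto simp: left_region_def intro: le_less_trans)

lemma R_bounded_linear: "z \<in> \<Omega> \<Longrightarrow> bounded_linear (R z)"
proof (rule bounded_linear_intro[where K = "C / (1 + cmod z)"])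
  assume z: "z \<in> \<Omega>"
  show "R z (s *\<^sub>R x) = s *\<^sub>R R z x" for s x
    using R_scaleC[OF z, of "of_real s" x] by (simp add: scaleC_of_real)
qed (auto simp: R_add mult.commute dest: R_bound)

lemma R_linear: "z \<in> \<Omega> \<Longrightarrow> linear (R z)"
  by (intro bounded_linear.linear R_bounded_linear)

lemma R_bound_const: "z \<in> \<Omega> \<Longrightarrow> norm (R z x) \<le> C * norm x"
proof -
  assume z: "z \<in> \<Omega>"
  have "C / (1 + cmod z) \<le> C / 1"
    using C_nonneg by (intro divide_left_mono) (auto simp: add_pos_nonneg)
  then show ?thesis
    using R_bound[OF z, of x] mult_right_mono[of "C / (1 + cmod z)" C "norm x"] by auto
qed

lemma R_commute: "z \<in> \<Omega> \<Longrightarrow> w \<in> \<Omega> \<Longrightarrow> R w (R z x) = R z (R w x)"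
proof (cases "z = w")
  case False
  assume "z \<in> \<Omega>" "w \<in> \<Omega>"
  then have "(z - w) *\<^sub>C R w (R z x) = - ((w - z) *\<^sub>C R z (R w x))"
    using R_identity[of z w x] R_identity[of w z x] by (metis minus_diff_eq)
  then have "(z - w) *\<^sub>C R w (R z x) = (z - w) *\<^sub>C R z (R w x)"
    by (metis minus_diff_eq scaleC.minus_left)
  then have "(1 / (z - w)) *\<^sub>C (z - w) *\<^sub>C R w (R z x) = (1 / (z - w)) *\<^sub>C (z - w) *\<^sub>C R z (R w x)"
    by simp
  then show ?thesis using False by (simp only: scaleC_scaleC) simp
qed simp

lemma R_product:
  assumes "z \<in> \<Omega>" "w \<in> \<Omega>" "z \<noteq> w"
  shows "R w (R z x) = (1 / (w - z)) *\<^sub>C (R z x - R w x)"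
proof -
  have "(1 / (w - z)) *\<^sub>C (R z x - R w x) = (1 / (w - z)) *\<^sub>C (- ((z - w) *\<^sub>C R w (R z x)))"
    using R_identity[OF assms(1,2), of x] by (metis minus_diff_eq)
  also have "\<dots> = (1 / (w - z) * (w - z)) *\<^sub>C R w (R z x)"
    by (metis minus_diff_eq scaleC.minus_left scaleC_scaleC)
  finally show ?thesis using assms(3) by simp
qed

lemma R_lipschitz:
  assumes "z \<in> \<Omega>" "w \<in> \<Omega>"
  shows "norm (R w x - R z x) \<le> C * C * norm x * cmod (w - z)"
proof -
  have "norm (R w x - R z x) = cmod (w - z) * norm (R w (R z x))"
    using R_identity[OF assms, of x] by (simp add: norm_scaleC norm_minus_commute)
  also have "norm (R w (R z x)) \<le> C * (C * norm x)"
    using R_bound_const[OF assms(2), of "R z x"] mult_left_mono[OF R_bound_const[OF assms(1), of x] C_nonneg]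
    by linarith
  finally have "norm (R w x - R z x) \<le> cmod (w - z) * (C * (C * norm x))"
    by (simp add: mult_left_mono)
  then show ?thesis by (simp add: mult_ac)
qed

lemma R_continuous: "continuous_on \<Omega> (\<lambda>z. R z x)"
proof (rule lipschitz_on_continuous_on[OF lipschitz_onI])
  show "dist (R z x) (R w x) \<le> C * C * norm x * dist z w" if "z \<in> \<Omega>" "w \<in> \<Omega>" for z w
    using R_lipschitz[OF that(2,1)] by (simp add: dist_norm)
qed (use C_nonneg in simp)

lemma R_has_derivative:
  assumes z: "z \<in> \<Omega>"
  shows "((\<lambda>z. R z x) has_derivative (\<lambda>h. h *\<^sub>C (- R z (R z x)))) (at z within \<Omega>)"
  unfolding has_derivative_iff_norm
proof
  show "bounded_linear (\<lambda>h. h *\<^sub>C (- R z (R z x)))"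
    by (rule scaleC.bounded_linear_left)
  let ?y = "R z x"
  show "((\<lambda>w. norm (R w x - R z x - (w - z) *\<^sub>C (- R z (R z x))) / norm (w - z)) \<longlongrightarrow> 0) (at z within \<Omega>)"
  proof (rule Lim_null_comparison)
    show "\<forall>\<^sub>F w in at z within \<Omega>. norm (norm (R w x - R z x - (w - z) *\<^sub>C (- R z (R z x))) / norm (w - z))
        \<le> C * C * norm ?y * cmod (w - z)"
      unfolding eventually_at_filter
    proof (intro always_eventually allI impI)
      fix w assume w: "w \<noteq> z" "w \<in> \<Omega>"
      have "R w x - R z x - (w - z) *\<^sub>C (- R z ?y) = (z - w) *\<^sub>C R w ?y + (w - z) *\<^sub>C R z ?y"
        using R_identity[OF z w(2), of x] by (simp add: scaleC.minus_right)
      also have "\<dots> = (z - w) *\<^sub>C (R w ?y - R z ?y)"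
        by (simp add: scaleC.diff_left scaleC.diff_right algebra_simps)
      finally have "norm (R w x - R z x - (w - z) *\<^sub>C (- R z ?y)) = cmod (w - z) * norm (R w ?y - R z ?y)"
        by (simp add: norm_scaleC norm_minus_commute)
      then show "norm (norm (R w x - R z x - (w - z) *\<^sub>C (- R z (R z x))) / norm (w - z))
          \<le> C * C * norm ?y * cmod (w - z)"
        using w R_lipschitz[OF z w(2), of ?y] by simp
    qed
    have "((\<lambda>w. C * C * norm ?y * cmod (w - z)) \<longlongrightarrow> C * C * norm ?y * cmod (z - z)) (at z within \<Omega>)"
      by (intro tendsto_intros)
    then show "((\<lambda>w. C * C * norm ?y * cmod (w - z)) \<longlongrightarrow> 0) (at z within \<Omega>)" by simp
  qed
qed

subsection \<open>The contour\<close>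

text \<open>
  The contour is the branch \<open>t \<mapsto> \<rho> sin (b + i t)\<close> of a hyperbola. Its modulus, its real part and
  the modulus of its derivative are all comparable to \<open>cosh t\<close>. The function \<open>\<gamma>'\<close> is the derivative
  divided by \<open>\<i>\<close>.
\<close>

definition \<gamma> :: "real \<Rightarrow> complex" where "\<gamma> t = of_real \<rho> * sin (Complex b t)"
definition \<gamma>' :: "real \<Rightarrow> complex" where "\<gamma>' t = of_real \<rho> * cos (Complex b t)"

text \<open>
  As \<open>Re w\<close> runs from \<open>-\<pi>/2\<close> to \<open>b\<close>, the curves \<open>t \<mapsto> \<rho> sin (Re w + i t)\<close> sweep out everything to the
  left of the contour, and all of it lies in the region where the resolvent is controlled. The
  choice \<open>\<rho> = r/2\<close> puts the points with \<open>cosh t < 2\<close> into the disc, and \<open>sin b = \<kappa>/2\<close> keeps the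
  others outside the sector.
\<close>

lemma sin_strip_Omega:
  assumes "w \<in> vstrip (- pi / 2) b"
  shows "of_real \<rho> * sin w \<in> \<Omega>"
proof (cases "cosh (Im w) < 2")
  case True
  have "cmod (of_real \<rho> * sin w) \<le> \<rho> * cosh (Im w)"
    using rho_pos norm_sin_le_cosh[of w] by (simp add: norm_mult)
  also have "\<dots> < \<rho> * 2" using True rho_pos by simp
  finally show ?thesis by (simp add: left_region_def \<rho>_def)
next
  case False
  let ?c = "cosh (Im w)"
  have s: "sin (Re w) \<le> \<kappa> / 2"
    using assms b_less sin_monotone_2pi_le[of "Re w" b] by (auto simp: vstrip_def sin_b)
  have "(?c / 2)\<^sup>2 < (cmod (sin w))\<^sup>2"
  proof -
    have "(cos (Re w))\<^sup>2 \<le> 1" by (simp add: cos_squared_eq)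
    moreover have "4 \<le> ?c\<^sup>2" using False power_mono[of 2 ?c 2] by simp
    ultimately show ?thesis by (simp add: norm_sin_sq power_divide)
  qed
  then have lt: "?c / 2 < cmod (sin w)" by (rule power2_less_imp_less) simp
  have "Re (of_real \<rho> * sin w) = \<rho> * (sin (Re w) * ?c)" by (simp add: Re_sin_cosh)
  also have "\<dots> \<le> \<rho> * (\<kappa> / 2 * ?c)"
    using s rho_pos by (intro mult_left_mono mult_right_mono) auto
  also have "\<dots> < \<rho> * (\<kappa> * cmod (sin w))"
    using lt kappa_pos rho_pos by (auto intro!: mult_strict_left_mono)
  also have "\<dots> = \<kappa> * cmod (of_real \<rho> * sin w)" using rho_pos by (simp add: norm_mult)
  finally show ?thesis by (simp add: left_region_def)
qed

lemma gamma_Omega: "\<gamma> t \<in> \<Omega>"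
proof -
  have "- pi / 2 \<le> b" using b_pos pi_gt_zero by linarith
  then show ?thesis unfolding \<gamma>_def by (intro sin_strip_Omega) (simp add: vstrip_def)
qed

lemma Re_gamma: "Re (\<gamma> t) = p * cosh t"
  by (simp add: \<gamma>_def Re_sin_cosh sin_b p_def)

lemma Re_gamma_pos: "Re (\<gamma> t) > 0" using p_pos by (simp add: Re_gamma)

lemma gamma_nz [simp]: "\<gamma> t \<noteq> 0" using Re_gamma_pos[of t] by auto

lemma Re_gamma_ge: "p \<le> Re (\<gamma> t)"
  using p_pos cosh_real_ge_1[of t] by (simp add: Re_gamma)

lemma norm_gamma_ge: "p * cosh t \<le> cmod (\<gamma> t)"
  using complex_Re_le_cmod[of "\<gamma> t"] by (simp add: Re_gamma)

lemma norm_gamma_le: "cmod (\<gamma> t) \<le> \<rho> * cosh t"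
  using rho_pos norm_sin_le_cosh[of "Complex b t"] by (simp add: \<gamma>_def norm_mult)

lemma norm_gamma'_le: "cmod (\<gamma>' t) \<le> \<rho> * cosh t"
  using rho_pos norm_cos_le_cosh[of "Complex b t"] by (simp add: \<gamma>'_def norm_mult)

lemma continuous_gamma: "continuous_on S \<gamma>" and continuous_gamma': "continuous_on S \<gamma>'"
  unfolding \<gamma>_def \<gamma>'_def Complex_eq by (intro continuous_intros)+

lemma continuous_R_gamma: "continuous_on S (\<lambda>t. R (\<gamma> t) x)"
  by (rule continuous_on_compose2[OF R_continuous continuous_gamma]) (use gamma_Omega in auto)

lemma norm_R_gamma: "cmod (\<gamma>' t) * norm (R (\<gamma> t) x) \<le> 2 * C / \<kappa> * norm x"
proof -
  have "norm (R (\<gamma> t) x) \<le> C / (1 + cmod (\<gamma> t)) * norm x" by (rule R_bound[OF gamma_Omega])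
  also have "\<dots> \<le> C / (p * cosh t) * norm x"
    using norm_gamma_ge[of t] p_pos C_nonneg
    by (intro mult_right_mono divide_left_mono mult_pos_pos) (auto simp: add_pos_nonneg)
  finally have "cmod (\<gamma>' t) * norm (R (\<gamma> t) x) \<le> (\<rho> * cosh t) * (C / (p * cosh t) * norm x)"
    using rho_pos by (intro mult_mono norm_gamma'_le) auto
  also have "\<dots> = 2 * C / \<kappa> * norm x"
    using rho_pos by (simp add: p_def)
  finally show ?thesis .
qed

subsection \<open>Admissible symbols\<close>

text \<open>
  Symbols: holomorphic on the right half-plane, with polynomial decay on and to the right of the
  vertical line through the vertex of the contour. This region contains everything to the right of
  the contour.
\<close>

definition admissible :: "(complex \<Rightarrow> complex) \<Rightarrow> bool" where
  "admissible g \<longleftrightarrow> g holomorphic_on {z. Re z > 0} \<and>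
     (\<exists>K a. K \<ge> 0 \<and> a > 0 \<and> (\<forall>z. Re z \<ge> p \<longrightarrow> cmod (g z) \<le> K * cmod z powr (- a)))"

lemma admissibleI:
  assumes "g holomorphic_on {z. Re z > 0}" "a > 0"
    and "\<And>z. Re z \<ge> p \<Longrightarrow> cmod (g z) \<le> K * cmod z powr (- a)"
  shows "admissible g"
proof -
  have "cmod (g z) \<le> \<bar>K\<bar> * cmod z powr (- a)" if "Re z \<ge> p" for z
    using order_trans[OF assms(3)[OF that] mult_right_mono[OF abs_ge_self]] by simp
  then show ?thesis using assms(1,2) unfolding admissible_def by (intro conjI exI[of _ "\<bar>K\<bar>"] exI[of _ a]) auto
qed

lemma admissible_mult:
  assumes "admissible g" "h holomorphic_on {z. Re z > 0}" "\<And>z. Re z \<ge> p \<Longrightarrow> cmod (h z) \<le> L"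
  shows "admissible (\<lambda>z. g z * h z)"
proof -
  obtain K a where "K \<ge> 0" "a > 0" "\<And>z. Re z \<ge> p \<Longrightarrow> cmod (g z) \<le> K * cmod z powr (- a)"
    using assms(1) unfolding admissible_def by auto
  moreover have "cmod (g z * h z) \<le> (K * L) * cmod z powr (- a)" if "Re z \<ge> p" for z
  proof -
    have "cmod (g z * h z) \<le> (K * cmod z powr (- a)) * L"
      unfolding norm_mult using calculation(3)[OF that] assms(3)[OF that] \<open>K \<ge> 0\<close>
      by (intro mult_mono) auto
    then show ?thesis by (simp add: mult_ac)
  qed
  ultimately show ?thesis
    using assms(1,2) by (intro admissibleI[of _ a "K * L"] holomorphic_on_mult) (auto simp: admissible_def)
qed

lemma admissible_scale: "admissible g \<Longrightarrow> admissible (\<lambda>z. g z * c)"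
  by (rule admissible_mult[of g "\<lambda>_. c" "cmod c"]) auto

lemma resolvent_symbol_bound: "Re \<mu> \<le> 0 \<Longrightarrow> Re z \<ge> p \<Longrightarrow> cmod (1 / (\<mu> - z)) \<le> 1 / p"
proof -
  assume "Re \<mu> \<le> 0" "Re z \<ge> p"
  then have "p \<le> Re (z - \<mu>)" by simp
  also have "\<dots> \<le> cmod (\<mu> - z)" using complex_Re_le_cmod[of "z - \<mu>"] by (simp add: norm_minus_commute)
  finally show ?thesis using p_pos by (simp add: norm_divide frac_le)
qed

lemma admissible_resolvent: "admissible g \<Longrightarrow> Re \<mu> \<le> 0 \<Longrightarrow> admissible (\<lambda>z. g z / (\<mu> - z))"
proof -
  assume "admissible g" "Re \<mu> \<le> 0"
  then have "admissible (\<lambda>z. g z * (1 / (\<mu> - z)))"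
    by (intro admissible_mult[of g _ "1 / p"] holomorphic_intros resolvent_symbol_bound) auto
  then show ?thesis by simp
qed

lemma admissible_inverse: "admissible (\<lambda>z. 1 / z)"
proof (rule admissibleI[of _ 1 1])
  fix z assume "p \<le> Re z"
  then have "z \<noteq> 0" using p_pos by auto
  then show "cmod (1 / z) \<le> 1 * cmod z powr - 1"
    by (simp add: norm_divide powr_minus inverse_eq_divide)
qed (auto intro!: holomorphic_intros)

lemma continuous_on_gamma_holo: "g holomorphic_on {z. Re z > 0} \<Longrightarrow> continuous_on S (\<lambda>t. g (\<gamma> t))"
  by (rule continuous_on_compose2[OF holomorphic_on_imp_continuous_on continuous_gamma])
    (use Re_gamma_pos in auto)

lemma powr_decay_cosh:
  assumes "K \<ge> 0" "a \<ge> 0" "p * cosh t \<le> cmod z" "cmod u \<le> K * cmod z powr (- a)"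
  shows "cmod u \<le> (K * p powr (- a) * 2 powr a) * exp (- a * \<bar>t\<bar>)"
proof -
  have "cmod u \<le> K * (p * cosh t) powr (- a)"
    using assms p_pos by (intro order_trans[OF assms(4)] mult_left_mono powr_mono2') auto
  also have "\<dots> = K * p powr (- a) * cosh t powr (- a)" using p_pos by (simp add: powr_mult)
  also have "\<dots> \<le> K * p powr (- a) * (2 powr a * exp (- a * \<bar>t\<bar>))"
    using assms by (intro mult_left_mono cosh_powr_minus_le) auto
  finally show ?thesis by (simp add: mult_ac)
qed

lemma admissible_gamma_bound:
  assumes "admissible g"
  obtains K a where "K \<ge> 0" "a > 0" "\<And>t. cmod (g (\<gamma> t)) \<le> K * exp (- a * \<bar>t\<bar>)"
proof -
  obtain K a where K: "K \<ge> 0" "a > 0" "\<And>z. Re z \<ge> p \<Longrightarrow> cmod (g z) \<le> K * cmod z powr (- a)"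
    using assms unfolding admissible_def by auto
  have "cmod (g (\<gamma> t)) \<le> (K * p powr (- a) * 2 powr a) * exp (- a * \<bar>t\<bar>)" for t
    using K by (intro powr_decay_cosh[OF _ _ norm_gamma_ge] K(3) Re_gamma_ge) auto
  then show thesis using that[of "K * p powr (- a) * 2 powr a" a] K by simp
qed

subsection \<open>The calculus\<close>

text \<open>
  The operator \<open>\<Phi> g\<close> is \<open>1 / (2 \<pi> \<i>) \<integral> g(z) R z dz\<close> along the contour run through downwards, that is,
  positively oriented around the spectrum. The sign compensates for \<open>t\<close> running upwards, and the
  missing \<open>\<i>\<close> is that of \<open>\<gamma>'\<close>.
\<close>

definition integrand :: "(complex \<Rightarrow> complex) \<Rightarrow> 'x \<Rightarrow> real \<Rightarrow> 'x" where
  "integrand g x t = (g (\<gamma> t) * \<gamma>' t) *\<^sub>C R (\<gamma> t) x"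

definition \<Phi> :: "(complex \<Rightarrow> complex) \<Rightarrow> 'x \<Rightarrow> 'x" where
  "\<Phi> g x = (- 1 / (2 * pi)) *\<^sub>R integral UNIV (integrand g x)"

lemma integrand_bound:
  "norm (integrand g x t) \<le> cmod (g (\<gamma> t)) * (2 * C / \<kappa> * norm x)"
  using mult_left_mono[OF norm_R_gamma[of t x], of "cmod (g (\<gamma> t))"]
  by (simp add: integrand_def norm_scaleC norm_mult mult_ac)

lemma integrand_continuous: "admissible g \<Longrightarrow> continuous_on S (integrand g x)"
  unfolding integrand_def admissible_def
  by (intro continuous_intros continuous_on_gamma_holo continuous_gamma' continuous_R_gamma) auto

lemma integrand_integrable: "admissible g \<Longrightarrow> integrand g x integrable_on UNIV"
proof -
  assume g: "admissible g"
  obtain K a where K: "K \<ge> 0" "a > 0" "\<And>t. cmod (g (\<gamma> t)) \<le> K * exp (- a * \<bar>t\<bar>)"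
    using admissible_gamma_bound[OF g] by auto
  show ?thesis
  proof (rule integrable_exp_decay[OF integrand_continuous[OF g] K(2)])
    fix t
    have "norm (integrand g x t) \<le> cmod (g (\<gamma> t)) * (2 * C / \<kappa> * norm x)" by (rule integrand_bound)
    also have "\<dots> \<le> K * exp (- a * \<bar>t\<bar>) * (2 * C / \<kappa> * norm x)"
      using C_nonneg kappa_pos by (intro mult_right_mono K(3)) auto
    finally show "norm (integrand g x t) \<le> (K * (2 * C / \<kappa> * norm x)) * exp (- a * \<bar>t\<bar>)"
      by (simp add: mult_ac)
  qed
qed

lemma integrand_has_integral: "admissible g \<Longrightarrow> (integrand g x has_integral (- (2 * pi)) *\<^sub>R \<Phi> g x) UNIV"
  using integrable_integral[OF integrand_integrable[of g x]] by (simp add: \<Phi>_def)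

lemma Phi_eqI: "(integrand g x has_integral (- (2 * pi)) *\<^sub>R y) UNIV \<Longrightarrow> \<Phi> g x = y"
  by (simp add: \<Phi>_def integral_unique)

text \<open>
  The basic estimate. The bound does not depend on \<open>\<tau>\<close>, which will be \<open>ln n\<close>.
\<close>

lemma Phi_estimate:
  assumes g: "admissible g" and "a > 0"
    and K: "\<And>t. cmod (g (\<gamma> t)) \<le> K * exp (- a * \<bar>\<bar>t\<bar> - \<tau>\<bar>)"
  shows "norm (\<Phi> g x) \<le> K * (4 * C / (a * \<kappa> * pi)) * norm x"
proof -
  have K0: "K \<ge> 0"
    using order_trans[OF norm_ge_zero K[of 0]] by (simp add: zero_le_mult_iff)
  let ?M = "K * (2 * C / \<kappa> * norm x)"
  let ?e = "\<lambda>t::real. exp (- a * \<bar>t - \<tau>\<bar>) + exp (- a * \<bar>t - (- \<tau>)\<bar>)"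
  have e: "((\<lambda>t. ?M * ?e t) has_integral ?M * (2 / a + 2 / a)) UNIV"
    by (intro has_integral_mult_right has_integral_add has_integral_exp_abs assms)
  have "norm (integral UNIV (integrand g x)) \<le> integral UNIV (\<lambda>t. ?M * ?e t)"
  proof (rule integral_norm_bound_integral[OF integrand_integrable[OF g]])
    show "(\<lambda>t. ?M * ?e t) integrable_on UNIV" using e by blast
    fix t
    have "\<bar>\<bar>t\<bar> - \<tau>\<bar> = \<bar>t - \<tau>\<bar> \<or> \<bar>\<bar>t\<bar> - \<tau>\<bar> = \<bar>t - (- \<tau>)\<bar>"
      by auto
    then have "exp (- a * \<bar>\<bar>t\<bar> - \<tau>\<bar>) \<le> ?e t"
      by (elim disjE) (simp_all only: le_add_same_cancel1 le_add_same_cancel2 exp_ge_zero)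
    then have "cmod (g (\<gamma> t)) \<le> K * ?e t"
      using K[of t] mult_left_mono[OF _ K0] by (meson order_trans)
    then show "norm (integrand g x t) \<le> ?M * ?e t"
      using order_trans[OF integrand_bound mult_right_mono[of _ "K * ?e t" "2 * C / \<kappa> * norm x"]]
        C_nonneg kappa_pos by (simp add: mult_ac)
  qed
  also have "\<dots> = ?M * (2 / a + 2 / a)" by (rule integral_unique[OF e])
  also have "2 / a + 2 / a = 4 / a" by simp
  finally have "norm (integral UNIV (integrand g x)) \<le> ?M * (4 / a)" .
  from mult_left_mono[OF this, of "1 / (2 * pi)"]
  show ?thesis by (simp add: \<Phi>_def field_simps)
qed

lemma Phi_add: 
  assumes "admissible g" shows "\<Phi> g (x + y) = \<Phi> g x + \<Phi> g y"
proof (rule Phi_eqI)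
  have "integrand g (x + y) = (\<lambda>t. integrand g x t + integrand g y t)"
    by (simp add: fun_eq_iff integrand_def R_add[OF gamma_Omega] scaleC_add_right)
  then show "(integrand g (x + y) has_integral (- (2 * pi)) *\<^sub>R (\<Phi> g x + \<Phi> g y)) UNIV"
    using has_integral_add[OF integrand_has_integral[OF assms] integrand_has_integral[OF assms]]
    by (simp add: scaleR_add_right)
qed

lemma has_integral_scaleC:
  fixes f :: "real \<Rightarrow> 'b::complex_banach"
  shows "(f has_integral y) S \<Longrightarrow> ((\<lambda>t. c *\<^sub>C f t) has_integral c *\<^sub>C y) S"
  by (rule has_integral_linear[OF _ scaleC.bounded_linear_right, unfolded o_def])

lemma scaleC_scaleR: "c *\<^sub>C (s *\<^sub>R (x::'b::complex_normed_vector)) = s *\<^sub>R (c *\<^sub>C x)"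
  by (simp add: scaleC.scaleR_right)

lemma Phi_scaleC: 
  assumes "admissible g" shows "\<Phi> g (c *\<^sub>C x) = c *\<^sub>C \<Phi> g x"
proof (rule Phi_eqI)
  have "integrand g (c *\<^sub>C x) = (\<lambda>t. c *\<^sub>C integrand g x t)"
    by (simp add: fun_eq_iff integrand_def R_scaleC[OF gamma_Omega] scaleC_scaleC mult_ac)
  then show "(integrand g (c *\<^sub>C x) has_integral (- (2 * pi)) *\<^sub>R (c *\<^sub>C \<Phi> g x)) UNIV"
    using has_integral_scaleC[OF integrand_has_integral[OF assms], of c]
    by (simp only: scaleC_scaleR)
qed

lemma Phi_symbol_lincomb: 
  assumes "admissible g" "admissible h" shows "\<Phi> (\<lambda>z. g z + c * h z) x = \<Phi> g x + c *\<^sub>C \<Phi> h x"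
proof (rule Phi_eqI)
  have "integrand (\<lambda>z. g z + c * h z) x = (\<lambda>t. integrand g x t + c *\<^sub>C integrand h x t)"
    by (simp add: fun_eq_iff integrand_def scaleC_scaleC mult_ac scaleC_add_left[symmetric] ring_distribs)
  then show "(integrand (\<lambda>z. g z + c * h z) x has_integral (- (2 * pi)) *\<^sub>R (\<Phi> g x + c *\<^sub>C \<Phi> h x)) UNIV"
    using has_integral_add[OF integrand_has_integral[OF assms(1)]
        has_integral_scaleC[OF integrand_has_integral[OF assms(2)], of c]]
    by (simp only: scaleC_scaleR scaleR_add_right)
qed

lemma Phi_cong:
  assumes "\<And>z. Re z > 0 \<Longrightarrow> g z = h z" shows "\<Phi> g x = \<Phi> h x"
proof -
  have "integrand g x = integrand h x"
    using assms Re_gamma_pos by (simp add: fun_eq_iff integrand_def)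
  then show ?thesis by (simp add: \<Phi>_def)
qed

lemma R_Phi_commute:
  assumes "admissible g" "z \<in> \<Omega>" shows "R z (\<Phi> g x) = \<Phi> g (R z x)"
proof -
  interpret bounded_linear "R z" by (rule R_bounded_linear[OF assms(2)])
  have "((\<lambda>t. R z (integrand g x t)) has_integral R z ((- (2 * pi)) *\<^sub>R \<Phi> g x)) UNIV"
    by (rule has_integral_linear[OF integrand_has_integral[OF assms(1)] R_bounded_linear[OF assms(2)], unfolded o_def])
  moreover have "(\<lambda>t. R z (integrand g x t)) = integrand g (R z x)"
    by (simp add: fun_eq_iff integrand_def R_scaleC[OF assms(2)] R_commute[OF assms(2) gamma_Omega])
  ultimately have "(integrand g (R z x) has_integral (- (2 * pi)) *\<^sub>R R z (\<Phi> g x)) UNIV"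
    by (simp only: scaleR)
  from Phi_eqI[OF this] show ?thesis by simp
qed

subsection \<open>Products with resolvents\<close>

text \<open>
  The integrand is holomorphic to the right of the contour, so the contour may be moved to
  \<open>Re w = \<pi>/2\<close> in the coordinate \<open>z = \<rho> sin w\<close>. There it covers the ray \<open>[\<rho>, \<infinity>)\<close> twice in opposite
  directions.
\<close>

lemma scalar_contour_integral:
  assumes g: "admissible g" and \<mu>: "Re \<mu> \<le> 0"
  shows "((\<lambda>t. g (\<gamma> t) / (\<mu> - \<gamma> t) * \<gamma>' t) has_integral 0) UNIV"
proof -
  obtain K a where K: "K \<ge> 0" "a > 0" "\<And>z. Re z \<ge> p \<Longrightarrow> cmod (g z) \<le> K * cmod z powr (- a)"
    using g unfolding admissible_def by auto
  define q where "q = (\<lambda>w. g (of_real \<rho> * sin w) / (\<mu> - of_real \<rho> * sin w) * (of_real \<rho> * cos w))"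
  define U where "U = {w. Re (of_real \<rho> * sin w) > 0}"
  have openU: "open U" unfolding U_def
    by (intro open_Collect_less continuous_intros)
  have holo: "q holomorphic_on U"
  proof -
    have "(g \<circ> (\<lambda>w. of_real \<rho> * sin w)) holomorphic_on U"
      by (rule holomorphic_on_compose_gen[where t = "{z. Re z > 0}"])
        (use g in \<open>auto simp: admissible_def U_def intro!: holomorphic_intros\<close>)
    moreover have "\<mu> - of_real \<rho> * sin w \<noteq> 0" if "w \<in> U" for w
      using that \<mu> by (auto simp: U_def)
    ultimately show ?thesis unfolding q_def o_def
      by (intro holomorphic_intros) auto
  qed
  have Re_ge: "p * cosh (Im w) \<le> Re (of_real \<rho> * sin w)" if "w \<in> vstrip b (pi / 2)" for w
  proof -
    have "\<kappa> / 2 \<le> sin (Re w)"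
      using that b_pos sin_monotone_2pi_le[of b "Re w"] by (auto simp: vstrip_def sin_b)
    then show ?thesis using rho_pos
      by (auto simp: Re_sin_cosh p_def mult.assoc intro!: mult_left_mono mult_right_mono)
  qed
  have sub: "vstrip b (pi / 2) \<subseteq> U"
    using Re_ge p_pos by (force simp: U_def intro: less_le_trans[of _ "p * cosh _"])
  have bound: "cmod (q w) \<le> (2 / \<kappa> * K * p powr (- a) * 2 powr a) * exp (- a * \<bar>Im w\<bar>)"
    if w: "w \<in> vstrip b (pi / 2)" for w
  proof -
    let ?z = "of_real \<rho> * sin w" and ?c = "cosh (Im w)"
    have z: "p * ?c \<le> Re ?z" by (rule Re_ge[OF w])
    then have z': "p * ?c \<le> cmod ?z" using complex_Re_le_cmod[of ?z] by linarith
    have pc: "p \<le> p * ?c" using p_pos cosh_real_ge_1[of "Im w"] by simp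
    have "cmod (g ?z) \<le> K * cmod ?z powr (- a)" using z pc by (intro K(3)) linarith
    then have 1: "cmod (g ?z) \<le> (K * p powr (- a) * 2 powr a) * exp (- a * \<bar>Im w\<bar>)"
      using K z' by (intro powr_decay_cosh) auto
    have "p * ?c \<le> Re (?z - \<mu>)" using z \<mu> by simp
    also have "\<dots> \<le> cmod (\<mu> - ?z)" using complex_Re_le_cmod[of "?z - \<mu>"] by (simp add: norm_minus_commute)
    finally have 2: "p * ?c \<le> cmod (\<mu> - ?z)" .
    have "cmod (of_real \<rho> * cos w) \<le> \<rho> * ?c"
      using norm_cos_le_cosh[of w] rho_pos by (simp add: norm_mult)
    then have "cmod (of_real \<rho> * cos w) / cmod (\<mu> - ?z) \<le> (\<rho> * ?c) / (p * ?c)"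
      using 2 p_pos rho_pos by (intro frac_le) auto
    also have "\<dots> = 2 / \<kappa>" using rho_pos by (simp add: p_def)
    finally have 3: "cmod (of_real \<rho> * cos w) / cmod (\<mu> - ?z) \<le> 2 / \<kappa>" .
    have "cmod (q w) = cmod (g ?z) * (cmod (of_real \<rho> * cos w) / cmod (\<mu> - ?z))"
      by (simp add: q_def norm_mult norm_divide)
    also have "\<dots> \<le> (K * p powr (- a) * 2 powr a) * exp (- a * \<bar>Im w\<bar>) * (2 / \<kappa>)"
      using K by (intro mult_mono 1 3) auto
    finally show ?thesis by (simp add: mult_ac)
  qed
  have int: "(\<lambda>t. q (Complex x t)) integrable_on UNIV" if "x \<in> {b..pi/2}" for x
  proof (rule integrable_exp_decay[OF _ K(2)])
    have "Complex x t \<in> vstrip b (pi / 2)" for t using that by (simp add: vstrip_def)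
    then show "continuous_on UNIV (\<lambda>t. q (Complex x t))"
      "cmod (q (Complex x t)) \<le> (2 / \<kappa> * K * p powr (- a) * 2 powr a) * exp (- a * \<bar>t\<bar>)" for t
      using sub bound[of "Complex x t"] unfolding Complex_eq
      by (auto intro!: continuous_on_compose2[OF holomorphic_on_imp_continuous_on[OF holo]] continuous_intros)
  qed
  have "integral UNIV (\<lambda>t. q (Complex b t)) = integral UNIV (\<lambda>t. q (Complex (pi / 2) t))"
  proof (rule strip_shift[where G' = "deriv q" and T = 0, OF _ _ _ K(2) bound])
    show "(q has_derivative (\<lambda>h. h *\<^sub>C deriv q w)) (at w within vstrip b (pi / 2))"
      if "w \<in> vstrip b (pi / 2)" for w
      using holomorphic_derivI[OF holo openU, of w "vstrip b (pi/2)"] sub that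
      by (auto simp: has_field_derivative_def mult.commute[of _ "deriv q w"] intro: has_derivative_eq_rhs)
    show "continuous_on (vstrip b (pi / 2)) (deriv q)"
      by (rule continuous_on_subset[OF holomorphic_on_imp_continuous_on sub])
        (rule holomorphic_deriv[OF holo openU])
  qed (use b_less in auto)
  also have "\<dots> = 0"
  proof (rule integral_odd_eq_0)
    fix t
    have "cos (Complex (pi / 2) (- t)) = - cos (Complex (pi / 2) t)"
      "sin (Complex (pi / 2) (- t)) = sin (Complex (pi / 2) t)"
      by (simp_all add: complex_eq_iff Re_cos Im_cos Re_sin Im_sin field_simps)
    then show "q (Complex (pi / 2) (- t)) = - q (Complex (pi / 2) t)" by (simp add: q_def)
  qed (use int b_less in auto)
  finally have "integral UNIV (\<lambda>t. q (Complex b t)) = 0" .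
  then have "((\<lambda>t. q (Complex b t)) has_integral 0) UNIV"
    using int[of b] b_less integrable_integral by fastforce
  then show ?thesis by (simp add: q_def \<gamma>_def \<gamma>'_def)
qed

text \<open>
  Multiplicativity of the calculus against a resolvent. By the resolvent identity
  \<open>R \<mu> (R z) = (R z - R \<mu>) / (\<mu> - z)\<close>, and the contribution of \<open>R \<mu>\<close> vanishes.
\<close>

lemma R_Phi:
  assumes g: "admissible g" and \<mu>: "Re \<mu> \<le> 0"
  shows "R \<mu> (\<Phi> g x) = \<Phi> (\<lambda>z. g z / (\<mu> - z)) x"
proof -
  have l: "\<mu> \<in> \<Omega>" by (rule Omega_left[OF \<mu>])
  interpret bounded_linear "R \<mu>" by (rule R_bounded_linear[OF l])
  have ne: "\<gamma> t \<noteq> \<mu>" for t using Re_gamma_pos[of t] \<mu> by auto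
  have 1: "((\<lambda>t. R \<mu> (integrand g x t)) has_integral R \<mu> ((- (2 * pi)) *\<^sub>R \<Phi> g x)) UNIV"
    by (rule has_integral_linear[OF integrand_has_integral[OF g] R_bounded_linear[OF l], unfolded o_def])
  have 2: "((\<lambda>t. (g (\<gamma> t) / (\<mu> - \<gamma> t) * \<gamma>' t) *\<^sub>C R \<mu> x) has_integral 0 *\<^sub>C R \<mu> x) UNIV"
    by (rule has_integral_linear[OF scalar_contour_integral[OF g \<mu>] scaleC.bounded_linear_left, unfolded o_def])
  have eq: "R \<mu> (integrand g x t) + (g (\<gamma> t) / (\<mu> - \<gamma> t) * \<gamma>' t) *\<^sub>C R \<mu> x
      = integrand (\<lambda>z. g z / (\<mu> - z)) x t" for t
  proof -
    have "R \<mu> (integrand g x t) = (g (\<gamma> t) * \<gamma>' t) *\<^sub>C (1 / (\<mu> - \<gamma> t)) *\<^sub>C (R (\<gamma> t) x - R \<mu> x)"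
      by (simp only: integrand_def R_scaleC[OF l] R_product[OF gamma_Omega l ne])
    then show ?thesis
      by (simp add: integrand_def scaleC_scaleC scaleC.diff_right)
  qed
  have "(integrand (\<lambda>z. g z / (\<mu> - z)) x has_integral (- (2 * pi)) *\<^sub>R R \<mu> (\<Phi> g x)) UNIV"
    using has_integral_add[OF 1 2] unfolding eq by (simp only: scaleR scaleC.zero_left add_0_right)
  from Phi_eqI[OF this] show ?thesis by simp
qed

subsection \<open>Normalisation\<close>

lemma gamma_has_vector_derivative:
  "(\<gamma> has_vector_derivative \<i> * \<gamma>' t) (at t within S)"
proof -
  have 1: "((\<lambda>z. of_real \<rho> * sin (of_real b + \<i> * z)) has_field_derivative \<i> * \<gamma>' t) (at (of_real t))"
    by (auto intro!: derivative_eq_intros simp: \<gamma>'_def Complex_eq)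
  have 2: "\<gamma> = (\<lambda>t. of_real \<rho> * sin (of_real b + \<i> * of_real t))"
    by (simp add: fun_eq_iff \<gamma>_def Complex_eq)
  show ?thesis
    using has_vector_derivative_real_field[OF 1, of S] unfolding 2 .
qed

lemma Im_gamma: "Im (\<gamma> t) = \<rho> * cos b * sinh t"
  by (simp add: \<gamma>_def Im_sin_sinh)

text \<open>
  The function \<open>P\<close> is a primitive of \<open>1/z - 1/(z - \<rho>)\<close> along the contour. Its limits at the two ends
  differ by \<open>2 \<pi> \<i>\<close> because \<open>exp (P t) = \<gamma> t / (\<rho> - \<gamma> t)\<close> tends to \<open>-1\<close> while
  the imaginary part of \<open>P\<close> has the sign of \<open>t\<close>.
\<close>

lemma log_primitive:
  defines "P \<equiv> \<lambda>t. Ln (\<gamma> t) - Ln (of_real \<rho> - \<gamma> t)"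
    and "u \<equiv> \<lambda>t. \<gamma> t / (\<gamma> t - of_real \<rho>)"
  assumes t: "t \<noteq> 0"
  shows "P t = sgn t * pi * \<i> + Ln (u t)"
proof -
  have Im: "sgn (Im (\<gamma> t)) = sgn t"
    using rho_pos cos_b by (cases t "0::real" rule: linorder_cases) (simp_all add: Im_gamma sgn_mult)
  have nz: "of_real \<rho> - \<gamma> t \<noteq> 0"
    using Im t by (metis Im_complex_of_real eq_iff_diff_eq_0 sgn_0_0)
  have "exp (P t - sgn t * pi * \<i>) = \<gamma> t / (of_real \<rho> - \<gamma> t) * exp (- (sgn t * pi * \<i>))"
    unfolding P_def using nz by (simp only: diff_conv_add_uminus exp_add exp_minus exp_Ln gamma_nz divide_inverse) auto
  also have "exp (- (sgn t * pi * \<i>)) = - 1"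
    using t by (cases "t > 0") (simp_all add: exp_minus)
  also have "\<gamma> t / (of_real \<rho> - \<gamma> t) * - 1 = u t"
    unfolding u_def using nz by (simp add: divide_simps) (simp add: algebra_simps)
  finally have e: "exp (P t - sgn t * pi * \<i>) = u t" .
  have "- pi < Im (P t - sgn t * pi * \<i>)" "Im (P t - sgn t * pi * \<i>) \<le> pi"
  proof -
    have "Im (P t) \<in> {0<..<2*pi}" if "t > 0"
    proof -
      have "0 < Im (\<gamma> t)" "Im (of_real \<rho> - \<gamma> t) < 0" using Im that by (auto simp: sgn_if split: if_splits)
      then show ?thesis unfolding P_def
        using Im_Ln_pos_lt[of "\<gamma> t"] Im_Ln_pos_le[of "of_real \<rho> - \<gamma> t"] nz
          mpi_less_Im_Ln[of "of_real \<rho> - \<gamma> t"] Im_Ln_le_pi[of "of_real \<rho> - \<gamma> t"] by auto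
    qed
    moreover have "Im (P t) \<in> {-2*pi<..<0}" if "t < 0"
    proof -
      have "Im (\<gamma> t) < 0" "0 < Im (of_real \<rho> - \<gamma> t)" using Im that by (auto simp: sgn_if split: if_splits)
      then show ?thesis unfolding P_def
        using Im_Ln_pos_lt[of "of_real \<rho> - \<gamma> t"] Im_Ln_pos_le[of "\<gamma> t"] nz
          mpi_less_Im_Ln[of "\<gamma> t"] Im_Ln_le_pi[of "\<gamma> t"] by auto
    qed
    ultimately show "- pi < Im (P t - sgn t * pi * \<i>)" "Im (P t - sgn t * pi * \<i>) \<le> pi"
      using t by (cases "t > 0"; auto)+
  qed
  then have "Ln (u t) = P t - sgn t * pi * \<i>" unfolding e[symmetric] by (rule Ln_exp)
  then show ?thesis by simp
qed

lemma log_ratio_limit: "((\<lambda>t. Ln (\<gamma> t / (\<gamma> t - of_real \<rho>))) \<longlongrightarrow> 0) at_top"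
  and log_ratio_limit': "((\<lambda>t. Ln (\<gamma> (- t) / (\<gamma> (- t) - of_real \<rho>))) \<longlongrightarrow> 0) at_top"
proof -
  have *: "((\<lambda>t. Ln (\<gamma> (s * t) / (\<gamma> (s * t) - of_real \<rho>))) \<longlongrightarrow> 0) at_top" if s: "s \<in> {1, -1}" for s
  proof -
    let ?d = "\<lambda>t. \<rho> * cos b * ((exp t - exp (- t)) / 2)" and ?g = "\<lambda>t. \<gamma> (s * t) - of_real \<rho>"
    have "((\<lambda>t. of_real \<rho> / ?g t) \<longlongrightarrow> 0) at_top"
    proof (rule Lim_null_comparison)
      have "norm (of_real \<rho> / ?g t) \<le> \<rho> / ?d t"
        if "t > 0" for t
      proof -
        have "?d t = \<bar>Im (?g t)\<bar>"
          using s that rho_pos cos_b by (auto simp: Im_gamma sinh_field_def abs_mult)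
        also have "\<dots> \<le> cmod (?g t)" by (rule abs_Im_le_cmod)
        finally have le: "?d t \<le> cmod (?g t)" .
        moreover have "0 < ?d t"
          using that rho_pos cos_b by simp
        ultimately have "\<rho> / cmod (?g t) \<le> \<rho> / ?d t"
          using rho_pos by (intro divide_left_mono) (auto intro!: mult_pos_pos)
        then show ?thesis using rho_pos by (simp add: norm_divide)
      qed
      then show "\<forall>\<^sub>F t in at_top. norm (of_real \<rho> / ?g t)
          \<le> \<rho> / ?d t"
        by (intro eventually_mono[OF eventually_gt_at_top[of 0]])
      show "((\<lambda>t. \<rho> / ?d t) \<longlongrightarrow> 0) at_top"
        using rho_pos cos_b by real_asymp
    qed
    then have "((\<lambda>t. Ln (1 + of_real \<rho> / ?g t)) \<longlongrightarrow> Ln (1 + 0)) at_top"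
      by (intro tendsto_Ln tendsto_intros) auto
    moreover have "\<forall>\<^sub>F t in at_top. Ln (1 + of_real \<rho> / ?g t)
        = Ln (\<gamma> (s * t) / ?g t)"
      using eventually_gt_at_top[of 0]
    proof eventually_elim
      case (elim t)
      have "Im (\<gamma> (s * t)) \<noteq> 0" using elim s rho_pos cos_b by (auto simp: Im_gamma)
      then have "?g t \<noteq> 0"
        by (metis Im_complex_of_real eq_iff_diff_eq_0)
      then show ?case by (simp add: field_simps)
    qed
    ultimately show ?thesis by (simp add: tendsto_cong)
  qed
  show "((\<lambda>t. Ln (\<gamma> t / (\<gamma> t - of_real \<rho>))) \<longlongrightarrow> 0) at_top" using *[of 1] by simp
  show "((\<lambda>t. Ln (\<gamma> (- t) / (\<gamma> (- t) - of_real \<rho>))) \<longlongrightarrow> 0) at_top" using *[of "-1"] by simp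
qed

lemma gamma_neq_rho: "\<gamma> t \<noteq> of_real \<rho>"
proof
  assume eq: "\<gamma> t = of_real \<rho>"
  then have "Im (\<gamma> t) = 0" by simp
  then have "t = 0" using rho_pos cos_b by (simp add: Im_gamma)
  then show False using eq Re_gamma[of t] p_less_rho by simp
qed

lemma compensator_integral:
  assumes int: "(\<lambda>t. (1 / \<gamma> t - 1 / (\<gamma> t - of_real \<rho>)) * \<gamma>' t) integrable_on UNIV"
  shows "integral UNIV (\<lambda>t. (1 / \<gamma> t - 1 / (\<gamma> t - of_real \<rho>)) * \<gamma>' t) = of_real (2 * pi)"
proof -
  let ?f = "\<lambda>t. (1 / \<gamma> t - 1 / (\<gamma> t - of_real \<rho>)) * \<gamma>' t"
  define P where "P = (\<lambda>t. Ln (\<gamma> t) - Ln (of_real \<rho> - \<gamma> t))"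
  have P': "(P has_vector_derivative \<i> * ?f t) (at t within S)" for t S
  proof -
    have g: "\<gamma> t \<notin> \<real>\<^sub>\<le>\<^sub>0" using Re_gamma_pos[of t] by (auto simp: complex_nonpos_Reals_iff)
    have h: "of_real \<rho> - \<gamma> t \<notin> \<real>\<^sub>\<le>\<^sub>0"
    proof
      assume a: "of_real \<rho> - \<gamma> t \<in> \<real>\<^sub>\<le>\<^sub>0"
      then have "Im (\<gamma> t) = 0" by (auto simp: complex_nonpos_Reals_iff)
      then have "t = 0" using rho_pos cos_b by (simp add: Im_gamma)
      then show False using a p_less_rho Re_gamma[of t] by (auto simp: complex_nonpos_Reals_iff)
    qed
    have 1: "((Ln \<circ> \<gamma>) has_vector_derivative \<i> * \<gamma>' t * inverse (\<gamma> t)) (at t within S)"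
      by (rule field_vector_diff_chain_within[OF gamma_has_vector_derivative])
        (rule has_field_derivative_at_within[OF has_field_derivative_Ln[OF g]])
    have "((\<lambda>t. of_real \<rho> - \<gamma> t) has_vector_derivative 0 - \<i> * \<gamma>' t) (at t within S)"
      by (intro has_vector_derivative_diff has_vector_derivative_const gamma_has_vector_derivative)
    then have 2: "((Ln \<circ> (\<lambda>t. of_real \<rho> - \<gamma> t)) has_vector_derivative (0 - \<i> * \<gamma>' t) * inverse (of_real \<rho> - \<gamma> t)) (at t within S)"
      by (rule field_vector_diff_chain_within)
        (rule has_field_derivative_at_within[OF has_field_derivative_Ln[OF h]])
    have eq: "\<i> * \<gamma>' t * inverse (\<gamma> t) - (0 - \<i> * \<gamma>' t) * inverse (of_real \<rho> - \<gamma> t) = \<i> * ?f t"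
      using gamma_neq_rho[of t] by (simp add: divide_simps) (simp add: algebra_simps)
    show ?thesis
      using has_vector_derivative_diff[OF 1 2] unfolding eq by (simp add: P_def o_def)
  qed
  have "((\<lambda>N. \<i> * integral {-N..N} ?f) \<longlongrightarrow> \<i> * integral UNIV ?f) at_top"
    by (intro tendsto_intros integral_UNIV_limit int)
  moreover have "((\<lambda>N. 2 * pi * \<i> + Ln (\<gamma> N / (\<gamma> N - of_real \<rho>)) - Ln (\<gamma> (- N) / (\<gamma> (- N) - of_real \<rho>)))
      \<longlongrightarrow> 2 * pi * \<i> + 0 - 0) at_top"
    by (intro tendsto_intros log_ratio_limit log_ratio_limit')
  moreover have "\<forall>\<^sub>F N in at_top. 2 * pi * \<i> + Ln (\<gamma> N / (\<gamma> N - of_real \<rho>)) - Ln (\<gamma> (- N) / (\<gamma> (- N) - of_real \<rho>))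
      = \<i> * integral {-N..N} ?f"
    using eventually_gt_at_top[of 0]
  proof eventually_elim
    case (elim N)
    have "((\<lambda>t. \<i> * ?f t) has_integral (P N - P (- N))) {-N..N}"
      by (rule fundamental_theorem_of_calculus) (use elim P' in auto)
    then have "\<i> * integral {-N..N} ?f = P N - P (- N)"
      using integral_unique by (metis integral_mult_right)
    then show ?case
      using log_primitive[of N] log_primitive[of "- N"] elim by (simp add: P_def)
  qed
  ultimately have "((\<lambda>N. \<i> * integral {-N..N} ?f) \<longlongrightarrow> 2 * pi * \<i>) at_top"
    by (auto elim: Lim_transform_eventually)
  then have "\<i> * integral UNIV ?f = 2 * pi * \<i>"
    using \<open>((\<lambda>N. \<i> * integral {-N..N} ?f) \<longlongrightarrow> \<i> * integral UNIV ?f) at_top\<close>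
      tendsto_unique[OF trivial_limit_at_top_linorder] by blast
  then show ?thesis by simp
qed

text \<open>
  The normalisation \<open>\<Phi> (1/z) = A\<inverse>\<close>. With \<open>y = R 0 x\<close>, the function \<open>R z y - y / (z - \<rho>)\<close> is holomorphic
  to the left of the contour, and it decays like \<open>1/|z|\<^sup>2\<close> because \<open>R z y = (y - R z x) / z\<close>. Moving the
  contour to \<open>Re w = -\<pi>/2\<close>, where it covers the ray \<open>(-\<infinity>, -\<rho>]\<close> twice in opposite directions, shows
  that its integral vanishes. What remains is a scalar integral. The term \<open>y / (z - \<rho>)\<close>, whose pole
  lies to the right of the contour, only serves to make the integrals converge.
\<close>

lemma Phi_inverse: "\<Phi> (\<lambda>z. 1 / z) x = - R 0 x"
proof -
  let ?S = "vstrip (- pi / 2) b"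
  define y where "y = R 0 x"
  define z where "z = (\<lambda>w::complex. complex_of_real \<rho> * sin w)"
  let ?v = "\<lambda>w. complex_of_real \<rho> * cos w"
  let ?q = "\<lambda>w. 1 / z w - 1 / (z w - of_real \<rho>)"
  define H where "H = (\<lambda>w. R (z w) y - (1 / (z w - of_real \<rho>)) *\<^sub>C y)"
  define G where "G = (\<lambda>w. ?v w *\<^sub>C H w)"
  have zO: "z w \<in> \<Omega>" if "w \<in> ?S" for w
    using sin_strip_Omega[OF that] by (simp add: z_def)
  have z_ne: "z w \<noteq> of_real \<rho>" if "w \<in> ?S" for w
  proof
    assume eq: "z w = of_real \<rho>"
    then have s: "Im (z w) = 0" "Re (z w) = \<rho>" by auto
    have "sin (Re w) \<le> \<kappa> / 2"
      using that b_less sin_monotone_2pi_le[of "Re w" b] by (auto simp: vstrip_def sin_b)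
    then have l: "sin (Re w) < 1" using kappa_le by linarith
    show False
    proof (cases "Im w = 0")
      case True
      then show ?thesis using s l rho_pos by (simp add: z_def Re_sin_cosh)
    next
      case False
      then have "cos (Re w) = 0" using s rho_pos by (simp add: z_def Im_sin_sinh)
      then have "Re w = - pi / 2"
        using that b_less cos_gt_zero_pi[of "Re w"] by (force simp: vstrip_def)
      then have "Re (z w) = - \<rho> * cosh (Im w)" by (simp add: z_def Re_sin_cosh)
      moreover have "0 < \<rho> * cosh (Im w)" using rho_pos by simp
      ultimately show ?thesis using s rho_pos by linarith
    qed
  qed
  define H' where "H' = (\<lambda>w. ?v w *\<^sub>C (- R (z w) (R (z w) y)) -
      (- ?v w / (z w - of_real \<rho>)\<^sup>2) *\<^sub>C y)"
  define G' where "G' = (\<lambda>w. ?v w *\<^sub>C H' w + (- of_real \<rho> * sin w) *\<^sub>C H w)"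
  have z': "(z has_field_derivative ?v w) (at w within S)" for w S
    unfolding z_def by (auto intro!: derivative_eq_intros)
  have H_der: "(H has_derivative (\<lambda>h. h *\<^sub>C H' w)) (at w within ?S)" if w: "w \<in> ?S" for w
  proof -
    have 1: "((\<lambda>w. R (z w) y) has_derivative (\<lambda>h. h *\<^sub>C (?v w *\<^sub>C (- R (z w) (R (z w) y))))) (at w within ?S)"
      by (rule has_derivative_scaleC_chain[OF z' w, where T = \<Omega>]) (use zO R_has_derivative in auto)
    have "((\<lambda>w. 1 / (z w - of_real \<rho>)) has_field_derivative - ?v w / (z w - of_real \<rho>)\<^sup>2) (at w within ?S)"
      using z_ne[OF w] by (auto intro!: derivative_eq_intros z' simp: power2_eq_square)
    from scaleC.FDERIV[OF this[unfolded has_field_derivative_def] has_derivative_const[of y]]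
    have 2: "((\<lambda>w. (1 / (z w - of_real \<rho>)) *\<^sub>C y) has_derivative
        (\<lambda>h. h *\<^sub>C ((- ?v w / (z w - of_real \<rho>)\<^sup>2) *\<^sub>C y))) (at w within ?S)"
      by (simp add: scaleC.zero_right scaleC_scaleC mult.commute)
    show ?thesis unfolding H_def H'_def
      by (rule has_derivative_eq_rhs[OF has_derivative_diff[OF 1 2]]) (simp add: fun_eq_iff scaleC.diff_right)
  qed
  have G_der: "(G has_derivative (\<lambda>h. h *\<^sub>C G' w)) (at w within ?S)" if w: "w \<in> ?S" for w
    unfolding G_def G'_def
    by (rule has_derivative_scaleC_mult[OF _ H_der[OF w]]) (auto intro!: derivative_eq_intros)
  have contz: "continuous_on S z" for S unfolding z_def by (intro continuous_intros)
  have contR: "continuous_on ?S (\<lambda>w. R (z w) v)" for v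
    by (rule continuous_on_compose2[OF R_continuous contz]) (use zO in auto)
  have contRR: "continuous_on ?S (\<lambda>w. R (z w) (R (z w) y))"
  proof -
    have "continuous_on \<Omega> (\<lambda>u. R u (R u y))"
    proof (rule lipschitz_on_continuous_on[OF lipschitz_onI])
      fix u v assume uv: "u \<in> \<Omega>" "v \<in> \<Omega>"
      interpret bounded_linear "R u" by (rule R_bounded_linear[OF uv(1)])
      let ?d = "cmod (u - v)"
      have 1: "norm (R u (R u y - R v y)) \<le> C * (C * C * norm y * ?d)"
        by (rule order_trans[OF R_bound_const[OF uv(1)] mult_left_mono[OF R_lipschitz[OF uv(2,1)] C_nonneg]])
      have 2: "norm (R u (R v y) - R v (R v y)) \<le> C * C * (C * norm y) * ?d"
        using C_nonneg by (intro order_trans[OF R_lipschitz[OF uv(2,1)] mult_right_mono] mult_left_mono R_bound_const uv) auto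
      show "dist (R u (R u y)) (R v (R v y)) \<le> (C * (C * C * norm y) + C * C * (C * norm y)) * dist u v"
        using norm_triangle_le[OF add_mono[OF 1 2]] by (simp add: dist_norm diff algebra_simps)
    qed (use C_nonneg in simp)
    then show ?thesis by (rule continuous_on_compose2[OF _ contz]) (use zO in auto)
  qed
  have contH: "continuous_on ?S H" unfolding H_def
    using z_ne by (intro continuous_intros contR contz) auto
  have contG: "continuous_on ?S G" unfolding G_def by (intro continuous_intros contH)
  have contG': "continuous_on ?S G'" unfolding G'_def H'_def
    using z_ne by (intro continuous_intros contRR contH contz) auto
  have H_eq: "H w = ?q w *\<^sub>C y - (1 / z w) *\<^sub>C R (z w) x"
    if "w \<in> ?S" "z w \<noteq> 0" for w
  proof -
    have "R (z w) y = (1 / z w) *\<^sub>C (y - R (z w) x)"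
      using R_product[OF zero_in_Omega zO[OF that(1)], of x] that(2) by (simp add: y_def)
    then show ?thesis unfolding H_def
      by (simp add: scaleC.diff_left scaleC.diff_right)
  qed
  \<comment> \<open>The bound \<open>5\<close> ensures \<open>cosh (Im w) \<ge> 3\<close>.\<close>
  have decay: "norm (?v w) * (A / (cmod (z w))\<^sup>2) \<le> (8 * A / \<rho>) * exp (- 1 * \<bar>Im w\<bar>)"
    and large: "2 * \<rho> \<le> cmod (z w)"
    if "w \<in> ?S" "5 \<le> \<bar>Im w\<bar>" "A \<ge> 0" for w A
  proof -
    let ?c = "cosh (Im w)"
    have "1 + 5 \<le> exp \<bar>Im w\<bar>" using exp_ge_add_one_self[of "\<bar>Im w\<bar>"] that by linarith
    then have c: "3 \<le> ?c" using exp_abs_le_cosh[of "Im w"] by linarith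
    have "(?c * (3/4))\<^sup>2 \<le> (cmod (sin w))\<^sup>2"
    proof -
      have "(cos (Re w))\<^sup>2 \<le> 1" by (simp add: cos_squared_eq)
      moreover have "9 \<le> ?c\<^sup>2" using c power_mono[of 3 ?c 2] by simp
      ultimately show ?thesis by (simp add: norm_sin_sq power_mult_distrib power_divide)
    qed
    then have "?c * (3/4) \<le> cmod (sin w)" by (rule power2_le_imp_le) simp
    then have zc: "\<rho> * (?c * (3/4)) \<le> cmod (z w)"
      using rho_pos by (simp add: z_def norm_mult)
    have "2 * \<rho> \<le> \<rho> * (?c * (3/4))" using c rho_pos by (simp add: field_simps)
    then show "2 * \<rho> \<le> cmod (z w)" using zc by linarith
    have "norm (?v w) \<le> \<rho> * ?c"
      using norm_cos_le_cosh[of w] rho_pos by (simp add: norm_mult)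
    moreover have "0 < \<rho> * (?c * (3/4))" "0 < cmod (z w)"
      using rho_pos zc less_le_trans[of 0 "\<rho> * (?c * (3/4))" "cmod (z w)"] by auto
    then have "A / (cmod (z w))\<^sup>2 \<le> A / (\<rho> * (?c * (3/4)))\<^sup>2"
      using zc that by (intro divide_left_mono power_mono mult_pos_pos[of "_ ^ 2"] zero_less_power) auto
    ultimately have "norm (?v w) * (A / (cmod (z w))\<^sup>2) \<le> (\<rho> * ?c) * (A / (\<rho> * (?c * (3/4)))\<^sup>2)"
      using rho_pos that by (intro mult_mono) auto
    also have "\<dots> = (16 * A / (9 * \<rho>)) * (1 / ?c)"
      using rho_pos by (simp add: power2_eq_square)
    also have "\<dots> \<le> (16 * A / (9 * \<rho>)) * (2 * exp (- \<bar>Im w\<bar>))"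
    proof (rule mult_left_mono)
      show "1 / ?c \<le> 2 * exp (- \<bar>Im w\<bar>)"
        using exp_abs_le_cosh[of "Im w"] by (simp add: exp_minus field_simps)
    qed (use rho_pos that in auto)
    also have "\<dots> \<le> (8 * A / \<rho>) * exp (- 1 * \<bar>Im w\<bar>)"
      using rho_pos that by (simp add: divide_simps)
    finally show "norm (?v w) * (A / (cmod (z w))\<^sup>2) \<le> (8 * A / \<rho>) * exp (- 1 * \<bar>Im w\<bar>)" .
  qed
  have comp: "cmod (?q w) \<le> 2 * \<rho> / (cmod (z w))\<^sup>2"
    if "w \<in> ?S" "2 * \<rho> \<le> cmod (z w)" for w
  proof -
    have nz: "cmod (z w) > 0" using that rho_pos by linarith
    have "cmod (z w) - \<rho> \<le> cmod (z w - of_real \<rho>)"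
      using norm_triangle_ineq2[of "z w" "of_real \<rho>"] rho_pos by simp
    then have "cmod (z w) / 2 \<le> cmod (z w - of_real \<rho>)" using that(2) by linarith
    then have "\<rho> / (cmod (z w) * cmod (z w - of_real \<rho>)) \<le> \<rho> / (cmod (z w) * (cmod (z w) / 2))"
      using nz rho_pos z_ne[OF that(1)] by (intro divide_left_mono mult_left_mono) (auto simp: zero_less_mult_iff)
    moreover have "?q w = - of_real \<rho> / (z w * (z w - of_real \<rho>))"
      using nz z_ne[OF that(1)] by (auto simp: divide_simps)
    then have "cmod (?q w) = \<rho> / (cmod (z w) * cmod (z w - of_real \<rho>))"
      using rho_pos by (simp add: norm_divide norm_mult)
    ultimately show ?thesis by (simp add: power2_eq_square mult.commute[of 2 \<rho>])
  qed
  define A where "A = 2 * \<rho> * norm y + C * norm x"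
  have A0: "A \<ge> 0" using rho_pos C_nonneg by (simp add: A_def)
  have G_bound: "norm (G w) \<le> (8 * A / \<rho>) * exp (- 1 * \<bar>Im w\<bar>)" if w: "w \<in> ?S" "5 \<le> \<bar>Im w\<bar>" for w
  proof -
    have l: "2 * \<rho> \<le> cmod (z w)" using large[OF w A0] .
    then have nz: "cmod (z w) > 0" using rho_pos by linarith
    have "norm (R (z w) x) \<le> C / (1 + cmod (z w)) * norm x" by (rule R_bound[OF zO[OF w(1)]])
    also have "\<dots> \<le> C / cmod (z w) * norm x"
      using nz C_nonneg by (intro mult_right_mono divide_left_mono mult_pos_pos) (auto intro: add_pos_nonneg)
    finally have "norm ((1 / z w) *\<^sub>C R (z w) x) \<le> C * norm x / (cmod (z w))\<^sup>2"
      using nz by (simp add: norm_scaleC norm_divide power2_eq_square field_simps)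
    moreover have "norm (?q w *\<^sub>C y) \<le> 2 * \<rho> / (cmod (z w))\<^sup>2 * norm y"
      unfolding norm_scaleC by (intro mult_right_mono comp w l) auto
    ultimately have "norm (H w) \<le> 2 * \<rho> / (cmod (z w))\<^sup>2 * norm y + C * norm x / (cmod (z w))\<^sup>2"
      unfolding H_eq[OF w(1), OF nz[unfolded zero_less_norm_iff]]
      by (intro order_trans[OF norm_triangle_ineq4 add_mono])
    also have "\<dots> = A / (cmod (z w))\<^sup>2" by (simp add: A_def add_divide_distrib)
    finally have "norm (G w) \<le> norm (?v w) * (A / (cmod (z w))\<^sup>2)"
      unfolding G_def norm_scaleC by (intro mult_left_mono) auto
    also note decay[OF w A0]
    finally show ?thesis .
  qed
  have int: "(\<lambda>t. G (Complex u t)) integrable_on UNIV" if "u \<in> {-pi/2..b}" for u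
  proof (rule integrable_exp_decay[where T = 5 and a = 1])
    have m: "Complex u t \<in> ?S" for t using that by (simp add: vstrip_def)
    show "continuous_on UNIV (\<lambda>t. G (Complex u t))"
      by (rule continuous_on_compose2[OF contG]) (use m in \<open>auto simp: Complex_eq intro!: continuous_intros\<close>)
    show "norm (G (Complex u t)) \<le> (8 * A / \<rho>) * exp (- 1 * \<bar>t\<bar>)" if "5 \<le> \<bar>t\<bar>" for t
      using G_bound[OF m, of t] that by simp
  qed simp
  have le: "- pi / 2 \<le> b" using b_pos pi_gt_zero by linarith
  have "integral UNIV (\<lambda>t. G (Complex (- pi / 2) t)) = integral UNIV (\<lambda>t. G (Complex b t))"
    by (rule strip_shift[OF le G_der contG' zero_less_one G_bound])
  moreover have "integral UNIV (\<lambda>t. G (Complex (- pi / 2) t)) = 0"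
  proof (rule integral_odd_eq_0)
    fix t
    have "cos (Complex (- pi / 2) (- t)) = - cos (Complex (- pi / 2) t)"
      "sin (Complex (- pi / 2) (- t)) = sin (Complex (- pi / 2) t)"
      by (simp_all add: complex_eq_iff Re_cos Im_cos Re_sin Im_sin field_simps)
    then show "G (Complex (- pi / 2) (- t)) = - G (Complex (- pi / 2) t)"
      by (simp add: G_def H_def z_def scaleC.minus_left)
  qed (use int le in auto)
  ultimately have G0: "((\<lambda>t. G (Complex b t)) has_integral 0) UNIV"
    using int[of b] le integrable_integral by fastforce
  have mem: "Complex b t \<in> ?S" for t using le by (simp add: vstrip_def)
  have zg: "z (Complex b t) = \<gamma> t" for t by (simp add: z_def \<gamma>_def)
  let ?f = "\<lambda>t. (1 / \<gamma> t - 1 / (\<gamma> t - of_real \<rho>)) * \<gamma>' t"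
  have fint: "?f integrable_on UNIV"
  proof (rule integrable_exp_decay[where T = 5 and a = 1])
    show "continuous_on UNIV ?f"
      using gamma_neq_rho by (intro continuous_intros continuous_gamma continuous_gamma') auto
    fix t :: real assume t: "5 \<le> \<bar>t\<bar>"
    then have t': "5 \<le> \<bar>Im (Complex b t)\<bar>" by simp
    have A: "0 \<le> 2 * \<rho>" using rho_pos by simp
    have "cmod (?f t) \<le> 2 * \<rho> / (cmod (\<gamma> t))\<^sup>2 * cmod (\<gamma>' t)"
      unfolding norm_mult using comp[OF mem large[OF mem t' A]] by (intro mult_right_mono) (auto simp: zg)
    also have "\<dots> \<le> (8 * (2 * \<rho>) / \<rho>) * exp (- 1 * \<bar>t\<bar>)"
      using decay[OF mem t' A] by (simp add: zg \<gamma>'_def mult.commute)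
    finally show "cmod (?f t) \<le> (8 * (2 * \<rho>) / \<rho>) * exp (- 1 * \<bar>t\<bar>)" .
  qed simp
  have f: "(?f has_integral of_real (2 * pi)) UNIV"
    using integrable_integral[OF fint] compensator_integral[OF fint] by simp
  have f': "((\<lambda>t. ?f t *\<^sub>C y) has_integral of_real (2 * pi) *\<^sub>C y) UNIV"
    by (rule has_integral_linear[OF f scaleC.bounded_linear_left, unfolded o_def])
  have "?f t *\<^sub>C y - G (Complex b t) = integrand (\<lambda>z. 1 / z) x t" for t
  proof -
    have "G (Complex b t) = \<gamma>' t *\<^sub>C ((1 / \<gamma> t - 1 / (\<gamma> t - of_real \<rho>)) *\<^sub>C y - (1 / \<gamma> t) *\<^sub>C R (\<gamma> t) x)"
      using H_eq[OF mem, of t] by (simp add: G_def zg \<gamma>'_def)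
    then show ?thesis
      by (simp add: scaleC.diff_right scaleC_scaleC integrand_def mult.commute)
  qed
  then have "(integrand (\<lambda>z. 1 / z) x has_integral of_real (2 * pi) *\<^sub>C y - 0) UNIV"
    using has_integral_diff[OF f' G0] by simp
  then have "(integrand (\<lambda>z. 1 / z) x has_integral (- (2 * pi)) *\<^sub>R (- y)) UNIV"
    by (simp only: scaleC_of_real diff_0_right scaleR_minus_left scaleR_minus_right minus_minus)
  from Phi_eqI[OF this] show ?thesis by (simp add: y_def)
qed

end

section \<open>Cauchy's formula for a pair of rays\<close>

lemma contour_integral_horizontal:
  fixes F :: "complex \<Rightarrow> complex"
  assumes "a < b" and cont: "continuous_on {a..b} (\<lambda>s. F (Complex s y))"
  shows "(F has_contour_integral integral {a..b} (\<lambda>s. F (Complex s y))) (linepath (Complex a y) (Complex b y))"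
proof -
  let ?I = "integral {a..b} (\<lambda>s. F (Complex s y))"
  have "((\<lambda>s. F (Complex s y)) has_integral ?I) (cbox a b)"
    using integrable_continuous_real[OF cont] integrable_integral by auto
  from has_integral_affinity'[OF this, of "b - a" a]
  have "((\<lambda>x. F (Complex ((b - a) * x + a) y)) has_integral ?I /\<^sub>R (b - a)) {0..1}"
    using assms by simp
  then have "((\<lambda>x. F (Complex ((b - a) * x + a) y) * of_real (b - a)) has_integral (?I /\<^sub>R (b - a)) * of_real (b - a)) {0..1}"
    by (rule has_integral_mult_left)
  moreover have "(?I /\<^sub>R (b - a)) * of_real (b - a) = ?I"
    using assms by (simp add: scaleR_conv_of_real)
  moreover have "Complex ((b - a) * x + a) y = linepath (Complex a y) (Complex b y) x" for x
    by (simp add: linepath_def complex_eq_iff algebra_simps)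
  moreover have "complex_of_real (b - a) = Complex b y - Complex a y" by (simp add: complex_eq_iff)
  ultimately show ?thesis by (simp add: has_contour_integral_linepath)
qed

text \<open>
  Cauchy's formula for the two rays of argument \<open>-\<delta>\<close> and \<open>\<delta>\<close>, parametrised by \<open>exp (s \<plusminus> \<i> \<delta>)\<close>: the
  residue theorem in the logarithmic coordinate \<open>v\<close>, for the rectangles \<open>|Re v| \<le> N\<close>, \<open>|Im v| \<le> \<delta>\<close>.
\<close>

lemma Cauchy_formula_rays:
  fixes f :: "complex \<Rightarrow> complex"
  assumes \<delta>: "pi / 2 \<le> \<delta>" "\<delta> < pi" and z: "Re z > 0"
    and holo: "(\<lambda>v. f (exp v)) holomorphic_on {v. \<bar>Im v\<bar> < pi}"
    and a: "a > 0" and decay: "\<And>s y. \<bar>y\<bar> \<le> \<delta> \<Longrightarrow> cmod (f (exp (Complex s y))) \<le> K * exp (- a * \<bar>s\<bar>)"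
    and fz: "f z \<noteq> 0"
  defines "F \<equiv> \<lambda>v. f (exp v) * exp v / (exp v - z)"
  shows "((\<lambda>s. F (Complex s (- \<delta>)) - F (Complex s \<delta>)) has_integral (2 * pi * \<i> * f z)) UNIV"
proof -
  let ?D = "\<lambda>s. F (Complex s (- \<delta>)) - F (Complex s \<delta>)"
  define S where "S = {v. \<bar>Im v\<bar> < pi}"
  define w where "w = Ln z"
  have z0: "z \<noteq> 0" using z by auto
  have w: "exp w = z" "\<bar>Im w\<bar> < pi / 2" unfolding w_def using z0 Re_Ln_pos_lt[OF z0] z by auto
  have wS: "w \<in> S" using w pi_gt_zero by (simp add: S_def)
  have S_alt: "S = {v. Im v < pi} \<inter> {v. Im v > - pi}" by (auto simp: S_def)
  have openS: "open S" unfolding S_alt by (intro open_Int open_halfspace_Im_lt open_halfspace_Im_gt)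
  have "convex S" unfolding S_alt by (intro convex_Int convex_halfspace_Im_lt convex_halfspace_Im_gt)
  then have connS: "connected S" by (rule convex_connected)
  have inj: "v = w" if "v \<in> S" "exp v = z" for v
    using that Ln_exp[of v] by (auto simp: S_def w_def)
  have holoN: "(\<lambda>v. f (exp v) * exp v) holomorphic_on S"
    using holo by (intro holomorphic_intros) (simp add: S_def)
  have holoF: "F holomorphic_on S - {w}"
    unfolding F_def using inj
    by (intro holomorphic_on_divide holomorphic_on_subset[OF holoN] holomorphic_intros) auto
  have res: "residue F w = f z"
  proof -
    have "residue (\<lambda>v. (f (exp v) * exp v) / (exp v - z)) w = (f (exp w) * exp w) / exp w"
      by (rule residue_simple_pole_deriv[OF holoN _ openS connS wS])
        (use w z0 fz in \<open>auto intro!: holomorphic_intros derivative_eq_intros\<close>)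
    then show ?thesis using w z0 by (simp add: F_def)
  qed
  \<comment> \<open>If \<open>|s| \<ge> T\<close>, then \<open>exp s\<close> is at least \<open>2 |z|\<close> or at most \<open>|z| / 2\<close>.\<close>
  define T where "T = max \<bar>Re w\<bar> (max (ln (2 * cmod z)) (ln (2 / cmod z))) + 1"
  have cz: "cmod z > 0" using z0 by simp
  have F_bound: "cmod (F (Complex s y)) \<le> 2 * K * exp (- a * \<bar>s\<bar>)" if s: "T \<le> \<bar>s\<bar>" and y: "\<bar>y\<bar> \<le> \<delta>" for s y
  proof -
    let ?v = "Complex s y"
    have ev: "cmod (exp ?v) = exp s" by (simp add: norm_exp_eq_Re)
    have "cmod (exp ?v) \<le> 2 * cmod (exp ?v - z)"
    proof (cases "s \<ge> 0")
      case True
      then have "ln (2 * cmod z) \<le> s" using s by (simp add: T_def)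
      then have "2 * cmod z \<le> exp s" using cz by (metis exp_le_cancel_iff exp_ln mult_pos_pos zero_less_numeral)
      moreover have "exp s - cmod z \<le> cmod (exp ?v - z)" using norm_triangle_ineq2[of "exp ?v" z] ev by simp
      ultimately show ?thesis using ev by linarith
    next
      case False
      then have "ln (2 / cmod z) \<le> - s" using s by (simp add: T_def)
      then have "2 / cmod z \<le> exp (- s)" using cz by (metis exp_le_cancel_iff exp_ln divide_pos_pos zero_less_numeral)
      then have "2 * exp s \<le> cmod z" using cz by (simp add: exp_minus field_simps)
      moreover have "cmod z - exp s \<le> cmod (exp ?v - z)"
        using norm_triangle_ineq2[of z "exp ?v"] ev by (simp add: norm_minus_commute)
      ultimately show ?thesis using ev exp_gt_zero[of s] by linarith
    qed
    moreover have "0 < cmod (exp ?v)" by simp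
    ultimately have "cmod (exp ?v) / cmod (exp ?v - z) \<le> 2"
      by (simp add: divide_simps)
    then have "cmod (f (exp ?v)) * (cmod (exp ?v) / cmod (exp ?v - z)) \<le> K * exp (- a * \<bar>s\<bar>) * 2"
      using decay[OF y, of s] by (intro mult_mono) (auto intro: order_trans[OF norm_ge_zero])
    then show ?thesis by (simp add: F_def norm_mult norm_divide)
  qed
  have contF': "continuous_on UNIV (\<lambda>s. F (Complex s y))" if "\<bar>y\<bar> < pi" "\<bar>y\<bar> \<ge> pi / 2" for y
  proof (rule continuous_on_compose2[OF holomorphic_on_imp_continuous_on[OF holoF]])
    show "(\<lambda>s. Complex s y) ` UNIV \<subseteq> S - {w}" using that w by (auto simp: S_def)
  qed (auto simp: Complex_eq intro!: continuous_intros)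
  then have contF: "continuous_on {l..u} (\<lambda>s. F (Complex s y))" if "\<bar>y\<bar> < pi" "\<bar>y\<bar> \<ge> pi / 2" for y l u
    using that continuous_on_subset by blast
  have int: "(\<lambda>s. F (Complex s y)) integrable_on UNIV" if "y = \<delta> \<or> y = - \<delta>" for y
  proof -
    have y: "\<bar>y\<bar> = \<delta>" using that \<delta> pi_gt_zero by auto
    show ?thesis
      by (rule integrable_exp_decay[OF contF' a, of y T "2 * K"]) (use y \<delta> F_bound in auto)
  qed
  have rect: "cmod (integral {-N..N} ?D - 2 * pi * \<i> * f z)
      \<le> 8 * K * \<delta> * exp (- a * N)" if N: "T \<le> N" for N
  proof -
    let ?a1 = "Complex (- N) (- \<delta>)" and ?a2 = "Complex N (- \<delta>)"
      and ?a3 = "Complex N \<delta>" and ?a4 = "Complex (- N) \<delta>"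
    let ?B = "2 * K * exp (- a * N)"
    have N': "\<bar>Re w\<bar> < N" "0 < N" using N by (auto simp: T_def)
    have d0: "0 < \<delta>" using \<delta> pi_gt_zero by linarith
    have wb: "w \<in> box ?a1 ?a3" using N' w \<delta> by (auto simp: in_box_complex_iff)
    have cb: "cbox ?a1 ?a3 \<subseteq> S" using \<delta> by (auto simp: in_cbox_complex_iff S_def)
    have im: "path_image (rectpath ?a1 ?a3) = cbox ?a1 ?a3 - box ?a1 ?a3"
      by (rule path_image_rectpath_cbox_minus_box) (use N' d0 in auto)
    have "contour_integral (rectpath ?a1 ?a3) F =
        2 * pi * \<i> * (\<Sum>p\<in>{w}. winding_number (rectpath ?a1 ?a3) p * residue F p)"
    proof (rule Residue_theorem[OF openS connS _ holoF])
      show "path_image (rectpath ?a1 ?a3) \<subseteq> S - {w}" using im cb wb by auto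
      show "\<forall>z. z \<notin> S \<longrightarrow> winding_number (rectpath ?a1 ?a3) z = 0"
        using cb N' d0 by (auto intro!: winding_number_rectpath_outside)
    qed auto
    also have "\<dots> = 2 * pi * \<i> * f z" using winding_number_rectpath[OF wb] by (simp add: res)
    finally have total: "contour_integral (rectpath ?a1 ?a3) F = 2 * pi * \<i> * f z" .
    let ?lo = "integral {-N..N} (\<lambda>s. F (Complex s (- \<delta>)))" and ?up = "integral {-N..N} (\<lambda>s. F (Complex s \<delta>))"
    have lo: "(F has_contour_integral ?lo) (linepath ?a1 ?a2)"
      by (rule contour_integral_horizontal) (use N' \<delta> pi_gt_zero in \<open>auto intro!: contF\<close>)
    have "(F has_contour_integral ?up) (linepath ?a4 ?a3)"
      by (rule contour_integral_horizontal) (use N' \<delta> pi_gt_zero in \<open>auto intro!: contF\<close>)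
    from has_contour_integral_reverse_linepath[OF this]
    have up: "(F has_contour_integral - ?up) (linepath ?a3 ?a4)" .
    have side: "\<exists>I. (F has_contour_integral I) (linepath (Complex s y) (Complex s (- y))) \<and>
        cmod I \<le> ?B * (2 * \<delta>)" if s: "\<bar>s\<bar> = N" and y: "\<bar>y\<bar> = \<delta>" for s y
    proof -
      let ?p = "linepath (Complex s y) (Complex s (- y))"
      have seg: "\<exists>u. v = Complex s u \<and> \<bar>u\<bar> \<le> \<delta>" if "v \<in> closed_segment (Complex s y) (Complex s (- y))" for v
      proof -
        have "Re v = s \<and> \<bar>Im v\<bar> \<le> \<delta>"
          using that y by (auto simp: closed_segment_same_Re closed_segment_eq_real_ivl split: if_splits)
        then show ?thesis by (intro exI[of _ "Im v"]) (auto simp: complex_eq_iff)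
      qed
      have "continuous_on (closed_segment (Complex s y) (Complex s (- y))) F"
      proof (rule continuous_on_subset[OF holomorphic_on_imp_continuous_on[OF holoF]])
        show "closed_segment (Complex s y) (Complex s (- y)) \<subseteq> S - {w}"
          using seg N' s \<delta> by (fastforce simp: S_def)
      qed
      then have I: "(F has_contour_integral contour_integral ?p F) ?p"
        by (intro has_contour_integral_integral contour_integrable_continuous_linepath)
      have "cmod (contour_integral ?p F) \<le> ?B * cmod (Complex s (- y) - Complex s y)"
      proof (rule has_contour_integral_bound_linepath[OF I])
        show "0 \<le> ?B"
          using order_trans[OF norm_ge_zero F_bound[of s y]] s y N by simp
        show "cmod (F v) \<le> ?B"
          if "v \<in> closed_segment (Complex s y) (Complex s (- y))" for v
          using seg[OF that] F_bound[of s] s N by auto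
      qed
      moreover have "cmod (Complex s (- y) - Complex s y) = 2 * \<delta>"
      proof -
        have "cmod (Complex s (- y) - Complex s y) = \<bar>- y - y\<bar>" by (simp add: cmod_eq_Im)
        then show ?thesis using y by linarith
      qed
      ultimately have "cmod (contour_integral ?p F) \<le> ?B * (2 * \<delta>)" by simp
      with I show ?thesis by blast
    qed
    have s1: "\<bar>N\<bar> = N" "\<bar>- N\<bar> = N" "\<bar>\<delta>\<bar> = \<delta>" "\<bar>- \<delta>\<bar> = \<delta>" using N' d0 by auto
    obtain I1 where I1: "(F has_contour_integral I1) (linepath ?a2 ?a3)"
      "cmod I1 \<le> ?B * (2 * \<delta>)"
      using side[OF s1(1) s1(4), unfolded minus_minus] by (elim exE conjE) (rule that)
    obtain I2 where I2: "(F has_contour_integral I2) (linepath ?a4 ?a1)"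
      "cmod I2 \<le> ?B * (2 * \<delta>)"
      using side[OF s1(2) s1(3)] by (elim exE conjE) (rule that)
    have "(F has_contour_integral (?lo + (I1 + (- ?up + I2)))) (rectpath ?a1 ?a3)"
    proof -
      have "(F has_contour_integral (- ?up + I2)) (linepath ?a3 ?a4 +++ linepath ?a4 ?a1)"
        by (rule has_contour_integral_join[OF up I2(1)]) simp_all
      then have "(F has_contour_integral (I1 + (- ?up + I2))) (linepath ?a2 ?a3 +++ linepath ?a3 ?a4 +++ linepath ?a4 ?a1)"
        by (rule has_contour_integral_join[OF I1(1)]) simp_all
      then have "(F has_contour_integral (?lo + (I1 + (- ?up + I2))))
          (linepath ?a1 ?a2 +++ linepath ?a2 ?a3 +++ linepath ?a3 ?a4 +++ linepath ?a4 ?a1)"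
        by (rule has_contour_integral_join[OF lo]) simp_all
      then show ?thesis by (simp only: rectpath_def Let_def complex.sel)
    qed
    from contour_integral_unique[OF this] total
    have "?lo + (I1 + (- ?up + I2)) = 2 * pi * \<i> * f z" by (simp only:)
    then have "?lo - ?up - 2 * pi * \<i> * f z = ?lo - ?up - (?lo + (I1 + (- ?up + I2)))" by (simp only:)
    also have "\<dots> = - (I1 + I2)" by simp
    also have "?lo - ?up = integral {-N..N} ?D"
      by (intro integral_diff[symmetric] integrable_continuous_real contF) (use \<delta> pi_gt_zero in auto)
    finally have "integral {-N..N} ?D - 2 * pi * \<i> * f z = - (I1 + I2)" .
    then have "cmod (integral {-N..N} ?D - 2 * pi * \<i> * f z)
        \<le> cmod I1 + cmod I2"
      by (simp only: norm_minus_cancel norm_triangle_ineq)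
    also have "\<dots> \<le> ?B * (2 * \<delta>) + ?B * (2 * \<delta>)"
      by (rule add_mono[OF I1(2) I2(2)])
    also have "\<dots> = 8 * K * \<delta> * exp (- a * N)" by simp
    finally show ?thesis .
  qed
  have i: "?D integrable_on UNIV"
    by (intro integrable_diff int) auto
  have "((\<lambda>N. integral {-N..N} ?D - 2 * pi * \<i> * f z) \<longlongrightarrow> 0) at_top"
  proof (rule Lim_null_comparison)
    show "\<forall>\<^sub>F N in at_top. cmod (integral {-N..N} ?D - 2 * pi * \<i> * f z)
        \<le> 8 * K * \<delta> * exp (- a * N)"
      using rect unfolding eventually_at_top_linorder by blast
    have "((\<lambda>N. exp (- a * N)) \<longlongrightarrow> 0) at_top" using a by real_asymp
    then show "((\<lambda>N. 8 * K * \<delta> * exp (- a * N)) \<longlongrightarrow> 0) at_top"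
      by (rule tendsto_mult_right_zero)
  qed
  then have "((\<lambda>N. integral {-N..N} ?D) \<longlongrightarrow> 2 * pi * \<i> * f z) at_top"
    by (simp add: LIM_zero_iff)
  then have "integral UNIV ?D = 2 * pi * \<i> * f z"
    using tendsto_unique[OF trivial_limit_at_top_linorder integral_UNIV_limit[OF i]] by blast
  then show ?thesis using integrable_integral[OF i] by simp
qed

section \<open>The symbol of the fractional power\<close>

text \<open>
  The regularised power \<open>z\<^sup>\<alpha> (1 + z)\<^sup>-\<^sup>m\<close>.
\<close>

definition frac_symbol :: "real \<Rightarrow> nat \<Rightarrow> complex \<Rightarrow> complex" where
  "frac_symbol \<alpha> m z = z powr of_real \<alpha> / (1 + z) ^ m"

lemma one_plus_exp_nonzero: "\<bar>Im v\<bar> < pi \<Longrightarrow> 1 + exp v \<noteq> (0::complex)"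
proof
  assume v: "\<bar>Im v\<bar> < pi" and "1 + exp v = 0"
  then have e: "exp v = - 1" by (simp add: add_eq_0_iff)
  have "Ln (exp v) = v" using v by (intro Ln_exp) auto
  then have "v = Ln (- 1)" using e by simp
  then have "Im v = pi" by simp
  then show False using v by simp
qed

lemma frac_symbol_holomorphic:
  "(\<lambda>v. frac_symbol \<alpha> m (exp v)) holomorphic_on {v. \<bar>Im v\<bar> < pi}"
proof -
  have "(\<lambda>v. exp (of_real \<alpha> * v) / (1 + exp v) ^ m) holomorphic_on {v. \<bar>Im v\<bar> < pi}"
    by (intro holomorphic_intros) (use one_plus_exp_nonzero in auto)
  moreover have "exp (of_real \<alpha> * v) / (1 + exp v) ^ m = frac_symbol \<alpha> m (exp v)" if "\<bar>Im v\<bar> < pi" for v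
    using that by (simp add: frac_symbol_def powr_def abs_less_iff)
  ultimately show ?thesis by (subst holomorphic_cong[OF refl]) auto
qed

lemma norm_one_plus_exp:
  assumes "\<bar>y\<bar> \<le> \<delta>" "\<delta> < pi"
  shows "sqrt ((1 + cos \<delta>) / 2) * (1 + exp s) \<le> cmod (1 + exp (Complex s y))"
proof (rule power2_le_imp_le)
  have c: "cos \<delta> \<le> cos y"
    using cos_monotone_0_pi_le[of "\<bar>y\<bar>" \<delta>] assms by simp
  have nn: "0 \<le> 1 + cos \<delta>" using cos_ge_minus_one[of \<delta>] by linarith
  have "(cmod (1 + exp (Complex s y)))\<^sup>2 = (1 + exp s * cos y)\<^sup>2 + (exp s * sin y)\<^sup>2"
    by (simp add: cmod_power2 Re_exp Im_exp)
  also have "\<dots> = 1 + 2 * exp s * cos y + (exp s)\<^sup>2 * ((cos y)\<^sup>2 + (sin y)\<^sup>2)"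
    by (simp only: power2_eq_square algebra_simps)
  also have "\<dots> = 1 + 2 * exp s * cos y + (exp s)\<^sup>2" by simp
  finally have e: "(cmod (1 + exp (Complex s y)))\<^sup>2 = 1 + 2 * exp s * cos y + (exp s)\<^sup>2" .
  have "(1 + 2 * exp s * cos \<delta> + (exp s)\<^sup>2) - (1 + cos \<delta>) / 2 * (1 + exp s)\<^sup>2 = (1 - cos \<delta>) / 2 * (1 - exp s)\<^sup>2"
    by (simp add: power2_eq_square field_simps)
  moreover have "0 \<le> (1 - cos \<delta>) / 2 * (1 - exp s)\<^sup>2" by simp
  moreover have "2 * exp s * cos \<delta> \<le> 2 * exp s * cos y" using c by simp
  ultimately have "(1 + cos \<delta>) / 2 * (1 + exp s)\<^sup>2 \<le> (cmod (1 + exp (Complex s y)))\<^sup>2"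
    unfolding e by linarith
  then show "(sqrt ((1 + cos \<delta>) / 2) * (1 + exp s))\<^sup>2 \<le> (cmod (1 + exp (Complex s y)))\<^sup>2"
    using nn by (simp add: power_mult_distrib)
qed simp

lemma frac_symbol_decay:
  assumes "\<bar>y\<bar> \<le> \<delta>" "\<delta> < pi" "0 \<le> \<delta>"
  shows "cmod (frac_symbol \<alpha> m (exp (Complex s y)))
    \<le> 1 / sqrt ((1 + cos \<delta>) / 2) ^ m * exp (- min \<alpha> (m - \<alpha>) * \<bar>s\<bar>)"
proof -
  let ?k = "sqrt ((1 + cos \<delta>) / 2)"
  let ?d = "exp (- min \<alpha> (m - \<alpha>) * \<bar>s\<bar>)" and ?z = "exp (Complex s y)"
  have "- 1 < cos \<delta>" using cos_monotone_0_pi[of \<delta> pi] assms by simp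
  then have k: "?k > 0" by simp
  have num: "cmod (?z powr of_real \<alpha>) = exp (\<alpha> * s)"
    by (simp add: norm_powr_real_powr' exp_powr_real mult.commute)
  have e1: "exp (\<alpha> * s) \<le> ?d * (1 + exp s) ^ m"
  proof (cases "s \<ge> 0")
    case True
    have "\<alpha> * s + min \<alpha> (m - \<alpha>) * s \<le> m * s"
      using mult_right_mono[OF min.cobounded2[of \<alpha> "m - \<alpha>"] True] by (simp add: algebra_simps)
    then have "exp (\<alpha> * s) \<le> ?d * exp (m * s)"
      using True by (simp add: exp_add[symmetric])
    also have "exp (m * s) = exp s ^ m" by (rule exp_of_nat_mult)
    also have "exp s ^ m \<le> (1 + exp s) ^ m" by (intro power_mono) auto
    finally show ?thesis by simp
  next
    case False
    have "\<alpha> * s \<le> min \<alpha> (m - \<alpha>) * s"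
      using False by (intro mult_right_mono_neg) auto
    then have "exp (\<alpha> * s) \<le> ?d * 1"
      using False by simp
    also have "\<dots> \<le> ?d * (1 + exp s) ^ m"
      by (intro mult_left_mono one_le_power) auto
    finally show ?thesis .
  qed
  have "(?k * (1 + exp s)) ^ m \<le> cmod (1 + ?z) ^ m"
    using norm_one_plus_exp[OF assms(1,2), of s] k by (intro power_mono) auto
  moreover have "0 < ?k * (1 + exp s)" using k by (simp add: add_pos_pos)
  moreover from this have "0 < cmod (1 + ?z)"
    using norm_one_plus_exp[OF assms(1,2), of s] by linarith
  ultimately have "exp (\<alpha> * s) / cmod (1 + ?z) ^ m \<le> exp (\<alpha> * s) / (?k * (1 + exp s)) ^ m"
    by (intro divide_left_mono mult_pos_pos[of "_ ^ m"] zero_less_power) simp_all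
  also have "\<dots> \<le> (?d * (1 + exp s) ^ m) / (?k * (1 + exp s)) ^ m"
    using k by (intro divide_right_mono e1) (auto simp: add_nonneg_nonneg)
  also have "\<dots> = 1 / ?k ^ m * ?d"
    using k by (simp add: power_mult_distrib add_pos_pos less_imp_neq[THEN not_sym])
  finally show ?thesis
    by (simp add: frac_symbol_def norm_divide norm_power num)
qed

section \<open>Comparison with the primary functional calculus\<close>

context sectorial_resolvent
begin

lemma Phi_scale:
  assumes "admissible h" shows "\<Phi> (\<lambda>z. c * h z) x = c *\<^sub>C \<Phi> h x"
proof (rule Phi_eqI)
  have "integrand (\<lambda>z. c * h z) x = (\<lambda>t. c *\<^sub>C integrand h x t)"
    by (simp add: fun_eq_iff integrand_def scaleC_scaleC mult_ac)
  then show "(integrand (\<lambda>z. c * h z) x has_integral (- (2 * pi)) *\<^sub>R (c *\<^sub>C \<Phi> h x)) UNIV"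
    using has_integral_scaleC[OF integrand_has_integral[OF assms], of c]
    by (simp only: scaleC_scaleR)
qed

lemma Phi_bounded_linear:
  assumes "admissible g" shows "bounded_linear (\<Phi> g)"
proof -
  obtain K a where K: "a > 0" "\<And>t. cmod (g (\<gamma> t)) \<le> K * exp (- a * \<bar>t\<bar>)"
    using admissible_gamma_bound[OF assms] by metis
  show ?thesis
  proof (rule bounded_linear_intro[where K = "K * (4 * C / (a * \<kappa> * pi))"])
    show "\<Phi> g (s *\<^sub>R x) = s *\<^sub>R \<Phi> g x" for s x
      using Phi_scaleC[OF assms, of "of_real s" x] by (simp add: scaleC_of_real)
    show "norm (\<Phi> g x) \<le> norm x * (K * (4 * C / (a * \<kappa> * pi)))" for x
      using Phi_estimate[OF assms K(1), of K 0 x] K(2) by (simp add: mult_ac)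
  qed (rule Phi_add[OF assms])
qed

text \<open>
  The primary functional calculus over the boundary of the sector of half-angle \<open>\<delta>\<close>: \<open>ray y\<close> is the
  ray of argument \<open>y\<close> in logarithmic parametrisation, \<open>fc_line \<delta> f x\<close> is the integrand, and
  \<open>fc \<delta> f x\<close> is the value of \<open>f(A) x\<close>.
\<close>

definition ray :: "real \<Rightarrow> real \<Rightarrow> complex" where "ray y s = exp (Complex s y)"

definition fc_line :: "real \<Rightarrow> (complex \<Rightarrow> complex) \<Rightarrow> 'x \<Rightarrow> real \<Rightarrow> 'x" where
  "fc_line \<delta> f x s = (1 / (2 * of_real pi * \<i>)) *\<^sub>C
     ((f (ray (- \<delta>) s) * ray (- \<delta>) s) *\<^sub>C R (ray (- \<delta>) s) x - (f (ray \<delta> s) * ray \<delta> s) *\<^sub>C R (ray \<delta> s) x)"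

definition fc :: "real \<Rightarrow> (complex \<Rightarrow> complex) \<Rightarrow> 'x \<Rightarrow> 'x" where
  "fc \<delta> f x = integral UNIV (fc_line \<delta> f x)"

lemma continuous_ray: "continuous_on S (ray y)"
  unfolding ray_def Complex_eq by (intro continuous_intros)

lemma norm_ray_resolvent: "Re \<mu> \<le> 0 \<Longrightarrow> cmod \<mu> * norm (R \<mu> x) \<le> C * norm x"
proof -
  assume "Re \<mu> \<le> 0"
  from R_bound[OF Omega_left[OF this]] have "norm (R \<mu> x) \<le> C / (1 + cmod \<mu>) * norm x" .
  then have "cmod \<mu> * norm (R \<mu> x) \<le> cmod \<mu> * (C / (1 + cmod \<mu>) * norm x)"
    by (intro mult_left_mono) auto
  also have "\<dots> = (cmod \<mu> / (1 + cmod \<mu>)) * (C * norm x)" by simp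
  also have "\<dots> \<le> 1 * (C * norm x)"
    using C_nonneg by (intro mult_right_mono) (auto simp: divide_simps add_pos_nonneg)
  finally show ?thesis by simp
qed

context
  fixes \<delta> a K :: real and f :: "complex \<Rightarrow> complex"
  assumes \<delta>: "pi / 2 \<le> \<delta>" "\<delta> < pi"
    and holo: "(\<lambda>v. f (exp v)) holomorphic_on {v. \<bar>Im v\<bar> < pi}"
    and a: "a > 0" and decay: "\<And>s y. \<bar>y\<bar> \<le> \<delta> \<Longrightarrow> cmod (f (exp (Complex s y))) \<le> K * exp (- a * \<bar>s\<bar>)"
    and f_nz: "\<And>z. Re z > 0 \<Longrightarrow> f z \<noteq> 0"
begin

lemma Re_ray: "\<bar>y\<bar> = \<delta> \<Longrightarrow> Re (ray y s) \<le> 0"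
proof -
  assume y: "\<bar>y\<bar> = \<delta>"
  have "cos \<bar>y\<bar> \<le> cos (pi / 2)" using \<delta> y pi_gt_zero by (intro cos_monotone_0_pi_le) auto
  then have "cos y \<le> 0" by simp
  then show ?thesis by (simp add: ray_def Re_exp mult_nonneg_nonpos)
qed

lemma abs_delta: "\<bar>\<delta>\<bar> = \<delta>" "\<bar>- \<delta>\<bar> = \<delta>" using \<delta> pi_gt_zero by linarith+

lemma ray_decay: "\<bar>y\<bar> = \<delta> \<Longrightarrow> cmod (f (ray y s)) \<le> K * exp (- a * \<bar>s\<bar>)"
  unfolding ray_def by (rule decay) simp

lemma K_nonneg: "0 \<le> K"
  using order_trans[OF norm_ge_zero decay[of 0 0]] \<delta> pi_gt_zero by auto

lemma continuous_f_ray: "\<bar>y\<bar> = \<delta> \<Longrightarrow> continuous_on S (\<lambda>s. f (ray y s))"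
  unfolding ray_def
  by (rule continuous_on_compose2[OF holomorphic_on_imp_continuous_on[OF holo]])
    (use \<delta> in \<open>auto simp: Complex_eq intro!: continuous_intros\<close>)

lemma continuous_R_ray: "\<bar>y\<bar> = \<delta> \<Longrightarrow> continuous_on S (\<lambda>s. R (ray y s) x)"
  by (rule continuous_on_compose2[OF R_continuous continuous_ray])
    (auto intro!: Omega_left Re_ray)

lemma fc_line_integrable: "fc_line \<delta> f x integrable_on UNIV"
proof (rule integrable_exp_decay[OF _ a])
  show "continuous_on UNIV (fc_line \<delta> f x)"
    unfolding fc_line_def
    by (intro continuous_intros continuous_f_ray continuous_R_ray continuous_ray abs_delta)
  fix s
  have *: "norm ((f (ray y s) * ray y s) *\<^sub>C R (ray y s) x) \<le> K * exp (- a * \<bar>s\<bar>) * (C * norm x)"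
    if "\<bar>y\<bar> = \<delta>" for y
  proof -
    have "norm ((f (ray y s) * ray y s) *\<^sub>C R (ray y s) x) =
        cmod (f (ray y s)) * (cmod (ray y s) * norm (R (ray y s) x))"
      by (simp add: norm_scaleC norm_mult)
    also have "\<dots> \<le> K * exp (- a * \<bar>s\<bar>) * (C * norm x)"
      using K_nonneg by (intro mult_mono ray_decay norm_ray_resolvent Re_ray that) auto
    finally show ?thesis .
  qed
  have "norm (fc_line \<delta> f x s) \<le> 1 / (2 * pi) *
      (K * exp (- a * \<bar>s\<bar>) * (C * norm x) + K * exp (- a * \<bar>s\<bar>) * (C * norm x))"
    unfolding fc_line_def norm_scaleC
    by (intro mult_mono order_trans[OF norm_triangle_ineq4 add_mono] * abs_delta)
      (auto simp: norm_divide norm_mult)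
  then show "norm (fc_line \<delta> f x s) \<le> (K * C * norm x / pi) * exp (- a * \<bar>s\<bar>)"
    by (simp add: field_simps)
qed

lemma fc_has_integral: "(fc_line \<delta> f x has_integral fc \<delta> f x) UNIV"
  unfolding fc_def by (rule integrable_integral[OF fc_line_integrable])

lemma f_bound: 
  assumes "Re z > 0" shows "cmod (f z) \<le> K"
proof -
  have z0: "z \<noteq> 0" using assms by auto
  have "\<bar>Im (Ln z)\<bar> \<le> \<delta>" using Re_Ln_pos_lt[OF z0] assms \<delta> by auto
  then have "cmod (f (exp (Ln z))) \<le> K * exp (- a * \<bar>Re (Ln z)\<bar>)"
    using decay[of "Im (Ln z)" "Re (Ln z)"] by simp
  also have "\<dots> \<le> K * 1"
    using a K_nonneg by (intro mult_left_mono) auto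
  finally show ?thesis using z0 by simp
qed

lemma f_holo: "f holomorphic_on {z. Re z > 0}"
proof -
  have "((\<lambda>v. f (exp v)) \<circ> Ln) holomorphic_on {z. Re z > 0}"
  proof (rule holomorphic_on_compose_gen[OF _ holo])
    show "Ln holomorphic_on {z. Re z > 0}"
      by (intro holomorphic_on_Ln) (auto simp: complex_nonpos_Reals_iff)
    show "Ln ` {z. Re z > 0} \<subseteq> {v. \<bar>Im v\<bar> < pi}"
    proof clarify
      fix z :: complex assume "Re z > 0"
      then show "\<bar>Im (Ln z)\<bar> < pi" using Re_Ln_pos_lt[of z] pi_gt_zero by force
    qed
  qed
  moreover have "((\<lambda>v. f (exp v)) \<circ> Ln) z = f z" if "Re z > 0" for z
  proof -
    have "z \<noteq> 0" using that by auto
    then show ?thesis by simp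
  qed
  ultimately show ?thesis
    by (rule holomorphic_transform) auto
qed

lemma admissible_f_mult: "admissible g \<Longrightarrow> admissible (\<lambda>z. g z * f z)"
  by (rule admissible_mult[OF _ f_holo]) (use p_pos in \<open>auto intro!: f_bound\<close>)

lemma ray_gamma_ratio:
  assumes "Re \<mu> \<le> 0" shows "cmod (\<mu> / (\<mu> - \<gamma> t)) \<le> 1 + 2 / \<kappa>"
proof -
  have "Re (\<gamma> t) \<le> Re (\<gamma> t - \<mu>)" using assms by simp
  also have "\<dots> \<le> cmod (\<mu> - \<gamma> t)" using complex_Re_le_cmod[of "\<gamma> t - \<mu>"] by (simp add: norm_minus_commute)
  finally have d: "p * cosh t \<le> cmod (\<mu> - \<gamma> t)" by (simp add: Re_gamma)
  have pc: "0 < p * cosh t" using p_pos by simp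
  have "cmod (\<gamma> t) \<le> 2 / \<kappa> * (p * cosh t)"
    using norm_gamma_le[of t] kappa_pos by (simp add: p_def)
  also have "\<dots> \<le> 2 / \<kappa> * cmod (\<mu> - \<gamma> t)" using d kappa_pos by (intro mult_left_mono) auto
  finally have "cmod \<mu> \<le> cmod (\<mu> - \<gamma> t) + 2 / \<kappa> * cmod (\<mu> - \<gamma> t)"
    using norm_triangle_ineq[of "\<mu> - \<gamma> t" "\<gamma> t"] by simp
  then have "cmod \<mu> \<le> (1 + 2 / \<kappa>) * cmod (\<mu> - \<gamma> t)" by (simp add: algebra_simps)
  moreover have "0 < cmod (\<mu> - \<gamma> t)" using d pc by linarith
  ultimately show ?thesis by (simp add: norm_divide pos_divide_le_eq)
qed

text \<open>
  Multiplicativity, \<open>f(A) (\<Phi> g) = \<Phi> (f g)\<close>. Since \<open>\<delta> \<ge> \<pi>/2\<close>, the rays lie to the left of the contour, so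
  \<open>R_Phi\<close> applies under the outer integral. After an exchange of the integrals, Cauchy's formula
  evaluates the inner one.
\<close>

lemma fc_Phi:
  assumes g: "admissible g" shows "fc \<delta> f (\<Phi> g x) = \<Phi> (\<lambda>z. g z * f z) x"
proof -
  let ?c = "1 / (2 * of_real pi * \<i>) :: complex"
  define k where "k = (\<lambda>y s t. f (ray y s) * ray y s / (ray y s - \<gamma> t))"
  define H where "H = (\<lambda>s t. (?c * (k (- \<delta>) s t - k \<delta> s t)) *\<^sub>C integrand g x t)"
  define P where "P = (\<lambda>s. (- (2 * pi)) *\<^sub>R fc_line \<delta> f (\<Phi> g x) s)"
  define Q where "Q = integrand (\<lambda>z. g z * f z) x"
  obtain L e where L: "L \<ge> 0" "e > 0" "\<And>t. cmod (g (\<gamma> t)) \<le> L * exp (- e * \<bar>t\<bar>)"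
    using admissible_gamma_bound[OF g] by auto
  have ne: "ray y s \<noteq> \<gamma> t" if "\<bar>y\<bar> = \<delta>" for y s t
    using Re_ray[OF that, of s] Re_gamma_pos[of t] by auto
  have contk: "continuous_on UNIV (\<lambda>(s, t). k y s t)" if "\<bar>y\<bar> = \<delta>" for y
    unfolding k_def case_prod_unfold
    using ne[OF that]
    by (intro continuous_intros continuous_on_compose2[OF continuous_f_ray[OF that, of UNIV]]
      continuous_on_compose2[OF continuous_ray[of UNIV]] continuous_on_compose2[OF continuous_gamma[of UNIV]]) auto
  have "integral UNIV P = integral UNIV Q"
  proof (rule integral_swap_exp_decay[where H = H, OF _ _ a L(2)])
    show "continuous_on UNIV (\<lambda>(s, t). H s t)"
      unfolding H_def case_prod_unfold
      by (intro continuous_intros continuous_on_compose2[OF integrand_continuous[OF g, of UNIV]]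
        contk[unfolded case_prod_unfold] abs_delta) auto
    show "norm (H s t) \<le> (1 / pi * K * (1 + 2 / \<kappa>) * L * (2 * C / \<kappa> * norm x)) * exp (- a * \<bar>s\<bar>) * exp (- e * \<bar>t\<bar>)" for s t
    proof -
      have kb: "cmod (k y s t) \<le> K * exp (- a * \<bar>s\<bar>) * (1 + 2 / \<kappa>)" if "\<bar>y\<bar> = \<delta>" for y
      proof -
        have "cmod (k y s t) = cmod (f (ray y s)) * cmod (ray y s / (ray y s - \<gamma> t))"
          by (simp add: k_def norm_mult norm_divide)
        also have "\<dots> \<le> K * exp (- a * \<bar>s\<bar>) * (1 + 2 / \<kappa>)"
          by (intro mult_mono ray_decay ray_gamma_ratio Re_ray that)
            (use K_nonneg in auto)
        finally show ?thesis .
      qed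
      let ?B = "K * exp (- a * \<bar>s\<bar>) * (1 + 2 / \<kappa>)"
      have "cmod (?c * (k (- \<delta>) s t - k \<delta> s t)) \<le> 1 / (2 * pi) * (?B + ?B)"
        unfolding norm_mult[of ?c]
        by (intro mult_mono order_trans[OF norm_triangle_ineq4 add_mono] kb abs_delta) (auto simp: norm_divide norm_mult)
      then have 1: "cmod (?c * (k (- \<delta>) s t - k \<delta> s t)) \<le> 1 / pi * ?B" by simp
      have "norm (integrand g x t) \<le> cmod (g (\<gamma> t)) * (2 * C / \<kappa> * norm x)" by (rule integrand_bound)
      also have "\<dots> \<le> L * exp (- e * \<bar>t\<bar>) * (2 * C / \<kappa> * norm x)"
        using C_nonneg kappa_pos by (intro mult_right_mono L(3)) auto
      finally have 2: "norm (integrand g x t) \<le> L * exp (- e * \<bar>t\<bar>) * (2 * C / \<kappa> * norm x)" .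
      have "norm (H s t) \<le> (1 / pi * ?B) * (L * exp (- e * \<bar>t\<bar>) * (2 * C / \<kappa> * norm x))"
        unfolding H_def norm_scaleC
        by (intro mult_mono 1 2) (use K_nonneg kappa_pos in auto)
      then show ?thesis by (simp only: mult_ac)
    qed
    show "(H s has_integral P s) UNIV" for s
    proof -
      have "((\<lambda>t. (f (ray y s) * ray y s) *\<^sub>C integrand (\<lambda>z. g z / (ray y s - z)) x t) has_integral
          (f (ray y s) * ray y s) *\<^sub>C ((- (2 * pi)) *\<^sub>R R (ray y s) (\<Phi> g x))) UNIV" if "\<bar>y\<bar> = \<delta>" for y
        unfolding R_Phi[OF g Re_ray[OF that]]
        by (intro has_integral_scaleC integrand_has_integral admissible_resolvent g Re_ray that)
      from has_integral_scaleC[OF has_integral_diff[OF this[OF abs_delta(2)] this[OF abs_delta(1)]], of ?c]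
      have "((\<lambda>t. ?c *\<^sub>C ((f (ray (- \<delta>) s) * ray (- \<delta>) s) *\<^sub>C integrand (\<lambda>z. g z / (ray (- \<delta>) s - z)) x t -
            (f (ray \<delta> s) * ray \<delta> s) *\<^sub>C integrand (\<lambda>z. g z / (ray \<delta> s - z)) x t)) has_integral P s) UNIV"
        by (simp only: P_def fc_line_def scaleC_scaleR scaleR_diff_right[symmetric])
      moreover have "(f (ray y s) * ray y s) *\<^sub>C integrand (\<lambda>z. g z / (ray y s - z)) x t = k y s t *\<^sub>C integrand g x t" for y t
        by (simp add: integrand_def k_def scaleC_scaleC)
      ultimately have "((\<lambda>t. ?c *\<^sub>C (k (- \<delta>) s t *\<^sub>C integrand g x t - k \<delta> s t *\<^sub>C integrand g x t)) has_integral P s) UNIV"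
        by (simp only:)
      then show ?thesis
        by (simp only: H_def scaleC.diff_left[symmetric] scaleC_scaleC)
    qed
    show "((\<lambda>s. H s t) has_integral Q t) UNIV" for t
    proof -
      have "((\<lambda>s. k (- \<delta>) s t - k \<delta> s t) has_integral (2 * pi * \<i> * f (\<gamma> t))) UNIV"
        unfolding k_def ray_def
        by (rule Cauchy_formula_rays[OF \<delta> Re_gamma_pos holo a decay f_nz[OF Re_gamma_pos]])
      from has_integral_mult_right[OF this, of ?c]
      have "((\<lambda>s. ?c * (k (- \<delta>) s t - k \<delta> s t)) has_integral f (\<gamma> t)) UNIV" by simp
      from has_integral_linear[OF this scaleC.bounded_linear_left[of "integrand g x t"], unfolded o_def]
      show ?thesis by (simp add: H_def Q_def integrand_def scaleC_scaleC mult_ac)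
    qed
    show "P integrable_on UNIV" unfolding P_def by (intro integrable_cmul fc_line_integrable)
    show "Q integrable_on UNIV" unfolding Q_def by (intro integrand_integrable admissible_f_mult g)
  qed
  then have "(- (2 * pi)) *\<^sub>R fc \<delta> f (\<Phi> g x) = integral UNIV Q"
    unfolding P_def fc_def using fc_line_integrable by simp
  then have "(- 1 / (2 * pi)) *\<^sub>R ((- (2 * pi)) *\<^sub>R fc \<delta> f (\<Phi> g x)) = \<Phi> (\<lambda>z. g z * f z) x"
    by (simp only: \<Phi>_def Q_def)
  then show ?thesis by simp
qed

lemma Phi_fc:
  assumes g: "admissible g" shows "\<Phi> g (fc \<delta> f x) = fc \<delta> f (\<Phi> g x)"
proof -
  interpret bounded_linear "\<Phi> g" by (rule Phi_bounded_linear[OF g])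
  have "((\<lambda>s. \<Phi> g (fc_line \<delta> f x s)) has_integral \<Phi> g (fc \<delta> f x)) UNIV"
    by (rule has_integral_linear[OF fc_has_integral Phi_bounded_linear[OF g], unfolded o_def])
  moreover have "\<Phi> g (fc_line \<delta> f x s) = fc_line \<delta> f (\<Phi> g x) s" for s
    by (simp add: fc_line_def Phi_scaleC[OF g] diff R_Phi_commute[OF g] Omega_left Re_ray abs_delta)
  ultimately show ?thesis by (simp add: fc_def integral_unique)
qed

end

subsection \<open>Rational symbols and the fractional power\<close>

text \<open>
  The operator \<open>(1 + A)\<inverse>\<close>.
\<close>

definition E :: "'x \<Rightarrow> 'x" where "E x = - R (- 1) x"

lemma E_inj: "E x = 0 \<Longrightarrow> x = 0"
proof -
  assume "E x = 0"
  then have "R (- 1) x = 0" by (simp add: E_def)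
  moreover have o: "- 1 \<in> \<Omega>" by (rule Omega_left) simp
  ultimately have "R 0 x = 0"
    using R_identity[OF o zero_in_Omega, of x] R_bounded_linear[OF zero_in_Omega]
    by (simp add: linear_0 bounded_linear.linear scaleC.zero_right)
  then show ?thesis by (rule R0_inj)
qed

lemma E_bounded_linear: "bounded_linear E"
  unfolding E_def by (intro bounded_linear_minus R_bounded_linear Omega_left) simp

lemma E_pow_linear: "linear (E ^^ n)"
proof (induction n)
  case (Suc n)
  then show ?case
    unfolding funpow.simps by (intro linear_compose bounded_linear.linear[OF E_bounded_linear])
qed (simp add: linear_id[unfolded id_def] id_def)

lemma E_pow_inj: "(E ^^ n) x = (E ^^ n) y \<Longrightarrow> x = y"
proof (induction n)
  case (Suc n)
  have "E ((E ^^ n) x - (E ^^ n) y) = 0"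
    using Suc.prems by (simp add: linear_diff[OF bounded_linear.linear[OF E_bounded_linear]])
  from E_inj[OF this] show ?case by (intro Suc.IH) simp
qed simp

lemma minus_one_symbol: "(- 1) * (u / (- 1 - z)) = u / (1 + z)" for u z :: complex
proof -
  have "- 1 - z = - (1 + z)" by simp
  then show ?thesis by (simp only: divide_minus_right) simp
qed

lemma E_Phi: 
  assumes "admissible g" shows "E (\<Phi> g x) = \<Phi> (\<lambda>z. g z / (1 + z)) x"
proof -
  have "E (\<Phi> g x) = (- 1) *\<^sub>C \<Phi> (\<lambda>z. g z / (- 1 - z)) x"
    using R_Phi[OF assms, of "- 1" x] by (simp add: E_def)
  also have "\<dots> = \<Phi> (\<lambda>z. (- 1) * (g z / (- 1 - z))) x"
    by (rule Phi_scale[symmetric]) (rule admissible_resolvent[OF assms], simp)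
  also have "(\<lambda>z. (- 1) * (g z / (- 1 - z))) = (\<lambda>z. g z / (1 + z))"
    by (simp only: minus_one_symbol)
  finally show ?thesis .
qed

lemma E_Phi_commute: "admissible g \<Longrightarrow> E (\<Phi> g x) = \<Phi> g (E x)"
  using R_Phi_commute[of g "- 1" x] linear_neg[OF bounded_linear.linear[OF Phi_bounded_linear[of g]]]
  by (simp add: E_def Omega_left)

lemma E_pow_Phi_commute: "admissible g \<Longrightarrow> (E ^^ n) (\<Phi> g x) = \<Phi> g ((E ^^ n) x)"
  by (induction n) (simp_all add: E_Phi_commute)

lemma E_R0_commute: "(E ^^ n) (R 0 x) = R 0 ((E ^^ n) x)"
proof (induction n)
  case (Suc n)
  have o: "- 1 \<in> \<Omega>" by (rule Omega_left) simp
  have "E (R 0 y) = R 0 (E y)" for y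
    using R_commute[OF zero_in_Omega o, of y] linear_neg[OF R_linear[OF zero_in_Omega]]
    by (simp add: E_def)
  then show ?case using Suc by simp
qed simp

lemma admissible_over_one_plus: "admissible g \<Longrightarrow> admissible (\<lambda>z. g z / (1 + z))"
  using admissible_scale[OF admissible_resolvent[of g "- 1"], of "- 1"]
  by (simp only: minus_one_symbol mult.commute[of _ "- 1"]) simp

lemma admissible_over_one_plus_pow: "admissible g \<Longrightarrow> admissible (\<lambda>z. g z / (1 + z) ^ n)"
proof (induction n)
  case (Suc n)
  from admissible_over_one_plus[OF Suc.IH[OF Suc.prems]] show ?case by (simp add: field_simps)
qed simp

lemma E_pow_Phi:
  assumes "admissible g" shows "(E ^^ n) (\<Phi> g x) = \<Phi> (\<lambda>z. g z / (1 + z) ^ n) x"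
proof (induction n)
  case (Suc n)
  have "(E ^^ Suc n) (\<Phi> g x) = \<Phi> (\<lambda>z. g z / (1 + z) ^ n / (1 + z)) x"
    using Suc E_Phi[OF admissible_over_one_plus_pow[OF assms]] by simp
  then show ?case by (simp add: field_simps)
qed simp

lemma Phi_of_division_by_z:
  assumes "admissible h" shows "\<Phi> (\<lambda>z. h z / z) x = - R 0 (\<Phi> h x)"
proof -
  have a: "admissible (\<lambda>z. h z / (0 - z))" by (rule admissible_resolvent[OF assms]) simp
  have "(- 1) *\<^sub>C R 0 (\<Phi> h x) = \<Phi> (\<lambda>z. (- 1) * (h z / (0 - z))) x"
    using R_Phi[OF assms, of 0 x] Phi_scale[OF a, of "- 1" x] by simp
  then show ?thesis by simp
qed

text \<open>
  For \<open>m = 1\<close> the symbol is not of the form \<open>g / (1 + z)\<close> with \<open>g\<close> admissible, so \<open>E_pow_Phi\<close> does not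
  apply directly. It does after a division by \<open>z\<close>, which amounts to applying the injective operator
  \<open>-R 0\<close>.
\<close>

lemma Phi_one_plus_pow:
  assumes "m \<ge> 1" shows "\<Phi> (\<lambda>z. 1 / (1 + z) ^ m) x = (E ^^ m) x"
    and "admissible (\<lambda>z. 1 / (1 + z) ^ m)"
proof -
  show ad: "admissible (\<lambda>z. 1 / (1 + z) ^ m)"
  proof (rule admissibleI[of _ 1 1])
    show "(\<lambda>z. 1 / (1 + z) ^ m) holomorphic_on {z. Re z > 0}"
    proof (intro holomorphic_intros)
      fix z :: complex assume "z \<in> {z. Re z > 0}"
      then have "1 + z \<noteq> 0" by (auto simp: complex_eq_iff)
      then show "(1 + z) ^ m \<noteq> 0" by simp
    qed
    fix z :: complex assume z: "p \<le> Re z"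
    then have z0: "0 < Re z" using p_pos by linarith
    have "(Re z)\<^sup>2 \<le> (Re (1 + z))\<^sup>2" using z0 by (intro power_mono) auto
    then have "cmod z \<le> cmod (1 + z)" by (simp add: cmod_def)
    moreover have "1 \<le> cmod (1 + z)" using complex_Re_le_cmod[of "1 + z"] z0 by simp
    then have "cmod (1 + z) ^ 1 \<le> cmod (1 + z) ^ m" using assms by (intro power_increasing)
    ultimately have "cmod z \<le> cmod (1 + z) ^ m" by simp
    moreover have "0 < cmod z" using z0 by auto
    ultimately show "cmod (1 / (1 + z) ^ m) \<le> 1 * cmod z powr - 1"
      by (simp add: norm_divide norm_power powr_minus divide_simps)
  qed simp
  have "- R 0 (\<Phi> (\<lambda>z. 1 / (1 + z) ^ m) x) = \<Phi> (\<lambda>z. 1 / (1 + z) ^ m / z) x"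
    by (rule Phi_of_division_by_z[OF ad, symmetric])
  also have "\<dots> = (E ^^ m) (\<Phi> (\<lambda>z. 1 / z) x)"
    unfolding E_pow_Phi[OF admissible_inverse] by (simp add: mult.commute)
  also have "\<dots> = - R 0 ((E ^^ m) x)"
    by (simp add: Phi_inverse linear_neg[OF E_pow_linear] E_R0_commute)
  finally have "R 0 (\<Phi> (\<lambda>z. 1 / (1 + z) ^ m) x - (E ^^ m) x) = 0"
    by (simp add: linear_diff[OF R_linear[OF zero_in_Omega]])
  from R0_inj[OF this] show "\<Phi> (\<lambda>z. 1 / (1 + z) ^ m) x = (E ^^ m) x" by simp
qed

lemma admissible_powr: 
  assumes "\<alpha> > 0" shows "admissible (\<lambda>z. z powr - of_real \<alpha>)"
proof (rule admissibleI[of _ \<alpha> 1])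
  show "(\<lambda>z. z powr - of_real \<alpha>) holomorphic_on {z. Re z > 0}"
    by (intro holomorphic_intros) (auto simp: complex_nonpos_Reals_iff)
  show "cmod (z powr - of_real \<alpha>) \<le> 1 * cmod z powr - \<alpha>" for z
    by (simp add: norm_powr_real_powr' flip: of_real_minus)
qed (rule assms)

text \<open>
  With \<open>f(z) = z\<^sup>\<alpha> (1 + z)\<^sup>-\<^sup>m\<close>, the relation \<open>f(A) x = (1 + A)\<^sup>-\<^sup>m y\<close>, which says that \<open>y\<close> is the value of
  the fractional power at \<open>x\<close>, is equivalent to \<open>x = \<Phi> (z\<^sup>-\<^sup>\<alpha>) y\<close>: the operators \<open>f(A)\<close> and
  \<open>\<Phi> (z\<^sup>-\<^sup>\<alpha>)\<close> commute, and their product is the injective operator \<open>(1 + A)\<^sup>-\<^sup>m\<close>.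
\<close>

lemma frac_power_char:
  assumes \<delta>: "pi / 2 \<le> \<delta>" "\<delta> < pi" and \<alpha>: "0 < \<alpha>" "\<alpha> < real m"
  shows "(fc_line \<delta> (frac_symbol \<alpha> m) x has_integral (E ^^ m) y) UNIV \<longleftrightarrow>
    x = \<Phi> (\<lambda>z. z powr - of_real \<alpha>) y"
proof -
  let ?f = "frac_symbol \<alpha> m" and ?g = "\<lambda>z. z powr - complex_of_real \<alpha>"
  let ?a = "min \<alpha> (m - \<alpha>)"
  have a: "?a > 0" using \<alpha> by simp
  have d0: "0 \<le> \<delta>" using \<delta> pi_gt_zero by linarith
  have nz: "?f z \<noteq> 0" if "Re z > 0" for z
  proof -
    have "z \<noteq> 0" "1 + z \<noteq> 0" using that by (auto simp: complex_eq_iff)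
    then show ?thesis by (simp add: frac_symbol_def)
  qed
  note hyps = \<delta> frac_symbol_holomorphic a frac_symbol_decay[OF _ \<delta>(2) d0] nz
  have m: "m \<ge> 1" using \<alpha> by (cases m) auto
  have fg: "\<Phi> (\<lambda>z. ?g z * ?f z) x = (E ^^ m) x" for x
  proof -
    have "\<Phi> (\<lambda>z. ?g z * ?f z) x = \<Phi> (\<lambda>z. 1 / (1 + z) ^ m) x"
    proof (rule Phi_cong)
      fix z :: complex assume "Re z > 0"
      then have "z \<noteq> 0" by auto
      then have "?g z * z powr of_real \<alpha> = 1" by (simp add: powr_minus)
      then show "?g z * ?f z = 1 / (1 + z) ^ m" by (simp add: frac_symbol_def)
    qed
    then show ?thesis using Phi_one_plus_pow[OF m] by simp
  qed
  have fcg: "fc \<delta> ?f (\<Phi> ?g x) = (E ^^ m) x" for x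
    using fc_Phi[OF hyps admissible_powr[OF \<alpha>(1)]] fg by simp
  have gfc: "\<Phi> ?g (fc \<delta> ?f x) = (E ^^ m) x" for x
    using Phi_fc[OF hyps admissible_powr[OF \<alpha>(1)]] fcg by simp
  have "(fc_line \<delta> ?f x has_integral (E ^^ m) y) UNIV \<longleftrightarrow> fc \<delta> ?f x = (E ^^ m) y"
  proof
    assume "(fc_line \<delta> ?f x has_integral (E ^^ m) y) UNIV"
    moreover have "(fc_line \<delta> ?f x has_integral fc \<delta> ?f x) UNIV"
      using fc_has_integral[OF hyps, of x] by simp
    ultimately show "fc \<delta> ?f x = (E ^^ m) y" by (rule has_integral_unique[rotated])
  next
    assume "fc \<delta> ?f x = (E ^^ m) y"
    then show "(fc_line \<delta> ?f x has_integral (E ^^ m) y) UNIV"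
      using fc_has_integral[OF hyps, of x] by simp
  qed
  also have "\<dots> \<longleftrightarrow> x = \<Phi> ?g y"
  proof
    assume "fc \<delta> ?f x = (E ^^ m) y"
    then have "(E ^^ m) x = (E ^^ m) (\<Phi> ?g y)"
      using gfc[of x] E_pow_Phi_commute[OF admissible_powr[OF \<alpha>(1)], of m y] by simp
    then show "x = \<Phi> ?g y" by (rule E_pow_inj)
  qed (simp add: fcg)
  finally show ?thesis .
qed

end

section \<open>Products of Cayley transforms\<close>

text \<open>
  The symbol of the product of the Cayley transforms with shifts \<open>w 1, ..., w n\<close>.
\<close>

definition cayley_prod :: "(nat \<Rightarrow> real) \<Rightarrow> nat \<Rightarrow> complex \<Rightarrow> complex" where
  "cayley_prod w n z = (\<Prod>k\<in>{1..n}. (z - of_real (w k)) / (z + of_real (w k)))"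

lemma Re_pos_shift_nonzero: "Re z > 0 \<Longrightarrow> \<nu> > 0 \<Longrightarrow> z + of_real \<nu> \<noteq> 0"
  by (auto simp: complex_eq_iff)

lemma Re_pos_shift_norm:
  assumes "Re z > 0" "\<nu> > 0"
  shows "cmod z \<le> cmod (z + of_real \<nu>)" "\<nu> \<le> cmod (z + of_real \<nu>)"
proof -
  have "(Re z)\<^sup>2 \<le> (Re (z + of_real \<nu>))\<^sup>2" using assms by (intro power_mono) auto
  then show "cmod z \<le> cmod (z + of_real \<nu>)" by (simp add: cmod_def)
  have "\<nu> \<le> Re (z + of_real \<nu>)" using assms by simp
  then show "\<nu> \<le> cmod (z + of_real \<nu>)" using complex_Re_le_cmod[of "z + of_real \<nu>"] by linarith
qed

lemma cayley_factor_bound: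
  assumes "Re z > 0" "\<nu> > 0"
  shows "cmod ((z - of_real \<nu>) / (z + of_real \<nu>)) \<le> exp (- (2 * \<nu> * Re z / (cmod (z + of_real \<nu>))\<^sup>2))"
proof (rule power2_le_imp_le)
  let ?D = "(cmod (z + of_real \<nu>))\<^sup>2"
  have D: "?D > 0" using Re_pos_shift_nonzero[OF assms] by simp
  have "(cmod (z - of_real \<nu>))\<^sup>2 = ?D - 4 * \<nu> * Re z"
    by (simp add: cmod_power2) (simp add: power2_eq_square algebra_simps)
  then have "(cmod ((z - of_real \<nu>) / (z + of_real \<nu>)))\<^sup>2 = (?D - 4 * \<nu> * Re z) / ?D"
    by (simp only: norm_divide power_divide)
  also have "\<dots> = 1 - 4 * \<nu> * Re z / ?D" using D by (simp only: diff_divide_distrib) simp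
  also have "\<dots> \<le> exp (- (4 * \<nu> * Re z / ?D))"
    using exp_ge_add_one_self[of "- (4 * \<nu> * Re z / ?D)"] by simp
  also have "\<dots> = (exp (- (2 * \<nu> * Re z / ?D)))\<^sup>2"
    by (simp add: power2_eq_square exp_add[symmetric])
  finally show "(cmod ((z - of_real \<nu>) / (z + of_real \<nu>)))\<^sup>2 \<le> (exp (- (2 * \<nu> * Re z / ?D)))\<^sup>2" .
qed simp

lemma cayley_factor_le_1: "Re z > 0 \<Longrightarrow> \<nu> > 0 \<Longrightarrow> cmod ((z - of_real \<nu>) / (z + of_real \<nu>)) \<le> 1"
  by (rule order_trans[OF cayley_factor_bound]) auto

lemma cayley_prod_le_1:
  assumes "Re z > 0" "\<And>k. k \<ge> 1 \<Longrightarrow> w k > 0"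
  shows "cmod (cayley_prod w n z) \<le> 1"
  unfolding cayley_prod_def prod_norm[symmetric]
  by (intro prod_le_1) (use assms in \<open>auto intro!: cayley_factor_le_1\<close>)

lemma cayley_prod_holomorphic:
  assumes "\<And>k. k \<ge> 1 \<Longrightarrow> w k > 0"
  shows "cayley_prod w n holomorphic_on {z. Re z > 0}"
  unfolding cayley_prod_def
  by (intro holomorphic_intros) (use assms in \<open>auto simp: Re_pos_shift_nonzero\<close>)

lemma one_minus_cayley_prod:
  assumes z: "Re z > 0" and w: "\<And>k. k \<ge> 1 \<Longrightarrow> w k > 0 \<and> w k \<le> W"
  shows "cmod (cayley_prod w n z - 1) \<le> 2 * W * n / cmod z"
proof -
  have z0: "cmod z > 0" using z by auto
  have "cmod (cayley_prod w n z - (\<Prod>k\<in>{1..n}. 1)) \<le>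
      (\<Sum>k\<in>{1..n}. cmod ((z - of_real (w k)) / (z + of_real (w k)) - 1))"
    unfolding cayley_prod_def by (rule norm_prod_diff) (use w z in \<open>auto intro!: cayley_factor_le_1\<close>)
  also have "\<dots> \<le> (\<Sum>k\<in>{1..n}. 2 * W / cmod z)"
  proof (rule sum_mono)
    fix k assume "k \<in> {1..n}"
    then have k: "w k > 0" "w k \<le> W" using w by auto
    have "(z - of_real (w k)) / (z + of_real (w k)) - 1 = - of_real (2 * w k) / (z + of_real (w k))"
      using Re_pos_shift_nonzero[OF z k(1)] by (simp add: field_simps)
    then have "cmod ((z - of_real (w k)) / (z + of_real (w k)) - 1) = 2 * w k / cmod (z + of_real (w k))"
      using k by (simp add: norm_divide norm_mult)
    also have "\<dots> \<le> 2 * W / cmod z"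
      using k z0 Re_pos_shift_norm[OF z k(1)] by (intro frac_le) auto
    finally show "cmod ((z - of_real (w k)) / (z + of_real (w k)) - 1) \<le> 2 * W / cmod z" .
  qed
  also have "\<dots> = 2 * W * n / cmod z" by simp
  finally show ?thesis by simp
qed

lemma exp_minus_le_powr:
  assumes "u > 0" "c > (0::real)" shows "exp (- u) \<le> (c / u) powr c"
proof -
  have "u / c \<le> exp (u / c)" using exp_ge_add_one_self[of "u / c"] by linarith
  then have "(u / c) powr c \<le> exp (u / c) powr c" using assms by (intro powr_mono2) auto
  also have "\<dots> = exp u" using assms by (simp add: exp_powr_real)
  finally have "1 / exp u \<le> 1 / (u / c) powr c" using assms by (intro divide_left_mono) auto
  then show ?thesis using assms by (simp add: exp_minus inverse_eq_divide powr_divide)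
qed

context sectorial_resolvent
begin

text \<open>
  On the contour each factor is at most \<open>exp (-c / cosh t)\<close>, with \<open>c\<close> depending only on the bounds for
  the shifts.
\<close>

lemma cayley_prod_gamma:
  assumes w: "\<And>k. k \<ge> 1 \<Longrightarrow> wmin \<le> w k \<and> w k \<le> wmax" and "0 < wmin"
  shows "cmod (cayley_prod w n (\<gamma> t)) \<le> exp (- (2 * wmin * p / (\<rho> + wmax)\<^sup>2 * n / cosh t))"
proof -
  let ?c = "2 * wmin * p / (\<rho> + wmax)\<^sup>2"
  have "cmod (cayley_prod w n (\<gamma> t)) \<le> (\<Prod>k\<in>{1..n}. exp (- (?c / cosh t)))"
    unfolding cayley_prod_def prod_norm[symmetric]
  proof (intro prod_mono conjI)
    fix k assume "k \<in> {1..n}"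
    then have k: "wmin \<le> w k" "w k \<le> wmax" "0 < w k" using w[of k] assms(2) by auto
    have "cmod (\<gamma> t + of_real (w k)) \<le> cmod (\<gamma> t) + w k"
      using norm_triangle_ineq[of "\<gamma> t" "of_real (w k)"] k by simp
    also have "\<dots> \<le> \<rho> * cosh t + wmax * cosh t"
      using norm_gamma_le[of t] mult_mono[of "w k" wmax 1 "cosh t"] k cosh_real_ge_1[of t] by simp
    finally have "(cmod (\<gamma> t + of_real (w k)))\<^sup>2 \<le> ((\<rho> + wmax) * cosh t)\<^sup>2"
      by (intro power_mono) (auto simp: algebra_simps)
    moreover have "0 < (cmod (\<gamma> t + of_real (w k)))\<^sup>2"
      using Re_pos_shift_nonzero[OF Re_gamma_pos k(3)] by simp
    ultimately have "2 * wmin * (p * cosh t) / ((\<rho> + wmax) * cosh t)\<^sup>2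
        \<le> 2 * w k * Re (\<gamma> t) / (cmod (\<gamma> t + of_real (w k)))\<^sup>2"
      using k assms(2) p_pos by (intro frac_le mult_mono) (auto simp: Re_gamma)
    moreover have "2 * wmin * (p * cosh t) / ((\<rho> + wmax) * cosh t)\<^sup>2 = ?c / cosh t"
      by (simp add: power2_eq_square mult_ac)
    ultimately show "cmod ((\<gamma> t - of_real (w k)) / (\<gamma> t + of_real (w k))) \<le> exp (- (?c / cosh t))"
      by (intro order_trans[OF cayley_factor_bound[OF Re_gamma_pos k(3)]]) simp
  qed simp
  also have "\<dots> = exp (real n * (- (?c / cosh t)))" by (simp only: prod_constant card_atLeastAtMost exp_of_nat_mult) simp
  also have "real n * (- (?c / cosh t)) = - (?c * n / cosh t)" by simp
  finally show ?thesis .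
qed

text \<open>
  The Cayley transform \<open>(A - \<nu>) (A + \<nu>)\<inverse> = 1 - 2 \<nu> (\<nu> + A)\<inverse>\<close>, and the product of the first \<open>n\<close> of
  them, in the order in which the relational product composes them.
\<close>

definition V :: "real \<Rightarrow> 'x \<Rightarrow> 'x" where "V \<nu> x = x + of_real (2 * \<nu>) *\<^sub>C R (- of_real \<nu>) x"

primrec V_prod :: "(nat \<Rightarrow> real) \<Rightarrow> nat \<Rightarrow> 'x \<Rightarrow> 'x" where
  "V_prod w 0 x = x"
| "V_prod w (Suc n) x = V_prod w n (V (w (Suc n)) x)"

lemma neg_in_Omega: "\<nu> > 0 \<Longrightarrow> - complex_of_real \<nu> \<in> \<Omega>"
  by (rule Omega_left) simp

lemma V_scaleC: "\<nu> > 0 \<Longrightarrow> V \<nu> (c *\<^sub>C x) = c *\<^sub>C V \<nu> x"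
  by (simp add: V_def R_scaleC neg_in_Omega scaleC_add_right scaleC_scaleC mult.commute)

lemma V_R0: "\<nu> > 0 \<Longrightarrow> V \<nu> (R 0 x) = R 0 (V \<nu> x)"
  by (simp add: V_def R_add R_scaleC zero_in_Omega R_commute[OF zero_in_Omega neg_in_Omega])

lemma V_bounded_linear:
  assumes "\<nu> > 0" shows "bounded_linear (V \<nu>)"
  unfolding V_def
  by (intro bounded_linear_add bounded_linear_ident
      bounded_linear_compose[OF scaleC.bounded_linear_right R_bounded_linear] neg_in_Omega assms)

context
  fixes w :: "nat \<Rightarrow> real" assumes w_pos: "\<And>k. k \<ge> 1 \<Longrightarrow> w k > 0"
begin

lemma V_prod_scaleC: "V_prod w n (c *\<^sub>C x) = c *\<^sub>C V_prod w n x"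
  by (induction n arbitrary: x) (simp_all add: V_scaleC w_pos)

lemma V_prod_R0: "V_prod w n (R 0 x) = R 0 (V_prod w n x)"
  by (induction n arbitrary: x) (simp_all add: V_R0 w_pos)

lemma V_prod_bounded_linear: "bounded_linear (V_prod w n)"
proof (induction n)
  case (Suc n)
  have "bounded_linear (\<lambda>x. V_prod w n (V (w (Suc n)) x))"
    by (rule bounded_linear_compose[OF Suc V_bounded_linear]) (simp add: w_pos)
  then show ?case by simp
qed simp

end

lemma admissible_cayley_factor: "admissible g \<Longrightarrow> \<nu> > 0 \<Longrightarrow> admissible (\<lambda>z. g z * ((z - of_real \<nu>) / (z + of_real \<nu>)))"
  by (rule admissible_mult[where L = 1])
    (use p_pos in \<open>auto intro!: holomorphic_intros cayley_factor_le_1 simp: Re_pos_shift_nonzero\<close>)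

lemma V_Phi:
  assumes "admissible g" "\<nu> > 0"
  shows "V \<nu> (\<Phi> g x) = \<Phi> (\<lambda>z. g z * ((z - of_real \<nu>) / (z + of_real \<nu>))) x"
proof -
  have re: "Re (- complex_of_real \<nu>) \<le> 0" using assms(2) by simp
  have "V \<nu> (\<Phi> g x) = \<Phi> (\<lambda>z. g z + of_real (2 * \<nu>) * (g z / (- of_real \<nu> - z))) x"
    unfolding V_def R_Phi[OF assms(1) re]
    by (rule Phi_symbol_lincomb[symmetric, OF assms(1) admissible_resolvent[OF assms(1) re]])
  also have "\<dots> = \<Phi> (\<lambda>z. g z * ((z - of_real \<nu>) / (z + of_real \<nu>))) x"
  proof (rule Phi_cong)
    fix z :: complex assume "Re z > 0"
    then have n: "z + of_real \<nu> \<noteq> 0" using assms(2) by (rule Re_pos_shift_nonzero)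
    have "- of_real \<nu> - z = - (z + of_real \<nu>)" by simp
    then have "g z + of_real (2 * \<nu>) * (g z / (- of_real \<nu> - z)) = g z - of_real (2 * \<nu>) * g z / (z + of_real \<nu>)"
      by (simp only: minus_divide_right[symmetric]) simp
    also have "\<dots> = g z * ((z - of_real \<nu>) / (z + of_real \<nu>))"
      using n by (simp add: field_simps)
    finally show "g z + of_real (2 * \<nu>) * (g z / (- of_real \<nu> - z)) = g z * ((z - of_real \<nu>) / (z + of_real \<nu>))" .
  qed
  finally show ?thesis .
qed

lemma V_prod_Phi:
  assumes "admissible g" "\<And>k. k \<ge> 1 \<Longrightarrow> w k > 0"
  shows "V_prod w n (\<Phi> g x) = \<Phi> (\<lambda>z. g z * cayley_prod w n z) x"
  using assms(1)
proof (induction n arbitrary: g)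
  case 0
  then show ?case by (simp add: cayley_prod_def)
next
  case (Suc n)
  have pos: "w (Suc n) > 0" by (simp add: assms(2))
  have "V_prod w (Suc n) (\<Phi> g x) =
      \<Phi> (\<lambda>z. g z * ((z - of_real (w (Suc n))) / (z + of_real (w (Suc n)))) * cayley_prod w n z) x"
    using V_Phi[OF Suc.prems pos] Suc.IH[OF admissible_cayley_factor[OF Suc.prems pos]] by simp
  then show ?case by (simp add: cayley_prod_def mult_ac)
qed

lemma admissible_cayley_prod:
  assumes "admissible g" "\<And>k. k \<ge> 1 \<Longrightarrow> w k > 0"
  shows "admissible (\<lambda>z. g z * cayley_prod w n z)"
  by (rule admissible_mult[OF assms(1) cayley_prod_holomorphic[OF assms(2)], where L = 1])
    (use p_pos in \<open>auto intro!: cayley_prod_le_1 assms(2)\<close>)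

section \<open>The two estimates\<close>

text \<open>
  For \<open>\<alpha> > 0\<close> the symbol on the contour is bounded by a multiple of
  \<open>exp (-c n / cosh t) (cosh t)\<^sup>-\<^sup>\<alpha>\<close>. Discarding the exponential for \<open>|t| \<ge> ln n\<close>, and replacing it by a
  multiple of \<open>(cosh t / n)\<^sup>2\<^sup>\<alpha>\<close> otherwise, gives a multiple of \<open>n\<^sup>-\<^sup>\<alpha> exp (-\<alpha> ||t| - ln n|)\<close> in both
  cases.
\<close>

lemma decay_estimate:
  assumes \<alpha>: "\<alpha> > 0" and wm: "0 < wmin" "wmin \<le> wmax"
  shows "\<exists>M\<ge>0. \<forall>n\<ge>1. \<forall>w x. (\<forall>k\<ge>1. wmin \<le> w k \<and> w k \<le> wmax) \<longrightarrow>
    norm (V_prod w n (\<Phi> (\<lambda>z. z powr - of_real \<alpha>) x)) \<le> M / real n powr \<alpha> * norm x"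
proof -
  define c where "c = 2 * wmin * p / (\<rho> + wmax)\<^sup>2"
  have c: "c > 0" using wm p_pos rho_pos by (simp add: c_def)
  let ?m = "max (2 powr \<alpha>) ((2 * \<alpha> / c) powr (2 * \<alpha>))"
  define L where "L = p powr (- \<alpha>) * ?m"
  define M where "M = L * (4 * C / (\<alpha> * \<kappa> * pi))"
  have L: "L \<ge> 0" unfolding L_def by (intro mult_nonneg_nonneg) (auto simp: le_max_iff_disj)
  have M: "M \<ge> 0" using L C_nonneg kappa_pos \<alpha> by (simp add: M_def)
  have "norm (V_prod w n (\<Phi> (\<lambda>z. z powr - of_real \<alpha>) x)) \<le> M / real n powr \<alpha> * norm x"
    if n: "n \<ge> 1" and w: "\<And>k. k \<ge> 1 \<Longrightarrow> wmin \<le> w k \<and> w k \<le> wmax" for n w x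
  proof -
    let ?g = "\<lambda>z. z powr - of_real \<alpha> * cayley_prod w n z"
    have wp: "k \<ge> 1 \<Longrightarrow> w k > 0" for k using w[of k] wm by linarith
    have n0: "real n > 0" using n by simp
    have bound: "cmod (?g (\<gamma> t)) \<le> (L * real n powr (- \<alpha>)) * exp (- \<alpha> * \<bar>\<bar>t\<bar> - ln (real n)\<bar>)" for t
    proof -
      have "cmod (\<gamma> t powr - of_real \<alpha>) = cmod (\<gamma> t) powr (- \<alpha>)"
        by (simp add: norm_powr_real_powr' flip: of_real_minus)
      also have "\<dots> \<le> (p * cosh t) powr (- \<alpha>)"
        using \<alpha> p_pos norm_gamma_ge[of t] by (intro powr_mono2') auto
      also have "\<dots> = p powr (- \<alpha>) * cosh t powr (- \<alpha>)" using p_pos by (simp add: powr_mult)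
      finally have g: "cmod (\<gamma> t powr - of_real \<alpha>) \<le> p powr (- \<alpha>) * cosh t powr (- \<alpha>)" .
      have v: "cmod (cayley_prod w n (\<gamma> t)) \<le> exp (- (c * n / cosh t))"
        unfolding c_def by (rule cayley_prod_gamma[OF w wm(1)])
      let ?e = "real n powr (- \<alpha>) * exp (- \<alpha> * \<bar>\<bar>t\<bar> - ln (real n)\<bar>)" and ?x = "exp (- (c * n / cosh t))"
        and ?k = "(2 * \<alpha> / c) powr (2 * \<alpha>)" and ?n = "real n powr (- (2 * \<alpha>))"
      have key: "cosh t powr (- \<alpha>) * ?x \<le>
          ?m * ?e"
      proof (cases "ln (real n) \<le> \<bar>t\<bar>")
        case True
        have e: "?e = exp (- \<alpha> * \<bar>t\<bar>)"
          using True n0 by (simp add: powr_def exp_add[symmetric] algebra_simps)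
        have "cosh t powr (- \<alpha>) * ?x \<le> cosh t powr (- \<alpha>) * 1"
          using c by (intro mult_left_mono) auto
        also have "\<dots> \<le> 2 powr \<alpha> * exp (- \<alpha> * \<bar>t\<bar>)"
          using cosh_powr_minus_le[of \<alpha> t] \<alpha> by simp
        also have "\<dots> \<le> ?m * exp (- \<alpha> * \<bar>t\<bar>)"
          by (intro mult_right_mono) auto
        finally show ?thesis unfolding e .
      next
        case False
        have e: "?e = ?n * exp (\<alpha> * \<bar>t\<bar>)"
          using False n0 by (simp add: powr_def exp_add[symmetric] algebra_simps)
        have "?x \<le> (2 * \<alpha> / (c * n / cosh t)) powr (2 * \<alpha>)"
          using c n0 \<alpha> by (intro exp_minus_le_powr) auto
        also have "2 * \<alpha> / (c * n / cosh t) = (2 * \<alpha> / c) * (1 / real n) * cosh t" by simp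
        also have "((2 * \<alpha> / c) * (1 / real n) * cosh t) powr (2 * \<alpha>) =
            ?k * ?n * cosh t powr (2 * \<alpha>)"
          using c \<alpha> n0 by (simp only: powr_mult powr_one_eq_one powr_minus inverse_eq_divide powr_divide)
        finally have "cosh t powr (- \<alpha>) * ?x \<le> cosh t powr (- \<alpha>) *
            (?k * ?n * cosh t powr (2 * \<alpha>))"
          by (intro mult_left_mono) auto
        also have "\<dots> = ?k * (?n * (cosh t powr (- \<alpha>) * cosh t powr (2 * \<alpha>)))"
          by (simp only: mult_ac)
        also have "cosh t powr (- \<alpha>) * cosh t powr (2 * \<alpha>) = cosh t powr \<alpha>" by (simp add: powr_add[symmetric])
        also have "?k * (?n * cosh t powr \<alpha>) \<le>
            ?m * (?n * exp (\<alpha> * \<bar>t\<bar>))"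
        proof (intro mult_mono order_refl)
          have "cosh t powr \<alpha> \<le> exp \<bar>t\<bar> powr \<alpha>"
            using cosh_le_exp_abs[of t] \<alpha> by (intro powr_mono2) auto
          then show "cosh t powr \<alpha> \<le> exp (\<alpha> * \<bar>t\<bar>)" by (simp add: exp_powr_real mult.commute)
        qed (auto simp: le_max_iff_disj)
        finally show ?thesis unfolding e .
      qed
      have "cmod (?g (\<gamma> t)) \<le> p powr (- \<alpha>) * cosh t powr (- \<alpha>) * ?x"
        unfolding norm_mult by (intro mult_mono g v) auto
      also have "\<dots> = p powr (- \<alpha>) * (cosh t powr (- \<alpha>) * ?x)" by (simp only: mult_ac)
      also have "\<dots> \<le> p powr (- \<alpha>) * (?m *
          ?e)"
        by (intro mult_left_mono key) auto
      finally show ?thesis by (simp only: L_def mult_ac)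
    qed
    have "norm (\<Phi> ?g x) \<le> (L * real n powr (- \<alpha>)) * (4 * C / (\<alpha> * \<kappa> * pi)) * norm x"
      by (rule Phi_estimate[OF admissible_cayley_prod[OF admissible_powr[OF \<alpha>] wp] \<alpha> bound])
    then show ?thesis
      using V_prod_Phi[OF admissible_powr[OF \<alpha>] wp] by (simp add: M_def powr_minus divide_inverse mult_ac)
  qed
  then show ?thesis using M by blast
qed

lemma Phi_shift_inverse:
  assumes "\<nu> > 0"
  shows "\<Phi> (\<lambda>z. 1 / z / (- of_real \<nu> - z)) x = R 0 (- R (- of_real \<nu>) x)"
proof -
  have re: "Re (- complex_of_real \<nu>) \<le> 0" using assms by simp
  have "\<Phi> (\<lambda>z. 1 / z / (- of_real \<nu> - z)) x = R (- of_real \<nu>) (- R 0 x)"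
    using R_Phi[OF admissible_inverse re, of x] by (simp add: Phi_inverse)
  also have "\<dots> = R 0 (- R (- of_real \<nu>) x)"
    using R_commute[OF zero_in_Omega neg_in_Omega[OF assms], of x]
      linear_neg[OF R_linear[OF neg_in_Omega[OF assms]]]
      linear_neg[OF R_linear[OF zero_in_Omega]] by simp
  finally show ?thesis .
qed

text \<open>
  For \<open>\<alpha> = 0\<close> the symbol of the product tends to \<open>1\<close> at infinity and is not admissible. It becomes so
  after the symbol \<open>z / (z + n)\<close> of the uniformly bounded operator \<open>A (A + n)\<inverse> = 1 + n (R (-n))\<close> has been
  subtracted. Both symbols change from about \<open>0\<close> to about \<open>1\<close> where \<open>cosh t\<close> is of order \<open>n\<close>, so the
  difference is at most a multiple of \<open>exp (-||t| - ln n|)\<close>.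
\<close>

lemma power_bound_estimate:
  assumes wm: "0 < wmin" "wmin \<le> wmax"
  shows "\<exists>M\<ge>0. \<forall>n\<ge>1. \<forall>w x. (\<forall>k\<ge>1. wmin \<le> w k \<and> w k \<le> wmax) \<longrightarrow> norm (V_prod w n x) \<le> M * norm x"
proof -
  define c where "c = 2 * wmin * p / (\<rho> + wmax)\<^sup>2"
  have c: "c > 0" using wm p_pos rho_pos by (simp add: c_def)
  define L where "L = max ((2 * wmax + 1) / p * 2) (1 / c + \<rho>)"
  define M where "M = L * (4 * C / (1 * \<kappa> * pi)) + 1 + C"
  have L: "L \<ge> 0" using c rho_pos by (simp add: L_def le_max_iff_disj)
  have M: "M \<ge> 0" using L C_nonneg kappa_pos by (simp add: M_def)
  have "norm (V_prod w n x) \<le> M * norm x"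
    if n: "n \<ge> 1" and w: "\<And>k. k \<ge> 1 \<Longrightarrow> wmin \<le> w k \<and> w k \<le> wmax" for n w x
  proof -
    have wp: "k \<ge> 1 \<Longrightarrow> w k > 0" for k using w[of k] wm by linarith
    have n0: "real n > 0" using n by simp
    let ?n = "complex_of_real (real n)"
    define h where "h = (\<lambda>z. cayley_prod w n z - z / (z + ?n))"
    have far: "cmod (h z) \<le> (2 * wmax + 1) * n / cmod z" if z: "Re z > 0" for z
    proof -
      have z0: "cmod z > 0" using z by auto
      have "1 - z / (z + ?n) = ?n / (z + ?n)"
        using Re_pos_shift_nonzero[OF z n0] by (simp add: field_simps)
      then have "cmod (1 - z / (z + ?n)) = n / cmod (z + ?n)"
        by (simp add: norm_divide)
      also have "\<dots> \<le> n / cmod z"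
        using z0 Re_pos_shift_norm(1)[OF z n0] by (intro frac_le) auto
      finally have "cmod (1 - z / (z + ?n)) \<le> n / cmod z" .
      moreover have "cmod (cayley_prod w n z - 1) \<le> 2 * wmax * n / cmod z"
        by (rule one_minus_cayley_prod[OF z]) (use w wp in auto)
      moreover have "h z = (cayley_prod w n z - 1) + (1 - z / (z + ?n))" by (simp add: h_def)
      ultimately have "cmod (h z) \<le> 2 * wmax * n / cmod z + n / cmod z"
        using norm_triangle_ineq[of "cayley_prod w n z - 1" "1 - z / (z + ?n)"] by simp
      also have "\<dots> = (2 * wmax + 1) * n / cmod z" by (simp add: add_divide_distrib[symmetric] algebra_simps)
      finally show ?thesis .
    qed
    have admissible: "admissible h"
    proof (rule admissibleI[of _ 1 "(2 * wmax + 1) * n"])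
      show "h holomorphic_on {z. Re z > 0}" unfolding h_def
      proof (intro holomorphic_intros cayley_prod_holomorphic wp)
        show "z + ?n \<noteq> 0" if "z \<in> {z. Re z > 0}" for z
          using Re_pos_shift_nonzero[of z "real n"] that n0 by blast
      qed
      fix z assume "p \<le> Re z"
      then have "Re z > 0" using p_pos by linarith
      moreover from this have "cmod z > 0" by auto
      ultimately show "cmod (h z) \<le> (2 * wmax + 1) * n * cmod z powr - 1"
        using far[of z] by (simp add: powr_minus divide_inverse)
    qed simp
    have bound: "cmod (h (\<gamma> t)) \<le> L * exp (- 1 * \<bar>\<bar>t\<bar> - ln (real n)\<bar>)" for t
    proof -
      let ?e = "exp (- 1 * \<bar>\<bar>t\<bar> - ln (real n)\<bar>)"
      show ?thesis
    proof (cases "ln (real n) \<le> \<bar>t\<bar>")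
      case True
      have "?e = exp (ln (real n)) * exp (- \<bar>t\<bar>)"
        using True by (simp add: exp_add[symmetric])
      then have e: "?e = n * exp (- \<bar>t\<bar>)" using n0 by simp
      have "cmod (h (\<gamma> t)) \<le> (2 * wmax + 1) * n / cmod (\<gamma> t)" by (rule far[OF Re_gamma_pos])
      also have "\<dots> \<le> (2 * wmax + 1) * n / (p * cosh t)"
        using wm p_pos norm_gamma_ge[of t] by (intro divide_left_mono) auto
      also have "\<dots> = (2 * wmax + 1) / p * n * (1 / cosh t)" by simp
      also have "\<dots> \<le> (2 * wmax + 1) / p * n * (2 * exp (- \<bar>t\<bar>))"
      proof (rule mult_left_mono)
        show "1 / cosh t \<le> 2 * exp (- \<bar>t\<bar>)"
          using exp_abs_le_cosh[of t] by (simp add: exp_minus field_simps)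
      qed (use wm p_pos in auto)
      also have "\<dots> = ((2 * wmax + 1) / p * 2) * (n * exp (- \<bar>t\<bar>))" by (simp only: mult_ac)
      also have "\<dots> \<le> L * (n * exp (- \<bar>t\<bar>))"
        by (intro mult_right_mono) (auto simp: L_def)
      finally show ?thesis unfolding e .
    next
      case False
      have "?e = exp \<bar>t\<bar> / exp (ln (real n))"
        using False by (simp add: exp_diff[symmetric])
      then have e: "?e = exp \<bar>t\<bar> / n" using n0 by simp
      have "cmod (cayley_prod w n (\<gamma> t)) \<le> exp (- (c * n / cosh t))"
        unfolding c_def by (rule cayley_prod_gamma[OF w wm(1)])
      also have "\<dots> \<le> (1 / (c * n / cosh t)) powr 1"
        using c n0 by (intro exp_minus_le_powr) auto
      also have "\<dots> = 1 / c * (cosh t / n)" using c n0 by simp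
      finally have 1: "cmod (cayley_prod w n (\<gamma> t)) \<le> 1 / c * (cosh t / n)" .
      have "cmod (\<gamma> t / (\<gamma> t + ?n)) \<le> (\<rho> * cosh t) / n"
        unfolding norm_divide using n0 rho_pos
        by (intro frac_le norm_gamma_le Re_pos_shift_norm(2)[OF Re_gamma_pos]) auto
      then have "cmod (h (\<gamma> t)) \<le> 1 / c * (cosh t / n) + (\<rho> * cosh t) / n"
        using 1 norm_triangle_ineq4[of "cayley_prod w n (\<gamma> t)" "\<gamma> t / (\<gamma> t + ?n)"]
        by (simp add: h_def)
      also have "\<dots> = (1 / c + \<rho>) * (cosh t / n)" by (simp add: algebra_simps)
      also have "\<dots> \<le> L * (exp \<bar>t\<bar> / n)"
        using L n0 by (intro mult_mono divide_right_mono cosh_le_exp_abs) (auto simp: L_def)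
      finally show ?thesis unfolding e .
    qed
    qed
    have Phi_h: "norm (\<Phi> h x) \<le> L * (4 * C / (1 * \<kappa> * pi)) * norm x"
      by (rule Phi_estimate[OF admissible _ bound]) simp
    let ?r = "R (- ?n) x"
    have nO: "- ?n \<in> \<Omega>" by (rule neg_in_Omega[OF n0])
    interpret R0: bounded_linear "R 0" by (rule R_bounded_linear[OF zero_in_Omega])
    have nr: "norm (?n *\<^sub>C ?r) \<le> C * norm x"
      using norm_ray_resolvent[of "- ?n" x] by (simp add: norm_scaleC)
    have adm1: "admissible (\<lambda>z. 1 / z * cayley_prod w n z)" by (rule admissible_cayley_prod[OF admissible_inverse wp])
    have adm2: "admissible (\<lambda>z. 1 / z / (- ?n - z))" by (rule admissible_resolvent[OF admissible_inverse]) simp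
    have adm3: "admissible (\<lambda>z. 1 / (- ?n - z))"
    proof (rule admissibleI[of _ 1 1])
      show "(\<lambda>z. 1 / (- ?n - z)) holomorphic_on {z. Re z > 0}"
        by (intro holomorphic_intros) (auto simp: complex_eq_iff)
      fix z assume "p \<le> Re z"
      then have z: "Re z > 0" using p_pos by linarith
      then have "cmod z > 0" by auto
      moreover have "cmod (- ?n - z) = cmod (z + ?n)"
        by (metis minus_add_distrib norm_minus_cancel add.commute diff_conv_add_uminus)
      ultimately show "cmod (1 / (- ?n - z)) \<le> 1 * cmod z powr - 1"
        using Re_pos_shift_norm(1)[OF z n0] by (simp add: norm_divide powr_minus divide_simps)
    qed simp
    \<comment> \<open>Apply \<open>-R 0\<close>, the operator with symbol \<open>1/z\<close>, to reach symbols of the calculus.\<close>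
    have "- R 0 (\<Phi> h x) = \<Phi> (\<lambda>z. h z / z) x"
      by (rule Phi_of_division_by_z[OF admissible, symmetric])
    also have "\<dots> = \<Phi> (\<lambda>z. 1 / z * cayley_prod w n z + 1 * (1 / (- ?n - z))) x"
    proof (rule Phi_cong)
      fix z :: complex assume z: "Re z > 0"
      then have "z \<noteq> 0" "z + ?n \<noteq> 0" using Re_pos_shift_nonzero[OF z n0] by auto
      moreover have "- ?n - z = - (z + ?n)" by simp
      ultimately show "h z / z = 1 / z * cayley_prod w n z + 1 * (1 / (- ?n - z))"
        unfolding h_def by (simp only: minus_divide_right[symmetric]) (simp add: diff_divide_distrib)
    qed
    also have "\<dots> = \<Phi> (\<lambda>z. 1 / z * cayley_prod w n z) x + 1 *\<^sub>C \<Phi> (\<lambda>z. 1 / (- ?n - z)) x"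
      by (rule Phi_symbol_lincomb[OF adm1 adm3])
    also have "\<Phi> (\<lambda>z. 1 / z * cayley_prod w n z) x = V_prod w n (- R 0 x)"
      using V_prod_Phi[OF admissible_inverse, where w = w and n = n and x = x] wp by (simp add: Phi_inverse)
    also have "\<dots> = - R 0 (V_prod w n x)"
      using V_prod_R0[where w = w and n = n and x = "- x"] V_prod_scaleC[where w = w and n = n and c = "-1" and x = x] wp
      by (simp add: R0.neg)
    also have "\<Phi> (\<lambda>z. 1 / (- ?n - z)) x = ?r"
    proof -
      have "- R 0 (\<Phi> (\<lambda>z. 1 / (- ?n - z)) x) = \<Phi> (\<lambda>z. 1 / (- ?n - z) / z) x"
        by (rule Phi_of_division_by_z[OF adm3, symmetric])
      also have "\<dots> = \<Phi> (\<lambda>z. 1 / z / (- ?n - z)) x" by (simp add: mult.commute)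
      also have "\<dots> = - R 0 ?r" using Phi_shift_inverse[OF n0] by (simp add: R0.neg)
      finally have "R 0 (\<Phi> (\<lambda>z. 1 / (- ?n - z)) x - ?r) = 0" by (simp add: R0.diff)
      from R0_inj[OF this] show ?thesis by simp
    qed
    finally have 1: "- R 0 (\<Phi> h x) = - R 0 (V_prod w n x) + 1 *\<^sub>C ?r" .
    have "R 0 x - ?r = (- ?n) *\<^sub>C R 0 ?r"
      using R_identity[OF nO zero_in_Omega, of x] by simp
    then have 2: "?r = R 0 (x + ?n *\<^sub>C ?r)"
      by (simp add: R0.add R_scaleC[OF zero_in_Omega] scaleC.minus_left algebra_simps)
    have "R 0 (V_prod w n x) + - R 0 (\<Phi> h x) = ?r" unfolding 1 by simp
    then have "R 0 (V_prod w n x - \<Phi> h x - (x + ?n *\<^sub>C ?r)) = 0"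
      using 2 by (simp add: R0.diff)
    from R0_inj[OF this] have "V_prod w n x = \<Phi> h x + (x + ?n *\<^sub>C ?r)"
      by (simp add: algebra_simps)
    then have "norm (V_prod w n x) \<le> norm (\<Phi> h x) + (norm x + norm (?n *\<^sub>C ?r))"
      by (metis norm_triangle_ineq norm_triangle_mono order_refl)
    also have "\<dots> \<le> L * (4 * C / (1 * \<kappa> * pi)) * norm x + (norm x + C * norm x)"
      by (intro add_mono Phi_h nr order_refl)
    also have "\<dots> = M * norm x" by (simp add: M_def algebra_simps)
    finally show ?thesis .
  qed
  then show ?thesis using M by blast
qed

end

section \<open>Everywhere defined operators as functions\<close>

text \<open>
  The everywhere defined operator given by a function.
\<close>

definition graph :: "('x \<Rightarrow> 'x) \<Rightarrow> 'x operator" where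
  "graph f = {(x, f x) |x. True}"

lemma in_graph [simp]: "(x, y) \<in> graph f \<longleftrightarrow> y = f x"
  by (auto simp: graph_def)

lemma op_fun_graph [simp]: "op_fun (graph f) = f"
  by (simp add: op_fun_def fun_eq_iff)

lemma op_mult_graph: "op_mult (graph f) (graph g) = graph (\<lambda>x. f (g x))"
  by (auto simp: op_mult_def graph_def)

lemma bounded_operator_iff:
  "bounded_operator T \<longleftrightarrow> (\<exists>f. bounded_linear f \<and> (\<forall>c x. f (c *\<^sub>C x) = c *\<^sub>C f x) \<and> T = graph f)"
  by (simp add: bounded_operator_def graph_def)

lemma graph_op_norm:
  assumes "bounded_linear f" "\<And>c x. f (c *\<^sub>C x) = c *\<^sub>C f x" "\<And>x. norm (f x) \<le> K * norm x" "0 \<le> K"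
  shows "bounded_operator (graph f) \<and> op_norm (graph f) \<le> K"
  using assms by (auto simp: bounded_operator_iff op_norm_def intro!: onorm_bound)

lemma op_add_scalar_iff:
  "(x, u) \<in> op_add (op_scale z Id) (op_scale (- 1) A) \<longleftrightarrow> (\<exists>y. (x, y) \<in> A \<and> u = z *\<^sub>C x - y)"
  by (auto simp: op_add_def op_scale_def)

lemma resolvent_iff: "(u, x) \<in> resolvent z A \<longleftrightarrow> (\<exists>y. (x, y) \<in> A \<and> u = z *\<^sub>C x - y)"
  by (simp add: resolvent_def op_add_scalar_iff)

section \<open>Resolvents\<close>

text \<open>
  The resolvent as a function; meaningful for \<open>z\<close> in the resolvent set.
\<close>

abbreviation res :: "('x::complex_normed_vector) operator \<Rightarrow> complex \<Rightarrow> 'x \<Rightarrow> 'x" where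
  "res A z \<equiv> op_fun (resolvent z A)"

context
  fixes A :: "('x::complex_banach) operator" and z :: complex
  assumes z: "z \<in> resolvent_set A"
begin

lemma resolvent_graph: "resolvent z A = graph (res A z)"
  and resolvent_bounded_linear: "bounded_linear (res A z)"
  and resolvent_scaleC: "res A z (c *\<^sub>C x) = c *\<^sub>C res A z x"
  using z by (auto simp: resolvent_set_def bounded_operator_iff)

lemma resolvent_in: "(res A z u, z *\<^sub>C res A z u - u) \<in> A"
proof -
  have "(u, res A z u) \<in> resolvent z A"
    by (subst resolvent_graph) simp
  then obtain y where y: "(res A z u, y) \<in> A" "u = z *\<^sub>C res A z u - y"
    by (auto simp: resolvent_iff)
  have "y = z *\<^sub>C res A z u - u"
    by (subst (2) y(2)) simp
  then show ?thesis using y(1) by simp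
qed

lemma resolvent_eqI: 
  assumes "(x, y) \<in> A" shows "res A z (z *\<^sub>C x - y) = x"
proof -
  have "(z *\<^sub>C x - y, x) \<in> resolvent z A"
    using assms by (auto simp: resolvent_iff)
  then have "(z *\<^sub>C x - y, x) \<in> graph (res A z)"
    by (simp only: resolvent_graph[symmetric])
  then show ?thesis by simp
qed

lemma in_operator_iff: "(x, y) \<in> A \<longleftrightarrow> x = res A z (z *\<^sub>C x - y)"
proof
  assume "x = res A z (z *\<^sub>C x - y)"
  then show "(x, y) \<in> A"
    using resolvent_in[of "z *\<^sub>C x - y"] by simp
qed (simp add: resolvent_eqI)

end

lemma resolvent_identity:
  fixes A :: "('x::complex_banach) operator"
  assumes "z \<in> resolvent_set A" "w \<in> resolvent_set A"
  shows "res A w x - res A z x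
    = (z - w) *\<^sub>C res A w (res A z x)"
proof -
  let ?R = "res A"
  interpret w: bounded_linear "?R w" by (rule resolvent_bounded_linear[OF assms(2)])
  have "?R w (w *\<^sub>C ?R z x - (z *\<^sub>C ?R z x - x)) = ?R z x"
    by (rule resolvent_eqI[OF assms(2) resolvent_in[OF assms(1)]])
  then have "w *\<^sub>C ?R w (?R z x) - (z *\<^sub>C ?R w (?R z x) - ?R w x) = ?R z x"
    by (simp only: w.diff resolvent_scaleC[OF assms(2)])
  then show ?thesis
    by (simp add: scaleC.diff_left algebra_simps)
qed

text \<open>
  A Neumann series argument in the form of a fixed point: \<open>x\<close> solves \<open>z x - A x = u\<close> if and only if
  \<open>x = R 0 u - z R 0 x\<close>.
\<close>

lemma resolvent_near_zero:
  fixes A :: "('x::complex_banach) operator"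
  assumes 0: "0 \<in> resolvent_set A" and B: "B > 0" "\<And>x. norm (res A 0 x) \<le> B * norm x"
    and z: "cmod z < 1 / (2 * B)"
  shows "z \<in> resolvent_set A" and "norm (res A z x) \<le> 2 * B * norm x"
proof -
  let ?R = "res A 0"
  interpret R: bounded_linear ?R by (rule resolvent_bounded_linear[OF 0])
  have small: "norm (z *\<^sub>C ?R x) \<le> 1 / 2 * norm x" for x
  proof -
    have "norm (z *\<^sub>C ?R x) \<le> cmod z * (B * norm x)"
      unfolding norm_scaleC by (intro mult_left_mono B) auto
    also have "\<dots> \<le> 1 / (2 * B) * (B * norm x)"
      using z B(1) by (intro mult_right_mono) auto
    finally show ?thesis using B(1) by simp
  qed
  have ex1: "\<exists>!x. ?R u - z *\<^sub>C ?R x = x" for u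
  proof (rule banach_fix_type[of "1 / 2"])
    have "dist (?R u - z *\<^sub>C ?R x) (?R u - z *\<^sub>C ?R y) \<le> 1 / 2 * dist x y" for x y
    proof -
      have "dist (?R u - z *\<^sub>C ?R x) (?R u - z *\<^sub>C ?R y) = norm (z *\<^sub>C ?R (y - x))"
        by (simp add: dist_norm R.diff scaleC.diff_right)
      also have "\<dots> \<le> 1 / 2 * norm (y - x)" by (rule small)
      finally show ?thesis by (simp add: dist_norm norm_minus_commute)
    qed
    then show "\<forall>x y. dist (?R u - z *\<^sub>C ?R x) (?R u - z *\<^sub>C ?R y) \<le> 1 / 2 * dist x y" by blast
  qed auto
  define f where "f = (\<lambda>u. THE x. ?R u - z *\<^sub>C ?R x = x)"
  have f: "?R u - z *\<^sub>C ?R (f u) = f u" for u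
    unfolding f_def by (rule theI'[OF ex1])
  have f_eqI: "f u = x" if "?R u - z *\<^sub>C ?R x = x" for u x
    using ex1 f that by blast
  have f_norm: "norm (f u) \<le> 2 * B * norm u" for u
  proof -
    have "norm (f u) \<le> norm (?R u) + norm (z *\<^sub>C ?R (f u))"
      using norm_triangle_ineq4[of "?R u" "z *\<^sub>C ?R (f u)"] by (simp only: f)
    also have "\<dots> \<le> B * norm u + 1 / 2 * norm (f u)" by (intro add_mono B small)
    finally show ?thesis by simp
  qed
  have f_scaleC: "f (c *\<^sub>C x) = c *\<^sub>C f x" for c x
  proof (rule f_eqI)
    have "c *\<^sub>C (?R x - z *\<^sub>C ?R (f x)) = c *\<^sub>C f x" by (simp only: f)
    then show "?R (c *\<^sub>C x) - z *\<^sub>C ?R (c *\<^sub>C f x) = c *\<^sub>C f x"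
      by (simp add: resolvent_scaleC[OF 0] scaleC.diff_right scaleC_scaleC mult.commute)
  qed
  have f_add: "f (x + y) = f x + f y" for x y
  proof (rule f_eqI)
    have "(?R x - z *\<^sub>C ?R (f x)) + (?R y - z *\<^sub>C ?R (f y)) = f x + f y" by (simp only: f)
    then show "?R (x + y) - z *\<^sub>C ?R (f x + f y) = f x + f y"
      by (simp add: R.add scaleC.add_right algebra_simps)
  qed
  have f_lin: "bounded_linear f"
  proof (rule bounded_linear_intro[of _ "2 * B"])
    show "f (s *\<^sub>R x) = s *\<^sub>R f x" for s x
      using f_scaleC[of "of_real s" x] by (simp add: scaleC_of_real)
  qed (use f_add f_norm in \<open>auto simp: mult.commute\<close>)
  have "(u, x) \<in> resolvent z A \<longleftrightarrow> x = f u" for u x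
  proof -
    have "(u, x) \<in> resolvent z A \<longleftrightarrow> (x, z *\<^sub>C x - u) \<in> A"
      unfolding resolvent_iff by (metis diff_diff_eq2 add_diff_cancel_left' add.commute diff_add_cancel)
    also have "\<dots> \<longleftrightarrow> x = ?R (u - z *\<^sub>C x)"
      using in_operator_iff[OF 0, of x "z *\<^sub>C x - u"] by (simp add: scaleC.zero_left)
    also have "\<dots> \<longleftrightarrow> ?R u - z *\<^sub>C ?R x = x"
      by (auto simp: R.diff resolvent_scaleC[OF 0])
    also have "\<dots> \<longleftrightarrow> x = f u" using f f_eqI by metis
    finally show ?thesis .
  qed
  then have g: "resolvent z A = graph f" by (auto simp: graph_def)
  show "z \<in> resolvent_set A"
    unfolding resolvent_set_def bounded_operator_iff using f_lin f_scaleC g by blast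
  show "norm (res A z x) \<le> 2 * B * norm x" by (simp add: g f_norm)
qed

lemma notin_closure_sector:
  assumes "0 \<le> \<theta>" "\<theta> \<le> \<theta>'" "\<theta>' < pi" "Re z < cos \<theta>' * cmod z"
  shows "z \<notin> closure (sector \<theta>)"
proof -
  have "sector \<theta> \<subseteq> {z. cos \<theta>' * cmod z \<le> Re z}"
  proof
    fix v assume v: "v \<in> sector \<theta>"
    show "v \<in> {z. cos \<theta>' * cmod z \<le> Re z}"
    proof (cases "\<theta> = 0")
      case True
      then obtain s where "v = of_real s" "s > 0" using v by (auto simp: sector_def)
      then show ?thesis using cos_le_one[of \<theta>'] by (simp add: mult_le_cancel_right1)
    next
      case False
      then have arg: "\<bar>Arg v\<bar> < \<theta>" "v \<noteq> 0" using v by (auto simp: sector_def)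
      have "cos \<theta>' \<le> cos \<bar>Arg v\<bar>" using arg assms by (intro cos_monotone_0_pi_le) auto
      then have "cmod v * cos \<theta>' \<le> cmod v * cos (Arg v)" by (intro mult_left_mono) auto
      also have "\<dots> = Re v" using arg(2) by (simp add: cos_Arg)
      finally show ?thesis by (simp add: mult.commute)
    qed
  qed
  moreover have "closed {z. cos \<theta>' * cmod z \<le> Re z}"
    by (intro closed_Collect_le continuous_intros)
  ultimately have "closure (sector \<theta>) \<subseteq> {z. cos \<theta>' * cmod z \<le> Re z}"
    by (rule closure_minimal)
  then show ?thesis using assms(4) by auto
qed

text \<open>
  The constants come from a sector of half-angle strictly between the angle of \<open>A\<close> and \<open>\<pi>/2\<close>, and from a
  disc about \<open>0\<close> on which \<open>resolvent_near_zero\<close> applies.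
\<close>

lemma sectorial_resolvent_exists:
  fixes A :: "('x::complex_banach) operator"
  assumes "A \<in> Sect_half_pi_minus" and 0: "0 \<in> resolvent_set A"
  obtains \<kappa> r C where "sectorial_resolvent (res A) \<kappa> r C"
    and "left_region \<kappa> r \<subseteq> resolvent_set A"
proof -
  let ?R = "res A"
  obtain \<theta> where \<theta>: "0 \<le> \<theta>" "\<theta> < pi / 2" and A: "A \<in> Sect \<theta>"
    using assms(1) by (auto simp: Sect_half_pi_minus_def)
  define \<theta>' where "\<theta>' = (\<theta> + pi / 2) / 2"
  have \<theta>': "\<theta> < \<theta>'" "\<theta>' < pi / 2" "\<theta>' < pi" "0 \<le> \<theta>'" using \<theta> by (auto simp: \<theta>'_def)
  define \<kappa> where "\<kappa> = cos \<theta>'"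
  have \<kappa>: "0 < \<kappa>" "\<kappa> \<le> 1" unfolding \<kappa>_def using \<theta>' by (auto intro!: cos_gt_zero_pi)
  have outside: "z \<in> resolvent_set A" "z \<in> - closure (sector \<theta>')" if "Re z < \<kappa> * cmod z" for z
  proof -
    have "z \<notin> closure (sector \<theta>)"
      by (rule notin_closure_sector[of \<theta> \<theta>']) (use \<theta> \<theta>' that in \<open>auto simp: \<kappa>_def\<close>)
    then show "z \<in> resolvent_set A" using A by (auto simp: Sect_def spectrum_def)
    show "z \<in> - closure (sector \<theta>')"
      using notin_closure_sector[of \<theta>' \<theta>' z] \<theta>' that by (auto simp: \<kappa>_def)
  qed
  have "bdd_above ((\<lambda>z. op_norm (op_scale z (resolvent z A))) ` (- closure (sector \<theta>')))"
    using A \<theta>' by (auto simp: Sect_def)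
  then obtain M where M: "\<And>z. z \<in> - closure (sector \<theta>') \<Longrightarrow> op_norm (op_scale z (resolvent z A)) \<le> M"
    by (auto simp: bdd_above_def)
  have M_bound: "cmod z * norm (?R z x) \<le> \<bar>M\<bar> * norm x" if z: "Re z < \<kappa> * cmod z" for z x
  proof -
    have bl: "bounded_linear (\<lambda>x. z *\<^sub>C ?R z x)"
      by (rule bounded_linear_compose[OF scaleC.bounded_linear_right
            resolvent_bounded_linear[OF outside(1)[OF z]]])
    have "op_scale z (resolvent z A) = graph (\<lambda>x. z *\<^sub>C ?R z x)"
      by (subst resolvent_graph[OF outside(1)[OF z]]) (auto simp: op_scale_def graph_def)
    then have "onorm (\<lambda>x. z *\<^sub>C ?R z x) \<le> M"
      using M[OF outside(2)[OF z]] by (simp add: op_norm_def)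
    then have "norm (z *\<^sub>C ?R z x) \<le> M * norm x"
      using onorm[OF bl, of x] mult_right_mono[of _ M "norm x"] by (meson norm_ge_zero order_trans)
    also have "\<dots> \<le> \<bar>M\<bar> * norm x" by (intro mult_right_mono) auto
    finally show ?thesis by (simp add: norm_scaleC)
  qed
  obtain B where B: "B > 0" "\<And>x. norm (?R 0 x) \<le> B * norm x"
    using bounded_linear.pos_bounded[OF resolvent_bounded_linear[OF 0]] by (auto simp: mult.commute)
  define r where "r = 1 / (2 * B)"
  have r: "r > 0" using B by (simp add: r_def)
  define C where "C = 2 * B * (1 + r) + (1 + 1 / r) * \<bar>M\<bar>"
  have C: "C \<ge> 0" using B r by (simp add: C_def)
  have sub: "left_region \<kappa> r \<subseteq> resolvent_set A"
    using outside(1) resolvent_near_zero(1)[OF 0 B] by (auto simp: left_region_def r_def)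
  have bound: "norm (?R z x) \<le> C / (1 + cmod z) * norm x" if z: "z \<in> left_region \<kappa> r" for z x
  proof -
    have "(1 + cmod z) * norm (?R z x) \<le> C * norm x"
    proof (cases "cmod z < r")
      case True
      then have "norm (?R z x) \<le> 2 * B * norm x"
        using resolvent_near_zero(2)[OF 0 B] by (simp add: r_def)
      then have "(1 + cmod z) * norm (?R z x) \<le> (1 + r) * (2 * B * norm x)"
        using True r by (intro mult_mono) auto
      also have "\<dots> \<le> C * norm x"
        using r by (simp add: C_def algebra_simps)
      finally show ?thesis .
    next
      case False
      then have z': "Re z < \<kappa> * cmod z" using z by (auto simp: left_region_def)
      have "1 + cmod z \<le> (1 + 1 / r) * cmod z"
        using False r by (simp add: field_simps)
      then have "(1 + cmod z) * norm (?R z x) \<le> (1 + 1 / r) * cmod z * norm (?R z x)"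
        by (intro mult_right_mono) auto
      also have "\<dots> = (1 + 1 / r) * (cmod z * norm (?R z x))" by (simp only: mult.assoc)
      also have "\<dots> \<le> (1 + 1 / r) * (\<bar>M\<bar> * norm x)"
        using r by (intro mult_left_mono M_bound z') auto
      also have "\<dots> \<le> C * norm x"
        using r B by (simp add: C_def distrib_right)
      finally show ?thesis .
    qed
    moreover have "0 < 1 + cmod z" by (simp add: add_pos_nonneg)
    ultimately show ?thesis by (simp add: pos_le_divide_eq mult.commute)
  qed
  have "sectorial_resolvent ?R \<kappa> r C"
  proof
    fix z w :: complex and x y :: 'x and c :: complex
    assume z: "z \<in> left_region \<kappa> r"
    then have zr: "z \<in> resolvent_set A" using sub by blast
    interpret bounded_linear "?R z" by (rule resolvent_bounded_linear[OF zr])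
    show "?R z (x + y) = ?R z x + ?R z y" by (rule add)
    show "?R z (c *\<^sub>C x) = c *\<^sub>C ?R z x" by (rule resolvent_scaleC[OF zr])
    show "norm (?R z x) \<le> C / (1 + cmod z) * norm x" by (rule bound[OF z])
    assume "w \<in> left_region \<kappa> r"
    then show "?R w x - ?R z x = (z - w) *\<^sub>C ?R w (?R z x)"
      using sub zr by (intro resolvent_identity) auto
  next
    fix x assume "?R 0 x = 0"
    then have 1: "(0, - x) \<in> A" using resolvent_in[OF 0, of x] by (simp add: scaleC.zero_left)
    have "linear_operator A" using A by (simp add: Sect_def)
    then have "single_valued A" "(0, 0) \<in> A" by (auto simp: linear_operator_def)
    then show "x = 0" using 1 by (auto dest: single_valuedD)
  qed (use \<kappa> r C in auto)
  then show thesis using sub that by blast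
qed

section \<open>The operators of the theorem\<close>

lemma contour_angle_bounds:
  assumes "A \<in> Sect_half_pi_minus"
  shows "pi / 2 \<le> contour_angle A" "contour_angle A < pi"
proof -
  obtain \<theta> where \<theta>: "\<theta> < pi / 2" "A \<in> Sect \<theta>"
    using assms by (auto simp: Sect_half_pi_minus_def)
  have nn: "\<And>t. t \<in> {\<theta>. A \<in> Sect \<theta>} \<Longrightarrow> 0 \<le> t" by (auto simp: Sect_def)
  have "0 \<le> sectoriality_angle A" unfolding sectoriality_angle_def
    by (rule cInf_greatest) (use \<theta> nn in auto)
  moreover have "sectoriality_angle A \<le> \<theta>" unfolding sectoriality_angle_def
    by (rule cInf_lower) (use \<theta> nn in \<open>auto intro!: bdd_belowI[of _ 0]\<close>)
  ultimately show "pi / 2 \<le> contour_angle A" "contour_angle A < pi"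
    using \<theta> by (auto simp: contour_angle_def)
qed

context
  fixes A :: "('x::complex_banach) operator" and \<kappa> r C :: real
  assumes SR: "sectorial_resolvent (res A) \<kappa> r C"
    and sub: "left_region \<kappa> r \<subseteq> resolvent_set A"
    and single_valued_A: "single_valued A"
begin

interpretation sectorial_resolvent "res A" \<kappa> r C
  by (rule SR)

lemma left_resolvent_set: "Re z \<le> 0 \<Longrightarrow> z \<in> resolvent_set A"
  using Omega_left sub by blast

lemma cayley_graph:
  assumes "\<nu> > 0" shows "cayley \<nu> A = graph (V \<nu>)"
proof -
  let ?R = "res A (- of_real \<nu>)"
  have n: "- complex_of_real \<nu> \<in> resolvent_set A"
    by (rule left_resolvent_set) (use assms in simp)
  interpret bounded_linear ?R by (rule resolvent_bounded_linear[OF n])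
  have "(u, v) \<in> cayley \<nu> A \<longleftrightarrow> v = V \<nu> u" for u v
  proof -
    have "(u, v) \<in> cayley \<nu> A \<longleftrightarrow>
        (\<exists>x y. (x, y) \<in> A \<and> u = y + of_real \<nu> *\<^sub>C x \<and> (\<exists>y'. (x, y') \<in> A \<and> v = y' - of_real \<nu> *\<^sub>C x))"
      by (auto simp: cayley_def op_mult_def op_add_def op_scale_def relcomp_unfold scaleC.minus_left)
    also have "\<dots> \<longleftrightarrow> v = V \<nu> u"
    proof
      assume "\<exists>x y. (x, y) \<in> A \<and> u = y + of_real \<nu> *\<^sub>C x \<and> (\<exists>y'. (x, y') \<in> A \<and> v = y' - of_real \<nu> *\<^sub>C x)"
      then obtain x y y' where xy: "(x, y) \<in> A" "u = y + of_real \<nu> *\<^sub>C x" "(x, y') \<in> A" "v = y' - of_real \<nu> *\<^sub>C x"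
        by blast
      have y: "y' = y" "y = u - of_real \<nu> *\<^sub>C x"
        using xy single_valued_A by (auto dest: single_valuedD)
      have "(- of_real \<nu>) *\<^sub>C x - y = - u" using xy(2) by (simp add: scaleC.minus_left)
      then have x: "x = - ?R u"
        using resolvent_eqI[OF n xy(1)] neg[of u] by simp
      have "v = u - of_real \<nu> *\<^sub>C x - of_real \<nu> *\<^sub>C x"
        using xy(4) unfolding y .
      also have "\<dots> = V \<nu> u"
        unfolding x V_def mult_2 of_real_add scaleC_add_left scaleC.minus_right by simp
      finally show "v = V \<nu> u" .
    next
      assume v: "v = V \<nu> u"
      show "\<exists>x y. (x, y) \<in> A \<and> u = y + of_real \<nu> *\<^sub>C x \<and> (\<exists>y'. (x, y') \<in> A \<and> v = y' - of_real \<nu> *\<^sub>C x)"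
      proof (intro exI conjI)
        show 1: "(- ?R u, u + of_real \<nu> *\<^sub>C ?R u) \<in> A"
          using resolvent_in[OF n, of "- u"]
          by (simp add: neg scaleC.minus_left scaleC.minus_right add.commute)
        show "u = (u + of_real \<nu> *\<^sub>C ?R u) + of_real \<nu> *\<^sub>C (- ?R u)"
          by (simp add: scaleC.minus_right)
        show "(- ?R u, u + of_real \<nu> *\<^sub>C ?R u) \<in> A" by (rule 1)
        show "v = (u + of_real \<nu> *\<^sub>C ?R u) - of_real \<nu> *\<^sub>C (- ?R u)"
          unfolding v V_def mult_2 of_real_add scaleC_add_left scaleC.minus_right by simp
      qed
    qed
    finally show ?thesis .
  qed
  then show ?thesis by auto
qed

lemma op_prod_cayley_graph:
  assumes "\<And>k. k \<ge> 1 \<Longrightarrow> w k > 0"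
  shows "op_prod (\<lambda>k. cayley (w k) A) n = graph (V_prod w n)"
proof (induction n)
  case 0
  then show ?case by (auto simp: graph_def)
next
  case (Suc n)
  have "V_prod w (Suc n) = (\<lambda>x. V_prod w n (V (w (Suc n)) x))" by (simp add: fun_eq_iff)
  then show ?case using Suc cayley_graph[OF assms, of "Suc n"] by (simp add: op_mult_graph)
qed

lemma one_plus_pow_iff: "(u, y) \<in> (op_add Id A) ^^ m \<longleftrightarrow> u = (E ^^ m) y"
proof -
  have n: "- 1 \<in> resolvent_set A" by (rule left_resolvent_set) simp
  interpret bounded_linear "res A (- 1)" by (rule resolvent_bounded_linear[OF n])
  have one: "(x, y) \<in> op_add Id A \<longleftrightarrow> x = E y" for x y
  proof -
    have "(x, y) \<in> op_add Id A \<longleftrightarrow> (x, y - x) \<in> A"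
      by (auto simp: op_add_def intro!: exI[of _ "y - x"])
    also have "\<dots> \<longleftrightarrow> x = res A (- 1) (- y)"
      using in_operator_iff[OF n, of x "y - x"] by simp
    finally show ?thesis by (simp add: E_def neg)
  qed
  show ?thesis
  proof (induction m arbitrary: y)
    case (Suc m)
    have "(u, y) \<in> (op_add Id A) ^^ Suc m \<longleftrightarrow> (\<exists>v. (u, v) \<in> (op_add Id A) ^^ m \<and> (v, y) \<in> op_add Id A)"
      by auto
    also have "\<dots> \<longleftrightarrow> u = (E ^^ m) (E y)" by (simp add: Suc one)
    finally show ?case by (simp only: funpow_Suc_right o_apply)
  qed auto
qed

lemma frac_power_inverse_graph:
  assumes A: "A \<in> Sect_half_pi_minus" and \<alpha>: "\<alpha> > 0"
  shows "(frac_power A \<alpha>)\<inverse> = graph (\<Phi> (\<lambda>z. z powr - of_real \<alpha>))"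
proof -
  define m where "m = nat \<lfloor>\<alpha>\<rfloor> + 1"
  have m: "\<alpha> < real m" using \<alpha> unfolding m_def by linarith
  note \<delta> = contour_angle_bounds[OF A]
  have line: "(\<lambda>s. (1 / (2 * of_real pi * \<i>)) *\<^sub>C
        (fc_integrand A (\<lambda>z. z powr of_real \<alpha> / (1 + z) ^ m) (exp (Complex s (- contour_angle A))) x
         - fc_integrand A (\<lambda>z. z powr of_real \<alpha> / (1 + z) ^ m) (exp (Complex s (contour_angle A))) x))
      = fc_line (contour_angle A) (frac_symbol \<alpha> m) x" for x
    by (simp add: fun_eq_iff fc_line_def fc_integrand_def ray_def frac_symbol_def)
  have "(x, y) \<in> frac_power A \<alpha> \<longleftrightarrow> x = \<Phi> (\<lambda>z. z powr - of_real \<alpha>) y" for x y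
  proof -
    have "(x, y) \<in> frac_power A \<alpha> \<longleftrightarrow>
        (\<exists>u. (fc_line (contour_angle A) (frac_symbol \<alpha> m) x has_integral u) UNIV \<and> (u, y) \<in> (op_add Id A) ^^ m)"
      using \<alpha> unfolding frac_power_def m_def[symmetric] Let_def op_mult_def primary_fc_def
      by (simp add: relcomp_unfold line)
    also have "\<dots> \<longleftrightarrow> x = \<Phi> (\<lambda>z. z powr - of_real \<alpha>) y"
      by (simp add: one_plus_pow_iff frac_power_char[OF \<delta> \<alpha> m])
    finally show ?thesis .
  qed
  then show ?thesis by auto
qed

end

theorem theorem3p2:
  fixes A :: "('x::complex_banach) operator" and \<alpha> \<omega>min \<omega>max :: real
  assumes "A \<in> Sect_half_pi_minus"
    and "0 \<in> resolvent_set A"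
    and "0 \<le> \<alpha>"
    and "0 < \<omega>min" and "\<omega>min \<le> \<omega>max"
  shows "\<exists>M>0. \<forall>n\<ge>1. \<forall>\<omega>\<in>shift_seqs \<omega>min \<omega>max.
           bounded_operator
             (op_mult (op_prod (\<lambda>k. cayley (\<omega> k) A) n) ((frac_power A \<alpha>)\<inverse>)) \<and>
           op_norm (op_mult (op_prod (\<lambda>k. cayley (\<omega> k) A) n) ((frac_power A \<alpha>)\<inverse>))
             \<le> M / real n powr \<alpha>"
proof -
  obtain \<kappa> r C where SR: "sectorial_resolvent (res A) \<kappa> r C"
    and sub: "left_region \<kappa> r \<subseteq> resolvent_set A"
    using sectorial_resolvent_exists[OF assms(1,2)] by blast
  interpret sectorial_resolvent "res A" \<kappa> r C by (rule SR)
  have sv: "single_valued A"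
    using assms(1) by (auto simp: Sect_half_pi_minus_def Sect_def linear_operator_def)
  note ctx = SR sub sv
  define S where "S = (if \<alpha> = 0 then (\<lambda>x. x) else \<Phi> (\<lambda>z. z powr - of_real \<alpha>))"
  have inv: "(frac_power A \<alpha>)\<inverse> = graph S"
    using frac_power_inverse_graph[OF ctx assms(1), of \<alpha>] assms(3)
    by (auto simp: S_def frac_power_def)
  have S_lin: "bounded_linear S" and S_scaleC: "\<And>c x. S (c *\<^sub>C x) = c *\<^sub>C S x"
    using assms(3) Phi_bounded_linear[OF admissible_powr] Phi_scaleC[OF admissible_powr] by (auto simp: S_def)
  obtain M where M: "M \<ge> 0" and est: "\<And>n w x. n \<ge> 1 \<Longrightarrow> (\<forall>k\<ge>1. \<omega>min \<le> w k \<and> w k \<le> \<omega>max) \<Longrightarrow>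
      norm (V_prod w n (S x)) \<le> M / real n powr \<alpha> * norm x"
  proof (cases "\<alpha> = 0")
    case True
    obtain M where "M \<ge> 0" "\<forall>n\<ge>1. \<forall>w x. (\<forall>k\<ge>1. \<omega>min \<le> w k \<and> w k \<le> \<omega>max) \<longrightarrow> norm (V_prod w n x) \<le> M * norm x"
      using power_bound_estimate[OF assms(4,5)] by blast
    then show thesis using True by (intro that[of M]) (auto simp: S_def)
  next
    case False
    then have \<alpha>: "\<alpha> > 0" using assms(3) by simp
    show thesis using decay_estimate[OF \<alpha> assms(4,5)] that False by (auto simp: S_def)
  qed
  show ?thesis
  proof (intro exI[of _ "M + 1"] conjI allI impI ballI)
    fix n :: nat and \<omega> assume n: "1 \<le> n" and \<omega>: "\<omega> \<in> shift_seqs \<omega>min \<omega>max"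
    then have w: "\<forall>k\<ge>1. \<omega>min \<le> \<omega> k \<and> \<omega> k \<le> \<omega>max" by (simp add: shift_seqs_def)
    have wp: "\<And>k. k \<ge> 1 \<Longrightarrow> \<omega> k > 0" using w assms(4) by (meson less_le_trans)
    let ?T = "op_mult (op_prod (\<lambda>k. cayley (\<omega> k) A) n) ((frac_power A \<alpha>)\<inverse>)"
    have T: "?T = graph (\<lambda>x. V_prod \<omega> n (S x))"
      using op_prod_cayley_graph[OF ctx wp] by (simp add: inv op_mult_graph)
    have "M / real n powr \<alpha> \<le> (M + 1) / real n powr \<alpha>" by (intro divide_right_mono) auto
    then have "norm (V_prod \<omega> n (S x)) \<le> (M + 1) / real n powr \<alpha> * norm x" for x
      by (rule order_trans[OF est[OF n w] mult_right_mono]) simp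
    then have "bounded_operator ?T \<and> op_norm ?T \<le> (M + 1) / real n powr \<alpha>"
      unfolding T using M
      by (intro graph_op_norm bounded_linear_compose[OF V_prod_bounded_linear[OF wp] S_lin])
        (auto simp: S_scaleC V_prod_scaleC[OF wp])
    then show "bounded_operator ?T" "op_norm ?T \<le> (M + 1) / real n powr \<alpha>" by auto
  qed (use M in simp)
qed

end
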